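(* Let $\mathbf T$ be the triangular lattice, $\Lambda\subseteq\mathbf T$ finite and connected, $n\ge1$, and let $V=\{v_1,\dots,v_n\}\subseteq\Lambda^{\mathrm{in}}$ be a good set of $n$ points. (1) The joint cumulants of the average degree field $\mathcal X_v=\frac16\deg_T(v)$ of the uniform spanning tree $T$ on $\Lambda$ with wired boundary conditions are $$\kappa(\mathcal X_v:v\in V)=\kappa^{\mathbf 0}_\Lambda(X_v:v\in V)=-\Bigl(\frac{-1}6\Bigr)^n\sum_{\sigma\in S_{\mathrm{cycl}}(V)}\ \sum_{\eta:V\to\tilde E_o}\ \prod_{v\in V}\nabla^{(1)}_{\eta(v)}\nabla^{(2)}_{\eta(\sigma(v))}G_\Lambda(v,\sigma(v)).$$ (2) For $\mathcal E\subseteq\tilde E(V)$ and $v\in V$ put $\mathcal E_v=\{f\in\mathcal E:f^-=v\}\subseteq\tilde E_v$. The joint cumulants of the height-one field $h_\Lambda$ of the Abelian sandpile model on $\Lambda$ are $$\kappa(h_\Lambda(v):v\in V)=\kappa^{\mathbf 0}_\Lambda(X_vY_v:v\in V)=\Bigl(\frac{-1}6\Bigr)^n\sum_{\substack{\mathcal E\subseteq\tilde E(V)\\|\mathcal E_v|\ge1\ \forall v}}K(\mathcal E)\sum_{\tau\in S_{\mathrm{co}}(\mathcal E)}\mathrm{sign}(\tau)\prod_{f\in\mathcal E}M(f,\tau(f)),$$ where $K(\mathcal E)=\prod_{v\in V}K(\mathcal E_v)$, $K(\mathcal E_v)=(-1)^{|\mathcal E_v|}|\mathcal E_v|$.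
   Context: Triangular lattice. $\tilde e_j=(\cos\frac{\pi(j-1)}3,\sin\frac{\pi(j-1)}3)$, $j=1,\dots,6$; $\tilde E_o=\{\tilde e_1,\dots,\tilde e_6\}$; $\mathbf T=\{a_1\tilde e_1+a_2\tilde e_2:a_1,a_2\in\mathbb Z\}$, with $v\sim w$ iff $w-v\in\tilde E_o$. $\tilde E_v$ is the set of the six edges $(v,v+\tilde e_j)$, $\tilde E(V)=\bigcup_{v\in V}\tilde E_v$; an edge $f=(f^-,f^+)$ has direction $\eta^*(f)=f^+-f^-$. $\Lambda^{\mathrm{in}}$ is the set of points of $\Lambda$ all of whose neighbours lie in $\Lambda$. $\Delta_\Lambda(u,v)$ ($u,v\in\Lambda$) is $-6$ if $u=v$, $1$ if $u\sim v$, $0$ otherwise; $G_\Lambda=(-\Delta_\Lambda)^{-1}$, extended by $0$ outside $\Lambda$. $\nabla^{(1)}_{e}\nabla^{(2)}_{e'}f(u,v)=f(u+e,v+e')-f(u+e,v)-f(u,v+e')+f(u,v)$. $M(f,f')=\nabla^{(1)}_{\eta^*(f)}\nabla^{(2)}_{\eta^*(f')}G_\Lambda(f^-,f'^-)$. $\Lambda^g$ is the wired graph obtained by identifying all vertices outside $\Lambda$ adjacent to $\Lambda$ with a ghost vertex $g$ (keeping multiple edges); $T$ is uniform on spanning trees of $\Lambda^g$. $A\subseteq\Lambda$ is good if no two points of $A$ are nearest neighbours and each $v\in\Lambda\setminus A$ is joined to $g$ by a nearest-neighbour path in $\Lambda^g$ disjoint from $A$. Permutations. $S_{\mathrm{cycl}}(V)$: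 permutations of $V$ consisting of one cycle of length $|V|$ (the identity if $|V|=1$). For $\mathcal E\subseteq\tilde E(V)$ with all $\mathcal E_v\neq\emptyset$ and a permutation $\tau$ of $\mathcal E$, $V_\tau$ is the multigraph on $V$ with, for each pair $v\ne w$, one edge for each $f\in\mathcal E_v,f'\in\mathcal E_w$ with $\tau(f)=f'$ or $\tau(f')=f$; $S_{\mathrm{co}}(\mathcal E)$ is the set of $\tau$ with $V_\tau$ connected. Sandpile. Markov chain on $\{1,\dots,6\}^\Lambda$: add one grain at a uniform site; a site with height $>6$ topples (loses $6$ grains, each neighbour in $\Lambda$ gains one, grains sent outside $\Lambda$ are lost) until stable; the unique stationary measure is uniform on recurrent configurations, and $h_\Lambda(v)=\mathbf 1_{\{\rho(v)=1\}}$ for $\rho$ stationary. Grassmann algebra. $\Omega^{2\Lambda}$ is the real Grassmann algebra with generators $\psi_v,\bar\psi_v$, $v\in\Lambda$ (pairwise anticommuting, squares zero). $\partial_\xi$ is the left derivative: on a monomial $\xi_{i_1}\cdots\xi_{i_p}$ with $\xi=\xi_{i_\alpha}$ it gives $(-1)^{\alpha-1}$ times the monomial with $\xi_{i_\alpha}$ removed; $0$ if $\xi$ does not occur. $\exp$ is defined by its (finite) power series. $$\langle F\rangle^{\mathbf 0}_\Lambda=\frac1{\det(-\Delta_\Lambda)}\Bigl(\prod_{v\in\Lambda}\partial_{\bar\psi_v}\partial_{\psi_v}\Bigr)\exp\Bigl(\sum_{u,v\in\Lambda}\psi_u(-\Delta_\Lambda(u,v))\bar\psi_v\Bigr)F .$$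 With $\nabla_e\psi(v)=\psi_{v+e}-\psi_v$ and likewise for $\bar\psi$: $X_v=\frac16\sum_{e\in\tilde E_o}\nabla_e\psi(v)\nabla_e\bar\psi(v)$, $Y_v=\prod_{e\in\tilde E_o}(1-\nabla_e\psi(v)\nabla_e\bar\psi(v))$. $\kappa^{\mathbf 0}_\Lambda(W_v:v\in V)=\sum_{\pi\in\Pi(V)}(|\pi|-1)!\,(-1)^{|\pi|-1}\prod_{B\in\pi}\langle\prod_{v\in B}W_v\rangle^{\mathbf 0}_\Lambda$, $\Pi(V)$ the set of partitions of $V$; $\kappa$ for random variables denotes usual joint cumulants (same formula with expectations). *)

theory Defs
  imports "HOL-Probability.Probability" "HOL-Combinatorics.Orbits"
begin

section \<open>The triangular lattice\<close>

type_synonym point = "real \<times> real"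

definition lattice_dir :: "nat \<Rightarrow> point" where
  "lattice_dir j = (cos (pi * (real j - 1) / 3), sin (pi * (real j - 1) / 3))"

definition unit_dirs :: "point set" where
  "unit_dirs = lattice_dir ` {1..6}"

definition tri_lattice :: "point set" where
  "tri_lattice = {of_int a *\<^sub>R lattice_dir 1 + of_int b *\<^sub>R lattice_dir 2 | a b :: int. True}"

definition nn :: "point \<Rightarrow> point \<Rightarrow> bool" where
  "nn v w \<longleftrightarrow> w - v \<in> unit_dirs"

definition lattice_connected :: "point set \<Rightarrow> bool" where
  "lattice_connected L \<longleftrightarrow> (\<forall>u\<in>L. \<forall>v\<in>L. (u, v) \<in> {(a, b). a \<in> L \<and> b \<in> L \<and> nn a b}\<^sup>*)"

definition lattice_interior :: "point set \<Rightarrow> point set" where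
  "lattice_interior L = {v \<in> L. \<forall>e\<in>unit_dirs. v + e \<in> L}"

text \<open>A directed edge is the pair of its tail and its head.\<close>

type_synonym dedge = "point \<times> point"

definition edges_from :: "point set \<Rightarrow> dedge set" where
  "edges_from V = {(v, v + e) | v e. v \<in> V \<and> e \<in> unit_dirs}"

definition edge_dir :: "dedge \<Rightarrow> point" where
  "edge_dir f = snd f - fst f"

definition edges_at :: "dedge set \<Rightarrow> point \<Rightarrow> dedge set" where
  "edges_at E v = {f \<in> E. fst f = v}"


section \<open>Laplacian and Green's function\<close>

text \<open>Matrices indexed by a finite set \<open>S\<close> are functions of two arguments that are only evaluated
  on \<open>S\<close>; the determinant is given by the Leibniz formula, as for \<^const>\<open>det\<close>.\<close>

definition det_on :: "'a set \<Rightarrow> ('a \<Rightarrow> 'a \<Rightarrow> real) \<Rightarrow> real" where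
  "det_on S A = (\<Sum>p | p permutes S. of_int (sign p) * (\<Prod>i\<in>S. A i (p i)))"

definition inverse_on :: "'a set \<Rightarrow> ('a \<Rightarrow> 'a \<Rightarrow> real) \<Rightarrow> ('a \<Rightarrow> 'a \<Rightarrow> real)" where
  "inverse_on S A = (THE B.
     (\<forall>u\<in>S. \<forall>w\<in>S. (\<Sum>v\<in>S. A u v * B v w) = of_bool (u = w) \<and>
                  (\<Sum>v\<in>S. B u v * A v w) = of_bool (u = w)) \<and>
     (\<forall>u w. u \<notin> S \<or> w \<notin> S \<longrightarrow> B u w = 0))"

text \<open>On \<open>L \<times> L\<close> this kernel is the Laplacian with Dirichlet boundary conditions on \<open>L\<close>.\<close>

definition lattice_laplacian :: "point \<Rightarrow> point \<Rightarrow> real" where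
  "lattice_laplacian u v = (if u = v then -6 else if nn u v then 1 else 0)"

definition green :: "point set \<Rightarrow> point \<Rightarrow> point \<Rightarrow> real" where
  "green L = inverse_on L (\<lambda>u v. - lattice_laplacian u v)"

definition mixed_diff :: "point \<Rightarrow> point \<Rightarrow> (point \<Rightarrow> point \<Rightarrow> real) \<Rightarrow> point \<Rightarrow> point \<Rightarrow> real" where
  "mixed_diff e e' f u v = f (u + e) (v + e') - f (u + e) v - f u (v + e') + f u v"

definition transfer_current :: "point set \<Rightarrow> dedge \<Rightarrow> dedge \<Rightarrow> real" where
  "transfer_current L f f' = mixed_diff (edge_dir f) (edge_dir f') (green L) (fst f) (fst f')"


section \<open>Multigraphs\<close>

text \<open>An undirected multigraph is given by a vertex set, a set \<open>E\<close> of edge names and a map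
  \<open>ends\<close> sending an edge to its set of (one or two) end points.\<close>

definition multi_adj :: "'e set \<Rightarrow> ('e \<Rightarrow> 'v set) \<Rightarrow> ('v \<times> 'v) set" where
  "multi_adj E ends = {(a, b). \<exists>e\<in>E. ends e = {a, b}}"

definition multi_connected :: "'v set \<Rightarrow> 'e set \<Rightarrow> ('e \<Rightarrow> 'v set) \<Rightarrow> bool" where
  "multi_connected W E ends \<longleftrightarrow>
     (\<forall>a\<in>W. \<forall>b\<in>W. (a, b) \<in> (multi_adj E ends \<inter> W \<times> W)\<^sup>*)"

text \<open>Cycles of length one (loops) and two (parallel edges) are included.\<close>

definition multi_cycle :: "'e set \<Rightarrow> ('e \<Rightarrow> 'v set) \<Rightarrow> 'v list \<Rightarrow> 'e list \<Rightarrow> bool" where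
  "multi_cycle E ends vs es \<longleftrightarrow>
     es \<noteq> [] \<and> length vs = length es \<and> distinct vs \<and> distinct es \<and> set es \<subseteq> E \<and>
     (\<forall>i<length es. ends (es ! i) = {vs ! i, vs ! (Suc i mod length es)})"

definition multi_spanning_tree :: "'v set \<Rightarrow> 'e set \<Rightarrow> ('e \<Rightarrow> 'v set) \<Rightarrow> 'e set \<Rightarrow> bool" where
  "multi_spanning_tree W E ends F \<longleftrightarrow>
     F \<subseteq> E \<and> multi_connected W F ends \<and> (\<nexists>vs es. multi_cycle F ends vs es)"


section \<open>The wired graph and its uniform spanning tree\<close>

text \<open>The ghost vertex is \<^const>\<open>None\<close>. Naming an edge of the wired graph by the lattice edge it
  comes from keeps parallel edges to the ghost apart. Lattice edges with both end points outside
  \<open>L\<close> would become loops at the ghost and are left out.\<close>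

definition wired_verts :: "point set \<Rightarrow> point option set" where
  "wired_verts L = insert None (Some ` L)"

definition wired_edges :: "point set \<Rightarrow> point set set" where
  "wired_edges L = {{u, w} | u w. u \<in> L \<and> w \<in> tri_lattice \<and> nn u w}"

definition wired_ends :: "point set \<Rightarrow> point set \<Rightarrow> point option set" where
  "wired_ends L d = (\<lambda>x. if x \<in> L then Some x else None) ` d"

definition wired_spanning_trees :: "point set \<Rightarrow> point set set set" where
  "wired_spanning_trees L =
     {F. multi_spanning_tree (wired_verts L) (wired_edges L) (wired_ends L) F}"

definition ust :: "point set \<Rightarrow> point set set pmf" where
  "ust L = pmf_of_set (wired_spanning_trees L)"

text \<open>No edge at a vertex of \<open>L\<close> is a loop, so the degree just counts the edges at \<open>v\<close>.\<close>

definition tree_degree :: "point set set \<Rightarrow> point \<Rightarrow> nat" where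
  "tree_degree F v = card {d \<in> F. v \<in> d}"

definition avg_degree :: "point \<Rightarrow> point set set \<Rightarrow> real" where
  "avg_degree v F = real (tree_degree F v) / 6"

definition good :: "point set \<Rightarrow> point set \<Rightarrow> bool" where
  "good L A \<longleftrightarrow> A \<subseteq> L \<and> (\<forall>u\<in>A. \<forall>v\<in>A. \<not> nn u v) \<and>
     (let W = wired_verts L - Some ` A in
       \<forall>v\<in>L - A. (Some v, None) \<in> (multi_adj (wired_edges L) (wired_ends L) \<inter> W \<times> W)\<^sup>*)"


section \<open>The Abelian sandpile model\<close>

definition sandpile_configs :: "point set \<Rightarrow> (point \<Rightarrow> nat) set" where
  "sandpile_configs L = L \<rightarrow>\<^sub>E {1..6}"

definition topple :: "point set \<Rightarrow> point \<Rightarrow> (point \<Rightarrow> nat) \<Rightarrow> (point \<Rightarrow> nat)" where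
  "topple L v \<rho> = (\<lambda>w\<in>L. if w = v then \<rho> w - 6 else if nn v w then \<rho> w + 1 else \<rho> w)"

definition toppling :: "point set \<Rightarrow> (point \<Rightarrow> nat) \<Rightarrow> (point \<Rightarrow> nat) \<Rightarrow> bool" where
  "toppling L \<rho> \<rho>' \<longleftrightarrow> (\<exists>v\<in>L. \<rho> v > 6 \<and> \<rho>' = topple L v \<rho>)"

definition stabilize :: "point set \<Rightarrow> (point \<Rightarrow> nat) \<Rightarrow> (point \<Rightarrow> nat)" where
  "stabilize L \<rho> = (THE \<rho>'. (toppling L)\<^sup>*\<^sup>* \<rho> \<rho>' \<and> (\<forall>v\<in>L. \<rho>' v \<le> 6))"

definition sandpile_step :: "point set \<Rightarrow> (point \<Rightarrow> nat) \<Rightarrow> (point \<Rightarrow> nat) pmf" where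
  "sandpile_step L \<rho> = map_pmf (\<lambda>v. stabilize L (\<rho>(v := \<rho> v + 1))) (pmf_of_set L)"

definition sandpile_stationary :: "point set \<Rightarrow> (point \<Rightarrow> nat) pmf" where
  "sandpile_stationary L =
     (THE \<mu>. set_pmf \<mu> \<subseteq> sandpile_configs L \<and> bind_pmf \<mu> (sandpile_step L) = \<mu>)"

definition height_one :: "point \<Rightarrow> (point \<Rightarrow> nat) \<Rightarrow> real" where
  "height_one v \<rho> = of_bool (\<rho> v = 1)"


section \<open>Cumulants\<close>

text \<open>\<open>m B\<close> is the moment of the variables indexed by \<open>B\<close>.\<close>

definition cumulant_of_moments :: "('i set \<Rightarrow> real) \<Rightarrow> 'i set \<Rightarrow> real" where
  "cumulant_of_moments m V =
     (\<Sum>P | partition_on V P. fact (card P - 1) * (-1) ^ (card P - 1) * (\<Prod>B\<in>P. m B))"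

definition joint_cumulant :: "'a pmf \<Rightarrow> ('i \<Rightarrow> 'a \<Rightarrow> real) \<Rightarrow> 'i set \<Rightarrow> real" where
  "joint_cumulant p W V =
     cumulant_of_moments (\<lambda>B. measure_pmf.expectation p (\<lambda>\<omega>. \<Prod>v\<in>B. W v \<omega>)) V"


section \<open>Real Grassmann algebras\<close>

text \<open>The Grassmann algebra on a linearly ordered set of generators has the monomials
  \<open>\<xi>\<^sub>1 \<cdots> \<xi>\<^sub>p\<close> with \<open>\<xi>\<^sub>1 < \<cdots> < \<xi>\<^sub>p\<close> as a basis. Such a monomial is represented by the finite set of
  its generators, and an element by its finitely many nonzero coefficients.\<close>

typedef 'g grassmann =
  "{f :: 'g set \<Rightarrow> real. finite {S. f S \<noteq> 0} \<and> (\<forall>S. f S \<noteq> 0 \<longrightarrow> finite S)}"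
  morphisms gcoeff Abs_grassmann
  by (rule exI[of _ "\<lambda>_. 0"]) simp

setup_lifting type_definition_grassmann

lemma finite_gcoeff_support [simp]: "finite {S. gcoeff f S \<noteq> 0}"
  and gcoeff_infinite [simp]: "infinite S \<Longrightarrow> gcoeff f S = 0"
  using gcoeff[of f] by auto

lemma grassmann_eqI: "(\<And>S. finite S \<Longrightarrow> gcoeff f S = gcoeff g S) \<Longrightarrow> f = g"
  by (metis gcoeff_infinite gcoeff_inject ext)

text \<open>The sign relating the product of the ordered monomials on \<open>A\<close> and on \<open>B\<close> to the ordered
  monomial on \<open>A \<union> B\<close>, for disjoint \<open>A\<close> and \<open>B\<close>.\<close>

definition shuffle_sign :: "'g::linorder set \<Rightarrow> 'g set \<Rightarrow> real" where
  "shuffle_sign A B = (-1) ^ card {(a, b). a \<in> A \<and> b \<in> B \<and> b < a}"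

lemma shuffle_sign_Un_left:
  assumes "finite A" "finite B" "finite C" "A \<inter> B = {}"
  shows "shuffle_sign (A \<union> B) C = shuffle_sign A C * shuffle_sign B C"
proof -
  have fin: "finite {(a, b). a \<in> X \<and> b \<in> C \<and> b < a}" if "finite X" for X :: "'a set"
    by (rule finite_subset[of _ "X \<times> C"]) (use that assms in auto)
  have "{(a, b). a \<in> A \<union> B \<and> b \<in> C \<and> b < a} =
        {(a, b). a \<in> A \<and> b \<in> C \<and> b < a} \<union> {(a, b). a \<in> B \<and> b \<in> C \<and> b < a}" by auto
  moreover have "{(a, b). a \<in> A \<and> b \<in> C \<and> b < a} \<inter> {(a, b). a \<in> B \<and> b \<in> C \<and> b < a} = {}"
    using assms(4) by auto
  ultimately show ?thesis
    unfolding shuffle_sign_def using fin assms by (simp add: card_Un_disjoint power_add)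
qed

lemma shuffle_sign_Un_right:
  assumes "finite A" "finite B" "finite C" "B \<inter> C = {}"
  shows "shuffle_sign A (B \<union> C) = shuffle_sign A B * shuffle_sign A C"
proof -
  have fin: "finite {(a, b). a \<in> A \<and> b \<in> X \<and> b < a}" if "finite X" for X :: "'a set"
    by (rule finite_subset[of _ "A \<times> X"]) (use that assms in auto)
  have "{(a, b). a \<in> A \<and> b \<in> B \<union> C \<and> b < a} =
        {(a, b). a \<in> A \<and> b \<in> B \<and> b < a} \<union> {(a, b). a \<in> A \<and> b \<in> C \<and> b < a}" by auto
  moreover have "{(a, b). a \<in> A \<and> b \<in> B \<and> b < a} \<inter> {(a, b). a \<in> A \<and> b \<in> C \<and> b < a} = {}"
    using assms(4) by auto
  ultimately show ?thesis
    unfolding shuffle_sign_def using fin assms by (simp add: card_Un_disjoint power_add)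
qed

lemma shuffle_sign_empty [simp]: "shuffle_sign {} B = 1" "shuffle_sign A {} = 1"
  by (simp_all add: shuffle_sign_def)

instantiation grassmann :: (type) real_vector
begin

lift_definition zero_grassmann :: "'a grassmann" is "\<lambda>_. 0" by simp

lift_definition plus_grassmann :: "'a grassmann \<Rightarrow> 'a grassmann \<Rightarrow> 'a grassmann"
  is "\<lambda>f g S. f S + g S"
  subgoal for f g
    by (auto intro: finite_subset[of _ "{S. f S \<noteq> 0} \<union> {S. g S \<noteq> 0}"])
       (metis add.right_neutral)
  done

lift_definition minus_grassmann :: "'a grassmann \<Rightarrow> 'a grassmann \<Rightarrow> 'a grassmann"
  is "\<lambda>f g S. f S - g S"
  subgoal for f g
    by (auto intro: finite_subset[of _ "{S. f S \<noteq> 0} \<union> {S. g S \<noteq> 0}"]) metis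
  done

lift_definition uminus_grassmann :: "'a grassmann \<Rightarrow> 'a grassmann"
  is "\<lambda>f S. - f S" by simp

lift_definition scaleR_grassmann :: "real \<Rightarrow> 'a grassmann \<Rightarrow> 'a grassmann"
  is "\<lambda>c f S. c * f S"
  subgoal for c f by (auto intro: finite_subset[of _ "{S. f S \<noteq> 0}"])
  done

instance
  by standard (transfer; simp add: fun_eq_iff algebra_simps)+

end

instantiation grassmann :: (linorder) real_algebra_1
begin

lift_definition one_grassmann :: "'a grassmann" is "\<lambda>S. of_bool (S = {})" by simp

lift_definition times_grassmann :: "'a grassmann \<Rightarrow> 'a grassmann \<Rightarrow> 'a grassmann"
  is "\<lambda>f g S. if finite S then \<Sum>A\<in>Pow S. shuffle_sign A (S - A) * f A * g (S - A) else 0"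
proof (intro conjI)
  fix f g :: "'a set \<Rightarrow> real"
  assume f: "finite {S. f S \<noteq> 0} \<and> (\<forall>S. f S \<noteq> 0 \<longrightarrow> finite S)"
    and g: "finite {S. g S \<noteq> 0} \<and> (\<forall>S. g S \<noteq> 0 \<longrightarrow> finite S)"
  let ?h = "\<lambda>S. if finite S then \<Sum>A\<in>Pow S. shuffle_sign A (S - A) * f A * g (S - A) else 0"
  have "{S. ?h S \<noteq> 0} \<subseteq> (\<lambda>(A, B). A \<union> B) ` ({S. f S \<noteq> 0} \<times> {S. g S \<noteq> 0})"
  proof
    fix S assume "S \<in> {S. ?h S \<noteq> 0}"
    then have "(\<Sum>A\<in>Pow S. shuffle_sign A (S - A) * f A * g (S - A)) \<noteq> 0"
      by (auto split: if_splits)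
    then obtain A where "A \<in> Pow S" "shuffle_sign A (S - A) * f A * g (S - A) \<noteq> 0"
      using sum.not_neutral_contains_not_neutral by blast
    then show "S \<in> (\<lambda>(A, B). A \<union> B) ` ({S. f S \<noteq> 0} \<times> {S. g S \<noteq> 0})"
      by (intro image_eqI[of _ _ "(A, S - A)"]) auto
  qed
  then show "finite {S. ?h S \<noteq> 0}"
    by (rule finite_subset) (use f g in auto)
  show "\<forall>S. ?h S \<noteq> 0 \<longrightarrow> finite S" by simp
qed

lemma gcoeff_times:
  "finite S \<Longrightarrow> gcoeff (f * g) S =
     (\<Sum>A\<in>Pow S. shuffle_sign A (S - A) * gcoeff f A * gcoeff g (S - A))"
  for f g :: "'a grassmann"
  by (simp add: times_grassmann.rep_eq)

instance
proof
  fix a b c :: "'a grassmann" and r :: real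
  show "a * b * c = a * (b * c)"
  proof (rule grassmann_eqI)
    fix S :: "'a set" assume S: "finite S"
    let ?t = "\<lambda>A B. shuffle_sign A B * shuffle_sign A (S - (A \<union> B)) * shuffle_sign B (S - (A \<union> B))
                 * gcoeff a A * gcoeff b B * gcoeff c (S - (A \<union> B))"
    have "gcoeff (a * b * c) S =
      (\<Sum>D\<in>Pow S. \<Sum>A\<in>Pow D. shuffle_sign D (S - D) *
         (shuffle_sign A (D - A) * gcoeff a A * gcoeff b (D - A)) * gcoeff c (S - D))"
      unfolding gcoeff_times[OF S]
    proof (rule sum.cong)
      fix D assume "D \<in> Pow S"
      then have "finite D" using finite_subset[OF _ S] by blast
      then show "shuffle_sign D (S - D) * gcoeff (a * b) D * gcoeff c (S - D) =
        (\<Sum>A\<in>Pow D. shuffle_sign D (S - D) *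
          (shuffle_sign A (D - A) * gcoeff a A * gcoeff b (D - A)) * gcoeff c (S - D))"
        by (simp add: gcoeff_times sum_distrib_left sum_distrib_right)
    qed simp
    also have "\<dots> = (\<Sum>(D, A)\<in>(SIGMA D:Pow S. Pow D). shuffle_sign D (S - D) *
         (shuffle_sign A (D - A) * gcoeff a A * gcoeff b (D - A)) * gcoeff c (S - D))"
      using S by (subst sum.Sigma) (auto intro: finite_subset)
    also have "\<dots> = (\<Sum>(A, B)\<in>(SIGMA A:Pow S. Pow (S - A)). ?t A B)"
    proof (rule sum.reindex_bij_witness[of _ "\<lambda>(A, B). (A \<union> B, A)" "\<lambda>(D, A). (A, D - A)"],
           goal_cases)
      case (5 x)
      obtain D A where x: "x = (D, A)" by force
      with 5 have *: "D \<subseteq> S" "A \<subseteq> D" by auto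
      then have fin: "finite D" "finite A"
        using finite_subset[OF _ S] finite_subset[of A S] S by (blast, blast)
      have un: "A \<union> (D - A) = D" "A \<union> D = D" using * by auto
      have "shuffle_sign D (S - D) = shuffle_sign A (S - D) * shuffle_sign (D - A) (S - D)"
        using shuffle_sign_Un_left[of A "D - A" "S - D"] fin S unfolding un by blast
      then show ?case by (simp add: x un)
    qed auto
    also have "\<dots> = (\<Sum>A\<in>Pow S. \<Sum>B\<in>Pow (S - A). ?t A B)"
      using S by (subst sum.Sigma) auto
    also have "\<dots> = gcoeff (a * (b * c)) S"
      unfolding gcoeff_times[OF S]
    proof (rule sum.cong)
      fix A assume A: "A \<in> Pow S"
      have fin: "finite A" "finite (S - A)" using finite_subset[of A S] A S by auto
      have "?t A B = shuffle_sign A (S - A) * gcoeff a A *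
               (shuffle_sign B (S - A - B) * gcoeff b B * gcoeff c (S - A - B))"
        if "B \<in> Pow (S - A)" for B
      proof -
        have "S - A = B \<union> (S - (A \<union> B))" "S - A - B = S - (A \<union> B)" using that by auto
        moreover have "shuffle_sign A (B \<union> (S - (A \<union> B))) =
            shuffle_sign A B * shuffle_sign A (S - (A \<union> B))"
          by (rule shuffle_sign_Un_right) (use that fin S finite_subset[OF _ fin(2)] in auto)
        ultimately show ?thesis by simp
      qed
      then show "(\<Sum>B\<in>Pow (S - A). ?t A B) =
          shuffle_sign A (S - A) * gcoeff a A * gcoeff (b * c) (S - A)"
        unfolding gcoeff_times[OF fin(2)] sum_distrib_left by (rule sum.cong[OF refl])
    qed simp
    finally show "gcoeff (a * b * c) S = gcoeff (a * (b * c)) S" .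
  qed
  show "(a + b) * c = a * c + b * c"
    by (rule grassmann_eqI)
       (simp add: gcoeff_times plus_grassmann.rep_eq algebra_simps sum.distrib)
  show "a * (b + c) = a * b + a * c"
    by (rule grassmann_eqI)
       (simp add: gcoeff_times plus_grassmann.rep_eq algebra_simps sum.distrib)
  show "1 * a = a"
  proof (rule grassmann_eqI)
    fix S :: "'a set" assume S: "finite S"
    have "gcoeff (1 * a) S = (\<Sum>A\<in>Pow S. if A = {} then gcoeff a S else 0)"
      unfolding gcoeff_times[OF S] by (rule sum.cong) (auto simp: one_grassmann.rep_eq)
    then show "gcoeff (1 * a) S = gcoeff a S" using S by simp
  qed
  show "a * 1 = a"
  proof (rule grassmann_eqI)
    fix S :: "'a set" assume S: "finite S"
    have "gcoeff (a * 1) S = (\<Sum>A\<in>Pow S. if A = S then gcoeff a S else 0)"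
      unfolding gcoeff_times[OF S] by (rule sum.cong) (auto simp: one_grassmann.rep_eq)
    then show "gcoeff (a * 1) S = gcoeff a S" using S by simp
  qed
  show "(0 :: 'a grassmann) \<noteq> 1"
    by transfer (auto simp: fun_eq_iff)
  show "r *\<^sub>R a * b = r *\<^sub>R (a * b)"
    by (rule grassmann_eqI)
       (simp add: gcoeff_times scaleR_grassmann.rep_eq sum_distrib_left mult_ac)
  show "a * r *\<^sub>R b = r *\<^sub>R (a * b)"
    by (rule grassmann_eqI)
       (simp add: gcoeff_times scaleR_grassmann.rep_eq sum_distrib_left mult_ac)
qed

end

lift_definition gvar :: "'g \<Rightarrow> 'g grassmann" is "\<lambda>x S. of_bool (S = {x})"
  by simp

lift_definition gderiv :: "'g::linorder \<Rightarrow> 'g grassmann \<Rightarrow> 'g grassmann"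
  is "\<lambda>x f S. if x \<in> S then 0 else (-1) ^ card {y \<in> S. y < x} * f (insert x S)"
proof (intro conjI)
  fix x :: 'g and f :: "'g set \<Rightarrow> real"
  assume f: "finite {S. f S \<noteq> 0} \<and> (\<forall>S. f S \<noteq> 0 \<longrightarrow> finite S)"
  let ?h = "\<lambda>S. if x \<in> S then 0 else (-1) ^ card {y \<in> S. y < x} * f (insert x S)"
  have "{S. ?h S \<noteq> 0} \<subseteq> (\<lambda>S. S - {x}) ` {S. f S \<noteq> 0}"
  proof
    fix S assume "S \<in> {S. ?h S \<noteq> 0}"
    then show "S \<in> (\<lambda>S. S - {x}) ` {S. f S \<noteq> 0}"
      by (intro image_eqI[of _ _ "insert x S"]) (auto split: if_splits)
  qed
  then show "finite {S. ?h S \<noteq> 0}" by (rule finite_subset) (use f in auto)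
  show "\<forall>S. ?h S \<noteq> 0 \<longrightarrow> finite S" using f by auto
qed

text \<open>The exponential series; its sum is finite for nilpotent elements, the only ones to which it
  is applied here.\<close>

definition gexp :: "'g::linorder grassmann \<Rightarrow> 'g grassmann" where
  "gexp F = (\<Sum>k | F ^ k \<noteq> 0. (1 / fact k) *\<^sub>R F ^ k)"

text \<open>Product of a family of pairwise commuting elements, so that no order of the finite index
  set has to be chosen.\<close>

definition comm_prod :: "('i \<Rightarrow> 'a::monoid_mult) \<Rightarrow> 'i set \<Rightarrow> 'a" where
  "comm_prod W I = Finite_Set.fold (\<lambda>i. (*) (W i)) 1 I"


section \<open>The fermionic Gaussian free field\<close>

text \<open>The order on generators only fixes the monomial basis; any linear order would do. There are
  generators for all points, and the algebra of a finite set \<open>L\<close> is the subalgebra generated by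
  those with points in \<open>L\<close>.\<close>

datatype gen = Psi point | PsiBar point

fun gen_key :: "gen \<Rightarrow> nat \<times> point" where
  "gen_key (Psi v) = (0, v)"
| "gen_key (PsiBar v) = (1, v)"

instantiation gen :: linorder
begin

definition less_gen :: "gen \<Rightarrow> gen \<Rightarrow> bool" where
  "less_gen x y = (case (gen_key x, gen_key y) of ((i, a, b), (j, c, d)) \<Rightarrow>
     i < j \<or> i = j \<and> (a < c \<or> a = c \<and> b < d))"

definition less_eq_gen :: "gen \<Rightarrow> gen \<Rightarrow> bool" where
  "less_eq_gen x y \<longleftrightarrow> x < y \<or> x = y" for x y :: gen

instance
proof
  fix x y z :: gen
  show "x < y \<longleftrightarrow> x \<le> y \<and> \<not> y \<le> x"
    by (cases x; cases y) (auto simp: less_gen_def less_eq_gen_def)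
  show "x \<le> x" by (simp add: less_eq_gen_def)
  show "x \<le> y \<Longrightarrow> y \<le> z \<Longrightarrow> x \<le> z"
    by (cases x; cases y; cases z) (auto simp: less_gen_def less_eq_gen_def)
  show "x \<le> y \<Longrightarrow> y \<le> x \<Longrightarrow> x = y"
    by (cases x; cases y) (auto simp: less_gen_def less_eq_gen_def)
  show "x \<le> y \<or> y \<le> x"
    by (cases x; cases y) (auto simp: less_gen_def less_eq_gen_def)
qed

end

definition psi :: "point \<Rightarrow> gen grassmann" where "psi v = gvar (Psi v)"

definition psibar :: "point \<Rightarrow> gen grassmann" where "psibar v = gvar (PsiBar v)"

text \<open>The operators \<open>\<partial>\<^bsub>\<psi>bar v\<^esub> \<partial>\<^bsub>\<psi> v\<^esub>\<close> for different \<open>v\<close> commute. Applied to an element of the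
  algebra of \<open>L\<close>, their product over \<open>L\<close> gives a scalar, which is read off as the coefficient of
  the empty monomial.\<close>

definition berezin :: "point set \<Rightarrow> gen grassmann \<Rightarrow> real" where
  "berezin L F =
     gcoeff (Finite_Set.fold (\<lambda>v G. gderiv (PsiBar v) (gderiv (Psi v) G)) F L) {}"

definition fgff :: "point set \<Rightarrow> gen grassmann \<Rightarrow> real" where
  "fgff L F =
     berezin L (gexp (\<Sum>u\<in>L. \<Sum>v\<in>L. psi u * (- lattice_laplacian u v) *\<^sub>R psibar v) * F)
       / det_on L (\<lambda>u v. - lattice_laplacian u v)"

definition grad :: "(point \<Rightarrow> gen grassmann) \<Rightarrow> point \<Rightarrow> point \<Rightarrow> gen grassmann" where
  "grad \<phi> e v = \<phi> (v + e) - \<phi> v"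

definition X_field :: "point \<Rightarrow> gen grassmann" where
  "X_field v = (1 / 6) *\<^sub>R (\<Sum>e\<in>unit_dirs. grad psi e v * grad psibar e v)"

definition Y_field :: "point \<Rightarrow> gen grassmann" where
  "Y_field v = comm_prod (\<lambda>e. 1 - grad psi e v * grad psibar e v) unit_dirs"

definition fgff_cumulant :: "point set \<Rightarrow> (point \<Rightarrow> gen grassmann) \<Rightarrow> point set \<Rightarrow> real" where
  "fgff_cumulant L W V = cumulant_of_moments (\<lambda>B. fgff L (comm_prod W B)) V"


section \<open>Permutations\<close>

definition cyclic_perms :: "'a set \<Rightarrow> ('a \<Rightarrow> 'a) set" where
  "cyclic_perms V = {\<sigma>. \<sigma> permutes V \<and> cyclic_on \<sigma> V}"

text \<open>The edge of the multigraph contributed by \<open>f\<close> and \<open>f'\<close> is named \<open>{f, f'}\<close>.\<close>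

definition perm_graph_edges :: "dedge set \<Rightarrow> (dedge \<Rightarrow> dedge) \<Rightarrow> dedge set set" where
  "perm_graph_edges E \<tau> =
     {{f, f'} | f f'. f \<in> E \<and> f' \<in> E \<and> fst f \<noteq> fst f' \<and> (\<tau> f = f' \<or> \<tau> f' = f)}"

definition connected_perms :: "point set \<Rightarrow> dedge set \<Rightarrow> (dedge \<Rightarrow> dedge) set" where
  "connected_perms V E =
     {\<tau>. \<tau> permutes E \<and> multi_connected V (perm_graph_edges E \<tau>) (\<lambda>d. fst ` d)}"

definition edge_weight :: "point set \<Rightarrow> dedge set \<Rightarrow> real" where
  "edge_weight V E = (\<Prod>v\<in>V. (-1) ^ card (edges_at E v) * real (card (edges_at E v)))"

end

theory Submission
  imports Defs "Jordan_Normal_Form.Determinant"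
begin

text \<open>
  Why the theorem holds. All four fields are polynomials in ``edge variables'' attached to the
  directed edges \<open>f\<close> at the sites of \<open>V\<close>. For the fermionic fields the variable of \<open>f = (v, w)\<close> is
  \<open>\<zeta>\<^sub>f = (\<psi>\<^sub>w - \<psi>\<^sub>v) (\<psi>bar\<^sub>w - \<psi>bar\<^sub>v)\<close>, for the spanning tree \<open>T\<close> it is the indicator of the event that
  \<open>T\<close> uses the edge \<open>{v, w}\<close>. The point is that both kinds of variables have the same moments: for
  every set \<open>E\<close> of directed edges starting in \<open>V\<close>, the fermionic expectation of \<open>\<Prod>f\<in>E. \<zeta>\<^sub>f\<close> and the
  probability that \<open>T\<close> contains \<open>E\<close> are both the minor \<open>det (M f g)\<^bsub>f,g\<in>E\<^esub>\<close> of the transfer current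
  matrix (\<open>fgff_prod_zeta\<close>, \<open>card_trees_containing\<close>). In either case the inclusion-exclusion sum
  over the subsets of \<open>E\<close> is easier than the moment itself. Since \<open>\<zeta>\<^sub>f\<close> is even with square zero,
  multiplying the Gaussian weight by \<open>\<Prod>f\<in>E. 1 - \<zeta>\<^sub>f = exp (- (\<Sum>f\<in>E. \<zeta>\<^sub>f))\<close> only changes the quadratic form in
  the exponent, namely into the Laplacian of the graph without the edges \<open>E\<close>; and by the matrix-tree
  theorem the determinant of that Laplacian counts the spanning trees avoiding \<open>E\<close>. A low rank update of
  the determinant, which brings in the Green's function, turns the common value into a sum of
  minors of the transfer current matrix.

  The degree of \<open>T\<close> at \<open>v\<close> is the sum of the six edge variables at \<open>v\<close>, exactly as \<open>6 X\<^sub>v\<close> is the sum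
  of the six \<open>\<zeta>\<^sub>f\<close>. The polynomial of \<open>X\<^sub>v Y\<^sub>v\<close> is \<open>1/6\<close> times the one for
  ``exactly one of the six edges is present'', so that it corresponds to the event that \<open>v\<close> is a
  leaf of \<open>T\<close>. For the sandpile one needs that the probability of height one on a set \<open>B\<close> is
  \<open>6\<^bsup>-|B|\<^esup>\<close> times the probability that all sites of \<open>B\<close> are leaves: removing \<open>B\<close> from the graph is a
  bijection on the configurations with height one on \<open>B\<close>, attaching the sites of \<open>B\<close> as leaves in
  all \<open>6\<^bsup>|B|\<^esup>\<close> possible ways produces the trees, and on the smaller graph there are as many recurrent
  configurations as spanning trees (\<open>card_recurrent_all_one_eq_leaves\<close>). The last fact and the
  matrix-tree theorem have the same proof: the number of spanning trees, the number of recurrent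
  configurations and the determinant of the Laplacian satisfy the same recursion when an edge at the
  root is deleted or contracted. That the sandpile is stationary exactly under the uniform measure on
  recurrent configurations is derived from the Abelian property and the burning algorithm
  (\<open>sandpile_stationary_uniform\<close>).

  It remains to compute cumulants of moments of the form
  \<open>m B = (\<Sum>E. (\<Prod>v\<in>B. a (E\<^sub>v)) * det M\<^sub>E)\<close>, the sum being over the edge sets over \<open>B\<close>. Expanding the
  determinant gives a sum over permutations \<open>\<tau>\<close> of \<open>E\<close>; cutting out the connected component of a
  fixed site in the graph of \<open>\<tau>\<close> gives the recursion between moments and cumulants, so that the
  cumulant is the part of the sum with connected \<open>\<tau>\<close> (\<open>cumulant_det_moment\<close>). If there is just one
  edge at every site, a connected permutation is the same as a cyclic permutation of the sites.
\<close>

section \<open>Determinants over finite index sets\<close>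

lemma det_on_empty [simp]: "det_on {} A = 1"
  by (simp add: det_on_def)

lemma det_on_cong:
  assumes "\<And>i j. i \<in> S \<Longrightarrow> j \<in> S \<Longrightarrow> A i j = B i j"
  shows "det_on S A = det_on S B"
  unfolding det_on_def
  by (intro sum.cong refl arg_cong2[where f="(*)"] prod.cong) (auto intro!: assms simp: permutes_in_image)

text \<open>Split the permutations in the Leibniz formula by whether they fix \<open>v\<close>: only those that do see the
  change of the diagonal entry.\<close>

lemma det_on_add_diag:
  assumes "finite S" "v \<in> S"
  shows "det_on S (\<lambda>i j. A i j + of_bool (i = v \<and> j = v)) = det_on S A + det_on (S - {v}) A"
proof -
  have *: "(\<Prod>i\<in>S. A i (p i) + of_bool (i = v \<and> p i = v)) =
      (\<Prod>i\<in>S. A i (p i)) + of_bool (p v = v) * (\<Prod>i\<in>S - {v}. A i (p i))" for p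
  proof -
    have "(\<Prod>i\<in>S - {v}. A i (p i) + of_bool (i = v \<and> p i = v)) = (\<Prod>i\<in>S - {v}. A i (p i))"
      by (rule prod.cong) auto
    then show ?thesis
      using prod.remove[OF assms, of "\<lambda>i. A i (p i) + of_bool (i = v \<and> p i = v)"]
        prod.remove[OF assms, of "\<lambda>i. A i (p i)"] by (simp add: algebra_simps)
  qed
  have fix_eq: "{p. p permutes S} \<inter> {p. p v = v} = {p. p permutes (S - {v})}"
    using assms(2) permutes_superset[of _ S "S - {v}"]
    by (auto intro: permutes_subset dest: permutes_not_in)
  have fin: "finite {p. p permutes S}" using assms(1) by (rule finite_permutations)
  have "det_on S (\<lambda>i j. A i j + of_bool (i = v \<and> j = v)) = det_on S A +
      (\<Sum>p | p permutes S. of_bool (p v = v) * (of_int (sign p) * (\<Prod>i\<in>S - {v}. A i (p i))))"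
    unfolding det_on_def * by (simp add: algebra_simps sum.distrib)
  also have "(\<Sum>p | p permutes S. of_bool (p v = v) * (of_int (sign p) * (\<Prod>i\<in>S - {v}. A i (p i)))) =
      det_on (S - {v}) A"
    unfolding det_on_def fix_eq[symmetric] using fin
    by (simp add: sum.inter_restrict of_bool_def if_distrib[of "\<lambda>x. x * _"] cong: if_cong)
  finally show ?thesis .
qed

lemma det_on_add_identity:
  assumes "finite S"
  shows "det_on S (\<lambda>i j. of_bool (i = j) + A i j) = (\<Sum>K\<in>Pow S. det_on K A)"
proof -
  have "det_on S (\<lambda>i j. A i j + of_bool (i = j \<and> i \<in> J)) = (\<Sum>K\<in>Pow J. det_on (S - K) A)"
    if "finite J" "J \<subseteq> S" "finite S" for J S A
    using that
  proof (induction J arbitrary: S A rule: finite_induct)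
    case empty
    then show ?case by simp
  next
    case (insert v J)
    let ?A = "\<lambda>i j. A i j + of_bool (i = j \<and> i \<in> J)"
    have "det_on S (\<lambda>i j. A i j + of_bool (i = j \<and> i \<in> insert v J)) =
        det_on S (\<lambda>i j. ?A i j + of_bool (i = v \<and> j = v))"
      using insert.hyps by (intro det_on_cong) auto
    also have "\<dots> = det_on S ?A + det_on (S - {v}) ?A"
      using insert.prems by (intro det_on_add_diag) auto
    also have "det_on S ?A = (\<Sum>K\<in>Pow J. det_on (S - K) A)"
      using insert.prems by (intro insert.IH) auto
    also have "det_on (S - {v}) ?A = (\<Sum>K\<in>Pow J. det_on (S - {v} - K) A)"
      using insert.prems insert.hyps by (intro insert.IH) auto
    also have "\<dots> = (\<Sum>K\<in>insert v ` Pow J. det_on (S - K) A)"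
    proof (rule sum.reindex_cong[of "\<lambda>K. K - {v}"])
      show "inj_on (\<lambda>K. K - {v}) (insert v ` Pow J)" using insert.hyps by (auto simp: inj_on_def)
      show "Pow J = (\<lambda>K. K - {v}) ` insert v ` Pow J" using insert.hyps by (force simp: image_image)
      show "det_on (S - {v} - (K - {v})) A = det_on (S - K) A" if "K \<in> insert v ` Pow J" for K
        using that by (intro arg_cong2[where f=det_on]) auto
    qed
    finally show ?case
      using insert.hyps by (subst Pow_insert, subst sum.union_disjoint) auto
  qed
  from this[OF assms order.refl assms, of A]
  have "det_on S (\<lambda>i j. of_bool (i = j) + A i j) = (\<Sum>K\<in>Pow S. det_on (S - K) A)"
    by (subst det_on_cong[where B="\<lambda>i j. A i j + of_bool (i = j \<and> i \<in> S)"]) auto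
  also have "\<dots> = (\<Sum>K\<in>Pow S. det_on K A)"
    by (rule sum.reindex_bij_witness[of _ "\<lambda>K. S - K" "\<lambda>K. S - K"]) auto
  finally show ?thesis .
qed

lemma det_on_uminus: "finite S \<Longrightarrow> det_on S (\<lambda>i j. - A i j) = (-1) ^ card S * det_on S A"
  unfolding det_on_def by (simp add: prod_uminus sum_distrib_left mult_ac)

lemma permutes_image_lt: "p permutes {0..<n} \<Longrightarrow> i < n \<Longrightarrow> p i < (n::nat)"
  using permutes_in_image[of p "{0..<n}" i] by simp

lemma bij_betw_map_permutation:
  assumes "bij_betw e T S"
  shows "bij_betw (map_permutation T e) {p. p permutes T} {p. p permutes S}"
proof -
  have inj: "inj_on e T" "inj_on (inv_into T e) S"
    using assms by (auto simp: bij_betw_def inj_on_inv_into)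
  show ?thesis
  proof (rule bij_betwI[of _ _ _ "map_permutation S (inv_into T e)"])
    show "map_permutation S (inv_into T e) (map_permutation T e p) = p" if "p \<in> {p. p permutes T}" for p
      using that assms by (intro map_permutation_compose_inv) (auto simp: bij_betw_def)
    show "map_permutation T e (map_permutation S (inv_into T e) p) = p" if "p \<in> {p. p permutes S}" for p
      using that assms
      by (intro map_permutation_compose_inv bij_betw_inv_into) (auto simp: bij_betw_def f_inv_into_f)
  qed (use assms bij_betw_inv_into[OF assms] in \<open>auto intro: map_permutation_permutes\<close>)
qed

text \<open>Conjugating permutations with an enumeration of the index set preserves their sign, so determinants over
  arbitrary finite index sets inherit what is known for matrices.\<close>

lemma det_on_reindex:
  assumes e: "bij_betw e T S" and "finite T"
  shows "det_on S A = det_on T (\<lambda>i j. A (e i) (e j))"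
proof -
  have inj: "inj_on e T" using e by (simp add: bij_betw_def)
  have "det_on S A = (\<Sum>p | p permutes T. of_int (sign (map_permutation T e p)) *
      (\<Prod>x\<in>S. A x (map_permutation T e p x)))"
    unfolding det_on_def by (rule sum.reindex_bij_betw[OF bij_betw_map_permutation[OF e], symmetric])
  also have "\<dots> = det_on T (\<lambda>i j. A (e i) (e j))"
    unfolding det_on_def
  proof (intro sum.cong refl)
    fix p assume p: "p \<in> {p. p permutes T}"
    have "(\<Prod>x\<in>S. A x (map_permutation T e p x)) = (\<Prod>i\<in>T. A (e i) (map_permutation T e p (e i)))"
      by (rule prod.reindex_bij_betw[OF e, symmetric])
    then show "of_int (sign (map_permutation T e p)) * (\<Prod>x\<in>S. A x (map_permutation T e p x)) =
        of_int (sign p) * (\<Prod>i\<in>T. A (e i) (e (p i)))"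
      using p inj assms(2) by (simp add: map_permutation_apply sign_map_permutation)
  qed
  finally show ?thesis .
qed

lemma det_on_eq_det:
  assumes "bij_betw e {0..<n} S"
  shows "det_on S A = det (mat n n (\<lambda>(i, j). A (e i) (e j)))"
proof -
  have "det_on S A = det_on {0..<n} (\<lambda>i j. A (e i) (e j))"
    by (rule det_on_reindex[OF assms finite_atLeastLessThan])
  then show ?thesis
    unfolding det_def det_on_def[of "{0..<n}"]
    by (auto simp: permutes_image_lt intro!: sum.cong prod.cong arg_cong2[where f="(*)"])
qed

lemma det_on_eq_0_if_row_sums_0:
  assumes "finite S" "S \<noteq> {}" "\<And>u. u \<in> S \<Longrightarrow> (\<Sum>v\<in>S. A u v) = 0"
  shows "det_on S A = 0"
proof -
  obtain e where e: "bij_betw e {0..<card S} S" using ex_bij_betw_nat_finite[OF assms(1)] by blast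
  let ?n = "card S"
  let ?A = "mat ?n ?n (\<lambda>(i, j). A (e i) (e j))"
  have n: "?n > 0" using assms by (simp add: card_gt_0_iff)
  have eS: "e i \<in> S" if "i < ?n" for i using e that by (auto simp: bij_betw_def)
  have "?A *\<^sub>v vec ?n (\<lambda>_. 1) = 0\<^sub>v ?n"
  proof (rule eq_vecI)
    fix i assume "i < dim_vec (0\<^sub>v ?n :: real vec)"
    then have i: "i < ?n" by simp
    have "(?A *\<^sub>v vec ?n (\<lambda>_. 1)) $ i = (\<Sum>j\<in>{0..<?n}. A (e i) (e j))"
      using i by (simp add: scalar_prod_def)
    also have "\<dots> = (\<Sum>v\<in>S. A (e i) v)" by (rule sum.reindex_bij_betw[OF e])
    finally show "(?A *\<^sub>v vec ?n (\<lambda>_. 1)) $ i = (0\<^sub>v ?n) $ i" using assms(3)[OF eS[OF i]] i by simp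
  qed simp
  moreover have "vec ?n (\<lambda>_. 1) \<noteq> (0\<^sub>v ?n :: real vec)"
  proof
    assume "vec ?n (\<lambda>_. 1) = (0\<^sub>v ?n :: real vec)"
    then have "vec ?n (\<lambda>_. 1) $ 0 = (0\<^sub>v ?n :: real vec) $ 0" by simp
    then show False using n by simp
  qed
  moreover have "?A \<in> carrier_mat ?n ?n" by simp
  ultimately have "det ?A = 0" unfolding det_0_iff_vec_prod_zero[OF \<open>?A \<in> _\<close>]
    using vec_carrier by blast
  then show ?thesis using det_on_eq_det[OF e] by simp
qed

text \<open>The block matrix with rows \<open>(A, P)\<close> and \<open>(Q, 1)\<close> has two factorisations into
  triangular block matrices; comparing their determinants gives the identity.\<close>

lemma det_one_minus_mult:
  fixes A :: "real mat"
  assumes A: "A \<in> carrier_mat n n" and G: "G \<in> carrier_mat n n" and AG: "A * G = 1\<^sub>m n"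
    and P: "P \<in> carrier_mat n m" and Q: "Q \<in> carrier_mat m n"
  shows "det (A - P * Q) = det A * det (1\<^sub>m m - Q * (G * P))"
proof -
  let ?B = "four_block_mat A P Q (1\<^sub>m m)"
  have PQ: "P * Q \<in> carrier_mat n n" and GP: "G * P \<in> carrier_mat n m"
    and QGP: "Q * (G * P) \<in> carrier_mat m m"
    using P Q G by auto
  have APQ: "A - P * Q \<in> carrier_mat n n" using PQ by (rule minus_carrier_mat)
  have LB: "four_block_mat (A - P * Q) P (0\<^sub>m m n) (1\<^sub>m m) \<in> carrier_mat (n + m) (n + m)"
    using APQ by (rule four_block_carrier_mat) simp
  have z: "A - P * Q + P * Q = A" "Q * (G * P) + (1\<^sub>m m - Q * (G * P)) = 1\<^sub>m m" "A * (G * P) = P"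
    using A P Q G PQ QGP assoc_mult_mat[OF A G P] AG by (auto simp: left_mult_one_mat[OF P])
  have "?B = four_block_mat (A - P * Q) P (0\<^sub>m m n) (1\<^sub>m m) * four_block_mat (1\<^sub>m n) (0\<^sub>m n m) Q (1\<^sub>m m)"
    by (subst mult_four_block_mat[of _ n n _ m _ m _ _ n _ m])
       (use A P Q PQ z in auto)
  also have "det \<dots> = det (A - P * Q)"
    using A P Q PQ
    by (subst det_mult[of _ "n + m"]) (simp_all add: LB det_four_block_mat_lower_left_zero[OF APQ P refl one_carrier_mat]
        det_four_block_mat_upper_right_zero[OF one_carrier_mat refl Q one_carrier_mat])
  finally have 1: "det ?B = det (A - P * Q)" .
  have R: "1\<^sub>m m - Q * (G * P) \<in> carrier_mat m m" using QGP by (rule minus_carrier_mat)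
  have LB': "four_block_mat A (0\<^sub>m n m) Q (1\<^sub>m m - Q * (G * P)) \<in> carrier_mat (n + m) (n + m)"
    using A R by (rule four_block_carrier_mat)
  have RB': "four_block_mat (1\<^sub>m n) (G * P) (0\<^sub>m m n) (1\<^sub>m m) \<in> carrier_mat (n + m) (n + m)"
    by (rule four_block_carrier_mat) auto
  have blocks: "A * 1\<^sub>m n + 0\<^sub>m n m * 0\<^sub>m m n = A" "A * (G * P) + 0\<^sub>m n m * 1\<^sub>m m = P"
    "Q * 1\<^sub>m n + (1\<^sub>m m - Q * (G * P)) * 0\<^sub>m m n = Q"
    "Q * (G * P) + (1\<^sub>m m - Q * (G * P)) * 1\<^sub>m m = 1\<^sub>m m"
    using A P Q z R by simp_all
  have "?B = four_block_mat A (0\<^sub>m n m) Q (1\<^sub>m m - Q * (G * P)) * four_block_mat (1\<^sub>m n) (G * P) (0\<^sub>m m n) (1\<^sub>m m)"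
    by (subst mult_four_block_mat[OF A zero_carrier_mat Q R one_carrier_mat GP zero_carrier_mat one_carrier_mat])
      (simp only: blocks)
  also have "det \<dots> = det A * det (1\<^sub>m m - Q * (G * P))"
    unfolding det_mult[OF LB' RB'] det_four_block_mat_upper_right_zero[OF A refl Q R]
      det_four_block_mat_lower_left_zero[OF one_carrier_mat GP refl one_carrier_mat] by simp
  finally have 2: "det ?B = det A * det (1\<^sub>m m - Q * (G * P))" .
  show ?thesis using 1 2 by simp
qed

text \<open>With \<open>A\<close> the Laplacian and \<open>a = b\<close> the incidence vectors of some edges, the left-hand
  side is the Laplacian after deleting these edges, and the matrix on the right is the identity minus the transfer
  current matrix.\<close>

lemma det_on_low_rank_update:
  assumes "finite S" "finite E"
    and G: "\<And>u w. u \<in> S \<Longrightarrow> w \<in> S \<Longrightarrow> (\<Sum>v\<in>S. A u v * G v w) = of_bool (u = w)"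
  shows "det_on S (\<lambda>u v. A u v - (\<Sum>f\<in>E. a f u * b f v)) =
    det_on S A * det_on E (\<lambda>f g. of_bool (f = g) - (\<Sum>u\<in>S. \<Sum>v\<in>S. b f u * G u v * a g v))"
proof -
  let ?n = "card S" and ?m = "card E"
  obtain e where e: "bij_betw e {0..<?n} S" using ex_bij_betw_nat_finite[OF assms(1)] by blast
  obtain h where h: "bij_betw h {0..<?m} E" using ex_bij_betw_nat_finite[OF assms(2)] by blast
  have eS: "e i \<in> S" if "i < ?n" for i using e that by (auto simp: bij_betw_def)
  have e_eq: "e i = e j \<longleftrightarrow> i = j" if "i < ?n" "j < ?n" for i j
    using e that by (auto simp: bij_betw_def inj_on_def)
  have h_eq: "h i = h j \<longleftrightarrow> i = j" if "i < ?m" "j < ?m" for i j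
    using h that by (auto simp: bij_betw_def inj_on_def)
  have sum_e: "(\<Sum>i\<in>{0..<?n}. f (e i)) = (\<Sum>v\<in>S. f v)" for f :: "_ \<Rightarrow> real"
    by (rule sum.reindex_bij_betw[OF e])
  have sum_h: "(\<Sum>i\<in>{0..<?m}. f (h i)) = (\<Sum>v\<in>E. f v)" for f :: "_ \<Rightarrow> real"
    by (rule sum.reindex_bij_betw[OF h])
  let ?A = "mat ?n ?n (\<lambda>(i, j). A (e i) (e j))" and ?G = "mat ?n ?n (\<lambda>(i, j). G (e i) (e j))"
  let ?P = "mat ?n ?m (\<lambda>(i, j). a (h j) (e i))" and ?Q = "mat ?m ?n (\<lambda>(i, j). b (h i) (e j))"
  have AG: "(\<Sum>k\<in>{0..<?n}. A (e i) (e k) * G (e k) (e j)) = of_bool (i = j)" if "i < ?n" "j < ?n" for i j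
    using sum_e[of "\<lambda>v. A (e i) v * G v (e j)"] G[OF eS eS] e_eq that by simp
  have "?A * ?G = 1\<^sub>m ?n"
    by (rule eq_matI) (simp_all add: scalar_prod_def AG)
  then have 1: "det (?A - ?P * ?Q) = det ?A * det (1\<^sub>m ?m - ?Q * (?G * ?P))"
    by (intro det_one_minus_mult[of _ ?n]) auto
  have 2: "?A - ?P * ?Q = mat ?n ?n (\<lambda>(i, j). A (e i) (e j) - (\<Sum>f\<in>E. a f (e i) * b f (e j)))"
    using sum_h[of "\<lambda>f. a f (e _) * b f (e _)"] by (intro eq_matI) (simp_all add: scalar_prod_def)
  have 3: "1\<^sub>m ?m - ?Q * (?G * ?P) = mat ?m ?m (\<lambda>(i, j). of_bool (h i = h j) -
      (\<Sum>u\<in>S. \<Sum>v\<in>S. b (h i) u * G u v * a (h j) v))"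
  proof (rule eq_matI)
    fix i j assume "i < dim_row (mat ?m ?m (\<lambda>(i, j). of_bool (h i = h j) -
      (\<Sum>u\<in>S. \<Sum>v\<in>S. b (h i) u * G u v * a (h j) v)))"
      "j < dim_col (mat ?m ?m (\<lambda>(i, j). of_bool (h i = h j) -
      (\<Sum>u\<in>S. \<Sum>v\<in>S. b (h i) u * G u v * a (h j) v)))"
    then have ij: "i < ?m" "j < ?m" by auto
    have "(?Q * (?G * ?P)) $$ (i, j) = (\<Sum>k\<in>{0..<?n}. b (h i) (e k) * (\<Sum>l\<in>{0..<?n}. G (e k) (e l) * a (h j) (e l)))"
      using ij by (simp add: scalar_prod_def)
    also have "\<dots> = (\<Sum>k\<in>{0..<?n}. b (h i) (e k) * (\<Sum>v\<in>S. G (e k) v * a (h j) v))"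
      using sum_e[of "\<lambda>v. G (e _) v * a (h j) v"] by simp
    also have "\<dots> = (\<Sum>u\<in>S. b (h i) u * (\<Sum>v\<in>S. G u v * a (h j) v))"
      by (rule sum_e)
    finally show "(1\<^sub>m ?m - ?Q * (?G * ?P)) $$ (i, j) = mat ?m ?m (\<lambda>(i, j). of_bool (h i = h j) -
      (\<Sum>u\<in>S. \<Sum>v\<in>S. b (h i) u * G u v * a (h j) v)) $$ (i, j)"
      using ij h_eq[OF ij] by (simp add: sum_distrib_left mult.assoc)
  qed auto
  show ?thesis
    using 1 unfolding 2 3 det_on_eq_det[OF e] det_on_eq_det[OF h] .
qed

text \<open>The description of the inverse by \<open>THE\<close> is made usable by the adjugate matrix.\<close>

lemma inverse_on_works:
  fixes A :: "'a \<Rightarrow> 'a \<Rightarrow> real"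
  assumes "finite S" and nz: "det_on S A \<noteq> 0"
  shows "u \<in> S \<Longrightarrow> w \<in> S \<Longrightarrow> (\<Sum>v\<in>S. A u v * inverse_on S A v w) = of_bool (u = w)"
    and "u \<notin> S \<or> w \<notin> S \<Longrightarrow> inverse_on S A u w = 0"
proof -
  let ?I = "\<lambda>B. (\<forall>u\<in>S. \<forall>w\<in>S. (\<Sum>v\<in>S. A u v * B v w) = of_bool (u = w) \<and>
                  (\<Sum>v\<in>S. B u v * A v w) = of_bool (u = w)) \<and>
     (\<forall>u w. u \<notin> S \<or> w \<notin> S \<longrightarrow> B u w = 0)"
  let ?n = "card S"
  obtain e where e: "bij_betw e {0..<?n} S" using ex_bij_betw_nat_finite[OF assms(1)] by blast
  define h where "h = inv_into {0..<?n} e"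
  have he: "h (e i) = i" if "i < ?n" for i
    unfolding h_def using e that by (simp add: bij_betw_inv_into_left)
  have eh: "e (h x) = x" "h x < ?n" if "x \<in> S" for x
    using bij_betw_inv_into_right[OF e that] bij_betw_inv_into[OF e] that
    unfolding h_def by (auto simp: bij_betw_def)
  have h_eq: "h u = h w \<longleftrightarrow> u = w" if "u \<in> S" "w \<in> S" for u w using eh that by metis
  have sum_e: "(\<Sum>v\<in>S. f v) = (\<Sum>i\<in>{0..<?n}. f (e i))" for f :: "_ \<Rightarrow> real"
    by (rule sum.reindex_bij_betw[OF e, symmetric])
  let ?A = "mat ?n ?n (\<lambda>(i, j). A (e i) (e j))"
  have dA: "det ?A \<noteq> 0" using nz det_on_eq_det[OF e] by metis
  have A: "?A \<in> carrier_mat ?n ?n" by simp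
  define C where "C = (1 / det ?A) \<cdot>\<^sub>m adj_mat ?A"
  have C: "C \<in> carrier_mat ?n ?n" unfolding C_def using adj_mat(1)[OF A] by simp
  have AC: "?A * C = 1\<^sub>m ?n" and CA: "C * ?A = 1\<^sub>m ?n"
    unfolding C_def using adj_mat[OF A] dA
    by (auto simp: mult_smult_distrib[OF A] mult_smult_assoc_mat[OF _ A] intro!: eq_matI)
  define B where "B = (\<lambda>u w. if u \<in> S \<and> w \<in> S then C $$ (h u, h w) else 0)"
  have IB: "?I B"
  proof (intro conjI ballI allI impI)
    fix u w assume u: "u \<in> S" and w: "w \<in> S"
    have eS: "e i \<in> S" if "i < ?n" for i using e that by (auto simp: bij_betw_def)
    have "(?A * C) $$ (h u, h w) = (\<Sum>i\<in>{0..<?n}. A u (e i) * C $$ (i, h w))"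
      using eh[OF u] eh[OF w] C by (auto simp: scalar_prod_def)
    also have "\<dots> = (\<Sum>v\<in>S. A u v * B v w)"
      unfolding sum_e by (rule sum.cong) (use u w eS he in \<open>auto simp: B_def\<close>)
    finally show "(\<Sum>v\<in>S. A u v * B v w) = of_bool (u = w)"
      unfolding AC using eh[OF u] eh[OF w] by (auto simp: h_eq[OF u w] split: if_splits)
    have "(C * ?A) $$ (h u, h w) = (\<Sum>i\<in>{0..<?n}. C $$ (h u, i) * A (e i) w)"
      using eh[OF u] eh[OF w] C by (auto simp: scalar_prod_def)
    also have "\<dots> = (\<Sum>v\<in>S. B u v * A v w)"
      unfolding sum_e by (rule sum.cong) (use u w eS he in \<open>auto simp: B_def\<close>)
    finally show "(\<Sum>v\<in>S. B u v * A v w) = of_bool (u = w)"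
      unfolding CA using eh[OF u] eh[OF w] by (auto simp: h_eq[OF u w] split: if_splits)
  qed (auto simp: B_def)
  have uniq: "B1 = B2" if B1: "?I B1" and B2: "?I B2" for B1 B2
  proof (intro ext)
    fix u w
    show "B1 u w = B2 u w"
    proof (cases "u \<in> S \<and> w \<in> S")
      case True
      have "B1 u w = (\<Sum>v\<in>S. B1 u v * (\<Sum>x\<in>S. A v x * B2 x w))"
        using True B2 assms(1) by (simp add: of_bool_def if_distrib[of "(*) _"] sum.delta' cong: if_cong)
      also have "\<dots> = (\<Sum>x\<in>S. (\<Sum>v\<in>S. B1 u v * A v x) * B2 x w)"
        unfolding sum_distrib_left sum_distrib_right mult.assoc by (rule sum.swap)
      also have "\<dots> = B2 u w"
        using True B1 assms(1) by (simp add: of_bool_def if_distrib[of "\<lambda>x. x * _"] sum.delta cong: if_cong)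
      finally show ?thesis .
    qed (use B1 B2 in auto)
  qed
  have "\<exists>!B. ?I B" by (rule ex1I[of ?I, OF IB]) (rule uniq[OF _ IB])
  from theI'[OF this] have *: "?I (inverse_on S A)" unfolding inverse_on_def .
  show "u \<in> S \<Longrightarrow> w \<in> S \<Longrightarrow> (\<Sum>v\<in>S. A u v * inverse_on S A v w) = of_bool (u = w)"
    by (rule *[THEN conjunct1, rule_format, THEN conjunct1])
  show "u \<notin> S \<or> w \<notin> S \<Longrightarrow> inverse_on S A u w = 0"
    by (rule *[THEN conjunct2, rule_format])
qed

section \<open>Trees and recurrent configurations of rooted graphs\<close>

text \<open>A graph is given by a set \<open>L\<close> of vertices and a set of two-element sets as edges; all points
  outside \<open>L\<close> are thought of as one root vertex. Connectedness is expressed by cuts instead of paths: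
  every set of non-root vertices is left by some edge. In this form it behaves trivially under contraction of an
  edge to the root, which amounts to removing its end point from \<open>L\<close>.\<close>

definition cut_connected :: "'a set \<Rightarrow> 'a set set \<Rightarrow> bool" where
  "cut_connected L T \<longleftrightarrow> (\<forall>W\<subseteq>L. W \<noteq> {} \<longrightarrow> (\<exists>d\<in>T. d \<inter> W \<noteq> {} \<and> \<not> d \<subseteq> W))"

text \<open>Spanning trees, with acyclicity replaced by the right number of edges.\<close>

definition rooted_trees :: "'a set \<Rightarrow> 'a set set \<Rightarrow> 'a set set set" where
  "rooted_trees L F = {T. T \<subseteq> F \<and> card T = card L \<and> cut_connected L T}"

definition edge_degree :: "'a set set \<Rightarrow> 'a \<Rightarrow> nat" where
  "edge_degree F v = card {d \<in> F. v \<in> d}"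

definition inner_degree :: "'a set set \<Rightarrow> 'a set \<Rightarrow> 'a \<Rightarrow> nat" where
  "inner_degree F W v = card {d \<in> F. v \<in> d \<and> d \<subseteq> W}"

text \<open>Recurrent sandpile configurations, characterised by the absence of forbidden sets. A vertex of degree
  \<open>k\<close> has heights between \<open>1\<close> and \<open>k\<close>.\<close>

definition recurrent_configs :: "'a set \<Rightarrow> 'a set set \<Rightarrow> ('a \<Rightarrow> nat) set" where
  "recurrent_configs L F = {\<rho> \<in> L \<rightarrow>\<^sub>E UNIV. (\<forall>v\<in>L. 1 \<le> \<rho> v \<and> \<rho> v \<le> edge_degree F v) \<and>
     (\<forall>W\<subseteq>L. W \<noteq> {} \<longrightarrow> (\<exists>v\<in>W. inner_degree F W v < \<rho> v))}"

definition graph_laplacian :: "'a set set \<Rightarrow> 'a \<Rightarrow> 'a \<Rightarrow> real" where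
  "graph_laplacian F u v = (if u = v then real (edge_degree F u) else - of_bool ({u, v} \<in> F))"

definition simple_edges :: "'a set set \<Rightarrow> bool" where
  "simple_edges F \<longleftrightarrow> finite F \<and> (\<forall>d\<in>F. card d = 2)"

lemma simple_edges_subset: "simple_edges F \<Longrightarrow> T \<subseteq> F \<Longrightarrow> simple_edges T"
  unfolding simple_edges_def by (auto intro: finite_subset)

lemma cut_connected_root_edge:
  assumes "simple_edges T" "cut_connected L T" "L \<noteq> {}"
  obtains v w where "{v, w} \<in> T" "v \<in> L" "w \<notin> L"
proof -
  obtain d where d: "d \<in> T" "d \<inter> L \<noteq> {}" "\<not> d \<subseteq> L"
    using assms(2,3) unfolding cut_connected_def by blast
  moreover have "card d = 2" using assms(1) d(1) by (auto simp: simple_edges_def)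
  ultimately obtain v w where "d = {v, w}" "v \<in> L" "w \<notin> L"
    by (auto simp: card_2_iff)
  then show ?thesis using d(1) that by blast
qed

text \<open>A set of vertices containing \<open>v\<close> is always left by the edge \<open>d\<close>, which goes to the
  root, and a set not containing \<open>v\<close> does not meet \<open>d\<close>.\<close>

lemma cut_connected_contract:
  assumes "d \<in> T" "d = {v, w}" "v \<in> L" "w \<notin> L"
  shows "cut_connected L T \<longleftrightarrow> cut_connected (L - {v}) (T - {d})"
proof
  assume L: "cut_connected L T"
  show "cut_connected (L - {v}) (T - {d})"
    unfolding cut_connected_def
  proof (intro allI impI)
    fix W assume W: "W \<subseteq> L - {v}" "W \<noteq> {}"
    then obtain e where "e \<in> T" "e \<inter> W \<noteq> {}" "\<not> e \<subseteq> W"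
      using L unfolding cut_connected_def by blast
    moreover have "d \<inter> W = {}" using W assms by auto
    ultimately show "\<exists>e\<in>T - {d}. e \<inter> W \<noteq> {} \<and> \<not> e \<subseteq> W" by blast
  qed
next
  assume R: "cut_connected (L - {v}) (T - {d})"
  show "cut_connected L T"
    unfolding cut_connected_def
  proof (intro allI impI)
    fix W assume W: "W \<subseteq> L" "W \<noteq> {}"
    show "\<exists>e\<in>T. e \<inter> W \<noteq> {} \<and> \<not> e \<subseteq> W"
    proof (cases "v \<in> W")
      case True
      then show ?thesis using W assms by (intro bexI[of _ d]) auto
    next
      case False
      then have "W \<subseteq> L - {v}" using W by blast
      then show ?thesis using R W(2) unfolding cut_connected_def by blast
    qed
  qed
qed

lemma cut_connected_card_le:
  assumes "finite L" "simple_edges T" "cut_connected L T"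
  shows "card L \<le> card T"
  using assms
proof (induction "card L" arbitrary: L T)
  case (Suc n)
  have ne: "L \<noteq> {}" using Suc.hyps(2) by auto
  obtain v w where d: "{v, w} \<in> T" "v \<in> L" "w \<notin> L"
    using cut_connected_root_edge[OF Suc.prems(2,3) ne] .
  have "card (L - {v}) \<le> card (T - {{v, w}})"
  proof (rule Suc.hyps(1))
    show "n = card (L - {v})" using Suc.hyps(2) d(2) by simp
    show "cut_connected (L - {v}) (T - {{v, w}})"
      using cut_connected_contract[OF d(1) refl d(2,3)] Suc.prems(3) by blast
  qed (use Suc.prems in \<open>auto intro: simple_edges_subset\<close>)
  moreover have "card T = Suc (card (T - {{v, w}}))"
    using Suc.prems(2) d(1) by (intro card.remove) (auto simp: simple_edges_def)
  moreover have "card L = Suc (card (L - {v}))" using Suc.prems(1) d(2) by (rule card.remove)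
  ultimately show ?case by simp
qed simp

lemma minimal_cut_connected_card:
  assumes "finite L" "simple_edges T" "cut_connected L T" "\<And>e. e \<in> T \<Longrightarrow> \<not> cut_connected L (T - {e})"
  shows "card T = card L"
  using assms
proof (induction "card L" arbitrary: L T)
  case 0
  then have "cut_connected L S" for S by (simp add: cut_connected_def)
  then have "T = {}" using 0(5) by blast
  then show ?case using 0 by simp
next
  case (Suc n)
  have ne: "L \<noteq> {}" using Suc.hyps(2) by auto
  obtain v w where d: "{v, w} \<in> T" "v \<in> L" "w \<notin> L"
    using cut_connected_root_edge[OF Suc.prems(2,3) ne] .
  have "card (T - {{v, w}}) = card (L - {v})"
  proof (rule Suc.hyps(1))
    show "n = card (L - {v})" using Suc.hyps(2) d(2) by simp
    show "cut_connected (L - {v}) (T - {{v, w}})"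
      using cut_connected_contract[OF d(1) refl d(2,3)] Suc.prems(3) by blast
    show "\<not> cut_connected (L - {v}) (T - {{v, w}} - {e})" if "e \<in> T - {{v, w}}" for e
    proof -
      have "{v, w} \<in> T - {e}" using d that by auto
      from cut_connected_contract[OF this refl d(2,3)] Suc.prems(4)[of e] that
      have "\<not> cut_connected (L - {v}) (T - {e} - {{v, w}})" by blast
      moreover have "T - {e} - {{v, w}} = T - {{v, w}} - {e}" by blast
      ultimately show ?thesis by simp
    qed
  qed (use Suc.prems in \<open>auto intro: simple_edges_subset\<close>)
  moreover have "card T = Suc (card (T - {{v, w}}))"
    using Suc.prems(2) d(1) by (intro card.remove) (auto simp: simple_edges_def)
  moreover have "card L = Suc (card (L - {v}))" using Suc.prems(1) d(2) by (rule card.remove)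
  ultimately show ?case by simp
qed

text \<open>Deletion-contraction along edges at the root. Contracting such an edge only removes a vertex from
  \<open>L\<close>, so no quotient graphs have to be formed. The induction stops at graphs in which no edge joins
  \<open>L\<close> to the root.\<close>

lemma root_edge_induct [consumes 2, case_names no_vertices no_root_edge root_edge]:
  assumes "finite L" "simple_edges F"
    and empty: "\<And>F. simple_edges F \<Longrightarrow> P {} F"
    and closed: "\<And>L F. finite L \<Longrightarrow> simple_edges F \<Longrightarrow> L \<noteq> {} \<Longrightarrow>
      (\<And>d. d \<in> F \<Longrightarrow> d \<inter> L \<noteq> {} \<Longrightarrow> d \<subseteq> L) \<Longrightarrow> P L F"
    and step: "\<And>L F d v w. finite L \<Longrightarrow> simple_edges F \<Longrightarrow> d \<in> F \<Longrightarrow> d = {v, w} \<Longrightarrow> v \<in> L \<Longrightarrow> w \<notin> L \<Longrightarrow>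
      P L (F - {d}) \<Longrightarrow> P (L - {v}) (F - {d}) \<Longrightarrow> P L F"
  shows "P L F"
  using assms(1,2)
proof (induction "card F" arbitrary: L F rule: less_induct)
  case less
  show ?case
  proof (cases "L = {} \<or> (\<forall>d\<in>F. d \<inter> L \<noteq> {} \<longrightarrow> d \<subseteq> L)")
    case True
    show ?thesis
    proof (cases "L = {}")
      case L: True
      show ?thesis unfolding L by (rule empty[OF less.prems(2)])
    next
      case L: False
      show ?thesis by (rule closed[OF less.prems L]) (use True L in blast)
    qed
  next
    case False
    then obtain d where d: "d \<in> F" "d \<inter> L \<noteq> {}" "\<not> d \<subseteq> L" by blast
    moreover have "card d = 2" using less.prems(2) d(1) by (auto simp: simple_edges_def)
    ultimately obtain v w where vw: "d = {v, w}" "v \<in> L" "w \<notin> L"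
      by (auto simp: card_2_iff)
    have "card (F - {d}) < card F" using d(1) less.prems(2)
      by (intro card_Diff1_less) (auto simp: simple_edges_def)
    then show ?thesis
      using d(1) vw less.prems by (intro step[OF _ _ d(1) vw] less.hyps) (auto intro: simple_edges_subset)
  qed
qed

lemma finite_rooted_trees: "simple_edges F \<Longrightarrow> finite (rooted_trees L F)"
  unfolding rooted_trees_def simple_edges_def by (auto intro: finite_subset[of _ "Pow F"])

text \<open>Trees without \<open>d\<close> are trees of the graph with \<open>d\<close> deleted, trees with \<open>d\<close>
  correspond to trees of the graph with \<open>d\<close> contracted.\<close>

lemma rooted_trees_recursion:
  assumes "finite L" "simple_edges F" "d \<in> F" and d: "d = {v, w}" "v \<in> L" "w \<notin> L"
  shows "card (rooted_trees L F) = card (rooted_trees L (F - {d})) + card (rooted_trees (L - {v}) (F - {d}))"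
proof -
  have finF: "finite F" using assms(2) by (simp add: simple_edges_def)
  have cc: "cut_connected L (insert d T) \<longleftrightarrow> cut_connected (L - {v}) T" if "d \<notin> T" for T
    using cut_connected_contract[of d "insert d T", OF _ d] that by simp
  have cL: "card L = Suc (card (L - {v}))" using assms(1) d(2) by (metis card.remove)
  have "rooted_trees L F = rooted_trees L (F - {d}) \<union> insert d ` rooted_trees (L - {v}) (F - {d})"
  proof (intro equalityI subsetI)
    fix T assume T: "T \<in> rooted_trees L F"
    show "T \<in> rooted_trees L (F - {d}) \<union> insert d ` rooted_trees (L - {v}) (F - {d})"
    proof (cases "d \<in> T")
      case True
      then have T': "insert d (T - {d}) = T" by blast
      have "finite T" using T finF by (auto simp: rooted_trees_def intro: finite_subset)
      then have "card T = Suc (card (T - {d}))" using True by (metis card.remove)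
      then have "T - {d} \<in> rooted_trees (L - {v}) (F - {d})"
        using T True cc[of "T - {d}"] cL T' by (auto simp: rooted_trees_def)
      then show ?thesis using T' by blast
    qed (use T in \<open>auto simp: rooted_trees_def\<close>)
  next
    fix T assume "T \<in> rooted_trees L (F - {d}) \<union> insert d ` rooted_trees (L - {v}) (F - {d})"
    then consider "T \<in> rooted_trees L (F - {d})"
      | T' where "T = insert d T'" "T' \<in> rooted_trees (L - {v}) (F - {d})" by blast
    then show "T \<in> rooted_trees L F"
    proof cases
      case 2
      then have "d \<notin> T'" "finite T'" using finF by (auto simp: rooted_trees_def intro: finite_subset)
      then show ?thesis using 2 cc[of T'] cL assms(3) by (auto simp: rooted_trees_def)
    qed (auto simp: rooted_trees_def)
  qed
  moreover have "rooted_trees L (F - {d}) \<inter> insert d ` rooted_trees (L - {v}) (F - {d}) = {}"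
    by (auto simp: rooted_trees_def)
  moreover have "inj_on (insert d) (rooted_trees (L - {v}) (F - {d}))"
    by (auto simp: inj_on_def rooted_trees_def)
  moreover have "simple_edges (F - {d})" using assms(2) by (auto intro: simple_edges_subset)
  ultimately show ?thesis
    by (simp add: card_Un_disjoint finite_rooted_trees card_image)
qed

lemma edge_degree_Diff:
  assumes "finite F" "d \<in> F"
  shows "edge_degree F u = edge_degree (F - {d}) u + of_bool (u \<in> d)"
proof (cases "u \<in> d")
  case True
  then have "{e \<in> F. u \<in> e} = insert d {e \<in> F - {d}. u \<in> e}" using assms(2) by blast
  then show ?thesis using True assms(1) by (simp add: edge_degree_def)
next
  case False
  then have "{e \<in> F. u \<in> e} = {e \<in> F - {d}. u \<in> e}" by blast
  then show ?thesis using False by (simp add: edge_degree_def)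
qed

lemma inner_degree_Diff: "\<not> d \<subseteq> W \<Longrightarrow> inner_degree (F - {d}) W u = inner_degree F W u"
  unfolding inner_degree_def by (rule arg_cong[where f=card]) auto

lemma inner_degree_less_edge_degree:
  assumes "finite F" "d \<in> F" "v \<in> d" "\<not> d \<subseteq> W"
  shows "inner_degree F W v < edge_degree F v"
  unfolding inner_degree_def edge_degree_def by (rule psubset_card_mono) (use assms in auto)

lemma finite_recurrent_configs: "finite L \<Longrightarrow> finite (recurrent_configs L F)"
proof (rule finite_subset)
  show "recurrent_configs L F \<subseteq> PiE L (\<lambda>v. {..edge_degree F v})"
    by (auto simp: recurrent_configs_def PiE_def Pi_def)
qed (auto intro: finite_PiE)

lemma recurrent_configsD:
  assumes "\<rho> \<in> recurrent_configs L F"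
  shows "\<rho> \<in> L \<rightarrow>\<^sub>E UNIV"
    and "v \<in> L \<Longrightarrow> 1 \<le> \<rho> v"
    and "v \<in> L \<Longrightarrow> \<rho> v \<le> edge_degree F v"
    and "W \<subseteq> L \<Longrightarrow> W \<noteq> {} \<Longrightarrow> \<exists>v\<in>W. inner_degree F W v < \<rho> v"
  using assms unfolding recurrent_configs_def by auto

text \<open>Forbidden sets only involve edges inside \<open>L\<close>, so deleting the root edge \<open>d\<close> just
  lowers the maximal height at its end point \<open>v\<close> by one. The configurations lost in this way have
  maximal height at \<open>v\<close>. There \<open>v\<close> belongs to no forbidden set, because \<open>d\<close>
  leaves every set containing \<open>v\<close>; hence \<open>v\<close> may be treated as part of the root.\<close>

lemma recurrent_configs_recursion:
  assumes "finite L" "simple_edges F" "d \<in> F" and d: "d = {v, w}" "v \<in> L" "w \<notin> L"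
  shows "card (recurrent_configs L F) =
    card (recurrent_configs L (F - {d})) + card (recurrent_configs (L - {v}) (F - {d}))"
proof -
  have finF: "finite F" using assms(2) by (simp add: simple_edges_def)
  have inner: "inner_degree (F - {d}) W u = inner_degree F W u" if "W \<subseteq> L" for W u
    using that d by (intro inner_degree_Diff) auto
  have deg: "edge_degree F u = edge_degree (F - {d}) u + of_bool (u = v)" if "u \<in> L" for u
    using edge_degree_Diff[OF finF assms(3)] that d by auto
  let ?R1 = "recurrent_configs L (F - {d})"
  let ?R2 = "{\<rho> \<in> recurrent_configs L F. \<rho> v = edge_degree F v}"
  have "recurrent_configs L F = ?R1 \<union> ?R2"
  proof (intro equalityI subsetI)
    fix \<rho> assume \<rho>: "\<rho> \<in> recurrent_configs L F"
    have "\<rho> u \<le> edge_degree (F - {d}) u" if "\<rho> v \<noteq> edge_degree F v" "u \<in> L" for u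
    proof -
      have "\<rho> u \<le> edge_degree F u" using \<rho> that by (auto simp: recurrent_configs_def)
      then show ?thesis using deg[OF that(2)] that(1) by (cases "u = v") auto
    qed
    then show "\<rho> \<in> ?R1 \<union> ?R2" using \<rho> inner by (auto simp: recurrent_configs_def)
  next
    fix \<rho> assume \<rho>: "\<rho> \<in> ?R1 \<union> ?R2"
    have "\<rho> u \<le> edge_degree F u" if "\<rho> \<in> ?R1" "u \<in> L" for u
    proof -
      have "\<rho> u \<le> edge_degree (F - {d}) u" using that by (auto simp: recurrent_configs_def)
      then show ?thesis using deg[OF that(2)] by simp
    qed
    then show "\<rho> \<in> recurrent_configs L F" using \<rho> inner by (auto simp: recurrent_configs_def)
  qed
  then have "card (recurrent_configs L F) = card (?R1 \<union> ?R2)" by (rule arg_cong)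
  moreover have "?R1 \<inter> ?R2 = {}"
  proof -
    have "\<rho> v < edge_degree F v" if "\<rho> \<in> ?R1" for \<rho>
    proof -
      have "\<rho> v \<le> edge_degree (F - {d}) v" using that d by (auto simp: recurrent_configs_def)
      then show ?thesis using deg[OF d(2)] by simp
    qed
    then show ?thesis by force
  qed
  moreover have "bij_betw (\<lambda>\<rho>. restrict \<rho> (L - {v})) ?R2 (recurrent_configs (L - {v}) (F - {d}))"
  proof (rule bij_betwI[of _ _ _ "\<lambda>\<rho>. \<rho>(v := edge_degree F v)"])
    show "(\<lambda>\<rho>. restrict \<rho> (L - {v})) \<in> ?R2 \<rightarrow> recurrent_configs (L - {v}) (F - {d})"
    proof
      fix \<rho> assume \<rho>: "\<rho> \<in> ?R2"
      have "\<exists>u\<in>W. inner_degree (F - {d}) W u < restrict \<rho> (L - {v}) u"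
        if W: "W \<subseteq> L - {v}" "W \<noteq> {}" for W
      proof -
        have "W \<subseteq> L" using W by blast
        then obtain u where u: "u \<in> W" "inner_degree F W u < \<rho> u"
          using recurrent_configsD(4)[of \<rho> L F W] \<rho> W by blast
        then have "u \<in> L - {v}" using W by blast
        then show ?thesis using u by (intro bexI[of _ u]) (simp_all add: inner[OF \<open>W \<subseteq> L\<close>])
      qed
      moreover have "\<rho> u \<le> edge_degree (F - {d}) u" if "u \<in> L - {v}" for u
      proof -
        have "\<rho> u \<le> edge_degree F u" using \<rho> that by (auto simp: recurrent_configs_def)
        then show ?thesis using deg[of u] that by simp
      qed
      ultimately show "restrict \<rho> (L - {v}) \<in> recurrent_configs (L - {v}) (F - {d})"
        using \<rho> by (auto simp: recurrent_configs_def)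
    qed
    show "(\<lambda>\<rho>. \<rho>(v := edge_degree F v)) \<in> recurrent_configs (L - {v}) (F - {d}) \<rightarrow> ?R2"
    proof
      fix \<rho> assume \<rho>: "\<rho> \<in> recurrent_configs (L - {v}) (F - {d})"
      let ?\<rho> = "\<rho>(v := edge_degree F v)"
      have "\<exists>u\<in>W. inner_degree F W u < ?\<rho> u" if W: "W \<subseteq> L" "W \<noteq> {}" for W
      proof (cases "v \<in> W")
        case True
        have "inner_degree F W v < edge_degree F v"
          by (rule inner_degree_less_edge_degree[OF finF assms(3)]) (use d W in auto)
        then show ?thesis using True by auto
      next
        case False
        then have "W \<subseteq> L - {v}" using W by blast
        then obtain u where u: "u \<in> W" "inner_degree (F - {d}) W u < \<rho> u"
          using recurrent_configsD(4)[OF \<rho> _ W(2)] by blast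
        then have "u \<noteq> v" using False by blast
        then show ?thesis using u by (intro bexI[of _ u]) (simp_all add: inner[OF W(1)])
      qed
      moreover have "1 \<le> \<rho> u \<and> \<rho> u \<le> edge_degree F u" if "u \<in> L - {v}" for u
      proof -
        have "1 \<le> \<rho> u" "\<rho> u \<le> edge_degree (F - {d}) u" using \<rho> that by (auto simp: recurrent_configs_def)
        then show ?thesis using deg[of u] that by simp
      qed
      moreover have "1 \<le> edge_degree F v" using deg[OF d(2)] by simp
      moreover have "?\<rho> \<in> L \<rightarrow>\<^sub>E UNIV" using \<rho> d by (auto simp: recurrent_configs_def PiE_def extensional_def)
      ultimately show "?\<rho> \<in> ?R2" by (auto simp: recurrent_configs_def)
    qed
    show "(restrict \<rho> (L - {v}))(v := edge_degree F v) = \<rho>" if "\<rho> \<in> ?R2" for \<rho>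
      using that by (auto simp: recurrent_configs_def PiE_def extensional_def fun_eq_iff)
    show "restrict (\<rho>(v := edge_degree F v)) (L - {v}) = \<rho>"
      if "\<rho> \<in> recurrent_configs (L - {v}) (F - {d})" for \<rho>
      using that by (auto simp: recurrent_configs_def PiE_def extensional_def fun_eq_iff)
  qed
  then have "card ?R2 = card (recurrent_configs (L - {v}) (F - {d}))"
    by (rule bij_betw_same_card)
  moreover have "finite ?R1" "finite ?R2" using finite_recurrent_configs[OF assms(1)] by auto
  ultimately show ?thesis by (simp only: card_Un_disjoint)
qed

lemma det_graph_laplacian_recursion:
  assumes "finite L" "simple_edges F" "d \<in> F" and d: "d = {v, w}" "v \<in> L" "w \<notin> L"
  shows "det_on L (graph_laplacian F) =
    det_on L (graph_laplacian (F - {d})) + det_on (L - {v}) (graph_laplacian (F - {d}))"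
proof -
  have finF: "finite F" using assms(2) by (simp add: simple_edges_def)
  have "det_on L (graph_laplacian F) =
      det_on L (\<lambda>i j. graph_laplacian (F - {d}) i j + of_bool (i = v \<and> j = v))"
  proof (rule det_on_cong)
    fix i j assume "i \<in> L" "j \<in> L"
    then show "graph_laplacian F i j = graph_laplacian (F - {d}) i j + of_bool (i = v \<and> j = v)"
    proof (cases "i = j")
      case True
      then show ?thesis
        using edge_degree_Diff[OF finF assms(3), of i] d \<open>i \<in> L\<close> by (auto simp: graph_laplacian_def)
    next
      case False
      have "{i, j} \<noteq> d" using \<open>i \<in> L\<close> \<open>j \<in> L\<close> d by auto
      then show ?thesis using False by (auto simp: graph_laplacian_def)
    qed
  qed
  then show ?thesis using det_on_add_diag[OF assms(1) d(2)] by simp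
qed

text \<open>A vertex without edges to the root has as many neighbours in \<open>L\<close> as its degree says.\<close>

lemma laplacian_row_sum:
  assumes "finite L" "simple_edges F" "u \<in> L" "\<And>d. d \<in> F \<Longrightarrow> u \<in> d \<Longrightarrow> d \<subseteq> L"
  shows "(\<Sum>v\<in>L. graph_laplacian F u v) = 0"
proof -
  have "{d \<in> F. u \<in> d} = (\<lambda>v. {u, v}) ` {v \<in> L - {u}. {u, v} \<in> F}"
  proof (intro equalityI subsetI)
    fix d assume d: "d \<in> {d \<in> F. u \<in> d}"
    then have "card d = 2" using assms(2) by (auto simp: simple_edges_def)
    then obtain v where "d = {u, v}" "v \<noteq> u" using d by (auto simp: card_2_iff)
    then show "d \<in> (\<lambda>v. {u, v}) ` {v \<in> L - {u}. {u, v} \<in> F}" using d assms(4)[of d] by auto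
  qed auto
  moreover have "inj_on (\<lambda>v. {u, v}) {v \<in> L - {u}. {u, v} \<in> F}"
    by (auto simp: inj_on_def doubleton_eq_iff)
  ultimately have "edge_degree F u = card {v \<in> L - {u}. {u, v} \<in> F}"
    by (simp add: edge_degree_def card_image)
  moreover have "(\<Sum>v\<in>L - {u}. graph_laplacian F u v) = - real (card {v \<in> L - {u}. {u, v} \<in> F})"
  proof -
    have "(\<Sum>v\<in>L - {u}. graph_laplacian F u v) = (\<Sum>v\<in>L - {u}. - of_bool ({u, v} \<in> F))"
      by (rule sum.cong) (auto simp: graph_laplacian_def)
    also have "\<dots> = - real (card {v \<in> L - {u}. {u, v} \<in> F})"
      using assms(1) by (simp add: sum_negf sum_of_bool_eq Int_def)
    finally show ?thesis .
  qed
  ultimately show ?thesis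
    using assms(1,3) by (simp add: sum.remove[of L u] graph_laplacian_def)
qed

text \<open>Both sides satisfy the same deletion-contraction recursion. If no edge joins a nonempty \<open>L\<close> to the
  root, there is no tree, and the rows of the Laplacian sum to zero.\<close>

theorem matrix_tree:
  assumes "finite L" "simple_edges F"
  shows "real (card (rooted_trees L F)) = det_on L (graph_laplacian F)"
  using assms
proof (induction rule: root_edge_induct)
  case (no_vertices F)
  have "T = {}" if "T \<subseteq> F" "card T = 0" for T
    using that no_vertices by (auto simp: simple_edges_def dest: finite_subset)
  then have "rooted_trees {} F = {{}}"
    by (auto simp: rooted_trees_def cut_connected_def)
  then show ?case by simp
next
  case (no_root_edge L F)
  then have "rooted_trees L F = {}" unfolding rooted_trees_def cut_connected_def by blast
  moreover have "det_on L (graph_laplacian F) = 0"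
    using no_root_edge by (intro det_on_eq_0_if_row_sums_0 laplacian_row_sum) auto
  ultimately show ?case by simp
next
  case (root_edge L F d v w)
  then show ?case
    using rooted_trees_recursion[OF root_edge(1-6)] det_graph_laplacian_recursion[OF root_edge(1-6)] by simp
qed

text \<open>The same recursion again; if no edge joins a nonempty \<open>L\<close> to the root, then \<open>L\<close> itself
  is a forbidden set.\<close>

theorem card_recurrent_configs:
  assumes "finite L" "simple_edges F"
  shows "card (recurrent_configs L F) = card (rooted_trees L F)"
proof -
  have "real (card (recurrent_configs L F)) = det_on L (graph_laplacian F)"
    using assms
  proof (induction rule: root_edge_induct)
    case (no_vertices F)
    have "recurrent_configs {} F = {\<lambda>_. undefined}"
      by (auto simp: recurrent_configs_def)
    then show ?case by simp
  next
    case (no_root_edge L F)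
    have "inner_degree F L v = edge_degree F v" if "v \<in> L" for v
      unfolding inner_degree_def edge_degree_def
      by (rule arg_cong[where f=card]) (use no_root_edge(4) that in blast)
    then have "recurrent_configs L F = {}"
      using no_root_edge(3) by (force simp: recurrent_configs_def dest: spec[of _ L])
    moreover have "det_on L (graph_laplacian F) = 0"
      using no_root_edge by (intro det_on_eq_0_if_row_sums_0 laplacian_row_sum) auto
    ultimately show ?case by simp
  next
    case (root_edge L F d v w)
    then show ?case
      using recurrent_configs_recursion[OF root_edge(1-6)] det_graph_laplacian_recursion[OF root_edge(1-6)] by simp
  qed
  then show ?thesis using matrix_tree[OF assms] by simp
qed

section \<open>Spanning trees of the wired graph\<close>

definition multi_walk :: "'e set \<Rightarrow> ('e \<Rightarrow> 'v set) \<Rightarrow> 'v list \<Rightarrow> 'e list \<Rightarrow> bool" where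
  "multi_walk F ends vs es \<longleftrightarrow> length vs = Suc (length es) \<and>
     (\<forall>i<length es. es ! i \<in> F \<and> ends (es ! i) = {vs ! i, vs ! Suc i})"

text \<open>Prepend the first step to a simple walk; if it returns to a vertex of the walk, drop the part before that
  vertex.\<close>

lemma rtrancl_multi_adj_imp_simple_walk:
  assumes "(a, b) \<in> (multi_adj F ends)\<^sup>*"
  shows "\<exists>vs es. multi_walk F ends vs es \<and> distinct vs \<and> hd vs = a \<and> last vs = b"
  using assms
proof (induction rule: converse_rtrancl_induct)
  case base
  show ?case by (rule exI[of _ "[b]"], rule exI[of _ "[]"]) (simp add: multi_walk_def)
next
  case (step a c)
  obtain vs es where w: "multi_walk F ends vs es" "distinct vs" "hd vs = c" "last vs = b"
    using step.IH by blast
  then have ne: "vs \<noteq> []" by (auto simp: multi_walk_def)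
  obtain e where e: "e \<in> F" "ends e = {a, c}" using step.hyps(1) by (auto simp: multi_adj_def)
  show ?case
  proof (cases "a \<in> set vs")
    case False
    have "multi_walk F ends (a # vs) (e # es)"
      using w e ne by (auto simp: multi_walk_def nth_Cons hd_conv_nth split: nat.split)
    then show ?thesis using w False ne by (intro exI[of _ "a # vs"] exI[of _ "e # es"]) auto
  next
    case True
    then obtain k where k: "k < length vs" "vs ! k = a" by (auto simp: in_set_conv_nth)
    have "multi_walk F ends (drop k vs) (drop k es)"
      using w k by (auto simp: multi_walk_def)
    then show ?thesis using w k
      by (intro exI[of _ "drop k vs"] exI[of _ "drop k es"]) (auto simp: hd_drop_conv_nth)
  qed
qed

lemma multi_walk_distinct_edges:
  assumes "multi_walk F ends vs es" "distinct vs"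
  shows "distinct es"
proof -
  have "i = j" if ij: "i < length es" "j < length es" "es ! i = es ! j" for i j
  proof -
    have "{vs ! i, vs ! Suc i} = {vs ! j, vs ! Suc j}" using assms(1) ij unfolding multi_walk_def by metis
    moreover have idx: "vs ! p = vs ! q \<longleftrightarrow> p = q" if "p \<le> length es" "q \<le> length es" for p q
      using assms that by (intro nth_eq_iff_index_eq) (auto simp: multi_walk_def)
    ultimately show ?thesis
      using idx[of i j] idx[of i "Suc j"] idx[of "Suc i" j] ij unfolding doubleton_eq_iff by linarith
  qed
  then show ?thesis by (auto simp: distinct_conv_nth)
qed

lemma sym_multi_adj: "sym (multi_adj F ends \<inter> W \<times> W)"
  by (auto simp: sym_def multi_adj_def insert_commute)

lemma rtrancl_multi_adj_commute:
  "(a, b) \<in> (multi_adj F ends \<inter> W \<times> W)\<^sup>* \<Longrightarrow> (b, a) \<in> (multi_adj F ends \<inter> W \<times> W)\<^sup>*"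
  using sym_rtrancl[OF sym_multi_adj[of F ends W]] by (rule symD)

text \<open>An edge of a cycle can be replaced by the rest of the cycle. Conversely, if an edge is not needed for
  connectedness, then a simple walk between its end points that avoids it closes up to a cycle with it. Loops and
  parallel edges are the cases of walks with no and with one edge.\<close>

lemma multi_cycle_iff_redundant_edge:
  assumes conn: "multi_connected W F ends" and ends: "\<And>e. e \<in> F \<Longrightarrow> \<exists>a\<in>W. \<exists>b\<in>W. ends e = {a, b}"
  shows "(\<exists>vs es. multi_cycle F ends vs es) \<longleftrightarrow> (\<exists>e\<in>F. multi_connected W (F - {e}) ends)"
proof
  assume "\<exists>vs es. multi_cycle F ends vs es"
  then obtain vs es where c: "multi_cycle F ends vs es" by blast
  define k where "k = length es - 1"
  define e where "e = es ! k"
  let ?r = "multi_adj (F - {e}) ends \<inter> W \<times> W"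
  have len: "length es = Suc k" "length vs = Suc k" using c by (auto simp: multi_cycle_def k_def)
  have ei: "es ! i \<in> F" "ends (es ! i) = {vs ! i, vs ! (Suc i mod Suc k)}" if "i \<le> k" for i
  proof -
    have "i < length es" using that len by simp
    then show "es ! i \<in> F" using c unfolding multi_cycle_def by (meson nth_mem subsetD)
    show "ends (es ! i) = {vs ! i, vs ! (Suc i mod Suc k)}"
      using c \<open>i < length es\<close> unfolding multi_cycle_def len by blast
  qed
  have eF: "e \<in> F" and ends_e: "ends e = {vs ! k, vs ! 0}" using ei[of k] by (auto simp: e_def)
  have vW: "vs ! i \<in> W" if "i \<le> k" for i
    using ends[OF ei(1)[OF that]] ei(2)[OF that] by (auto simp: doubleton_eq_iff)
  have reach: "(vs ! 0, vs ! i) \<in> ?r\<^sup>*" if "i \<le> k" for i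
    using that
  proof (induction i)
    case (Suc i)
    have "es ! i \<noteq> e" using c Suc.prems len by (auto simp: e_def multi_cycle_def nth_eq_iff_index_eq)
    then have "(vs ! i, vs ! Suc i) \<in> ?r"
      using ei[of i] Suc.prems vW[of i] vW[of "Suc i"] by (auto simp: multi_adj_def)
    then show ?case using Suc by (meson Suc_leD rtrancl.rtrancl_into_rtrancl)
  qed simp
  have "multi_adj F ends \<inter> W \<times> W \<subseteq> ?r\<^sup>*"
  proof
    fix p assume "p \<in> multi_adj F ends \<inter> W \<times> W"
    then obtain a b d where p: "p = (a, b)" "d \<in> F" "ends d = {a, b}" "a \<in> W" "b \<in> W"
      by (auto simp: multi_adj_def)
    show "p \<in> ?r\<^sup>*"
    proof (cases "d = e")
      case True
      then have "(a = vs ! k \<and> b = vs ! 0) \<or> (a = vs ! 0 \<and> b = vs ! k)"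
        using p ends_e by (auto simp: doubleton_eq_iff)
      then show ?thesis using reach[of k] rtrancl_multi_adj_commute[OF reach[of k]] p by auto
    next
      case False
      then have "p \<in> ?r" using p by (auto simp: multi_adj_def)
      then show ?thesis by (rule r_into_rtrancl)
    qed
  qed
  then have "(multi_adj F ends \<inter> W \<times> W)\<^sup>* \<subseteq> ?r\<^sup>*" by (rule rtrancl_subset_rtrancl)
  then have "multi_connected W (F - {e}) ends" using conn unfolding multi_connected_def by blast
  then show "\<exists>e\<in>F. multi_connected W (F - {e}) ends" using eF by blast
next
  assume "\<exists>e\<in>F. multi_connected W (F - {e}) ends"
  then obtain e where e: "e \<in> F" "multi_connected W (F - {e}) ends" by blast
  obtain a b where ab: "a \<in> W" "b \<in> W" "ends e = {a, b}" using ends[OF e(1)] by blast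
  have "(a, b) \<in> (multi_adj (F - {e}) ends \<inter> W \<times> W)\<^sup>*"
    using e(2) ab unfolding multi_connected_def by blast
  then have "(a, b) \<in> (multi_adj (F - {e}) ends)\<^sup>*"
    by (rule rtrancl_mono[THEN subsetD, rotated]) blast
  from rtrancl_multi_adj_imp_simple_walk[OF this]
  obtain vs es where w: "multi_walk (F - {e}) ends vs es" "distinct vs" "hd vs = a" "last vs = b"
    by blast
  have des: "distinct es" by (rule multi_walk_distinct_edges[OF w(1,2)])
  have len: "length vs = Suc (length es)" using w(1) by (simp add: multi_walk_def)
  have "vs \<noteq> []" using len by auto
  then have ends_vs: "vs ! 0 = a" "vs ! length es = b"
    using w(3,4) len by (simp_all add: hd_conv_nth last_conv_nth)
  have es: "es ! i \<in> F - {e}" "ends (es ! i) = {vs ! i, vs ! Suc i}" if "i < length es" for i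
    using w(1) that unfolding multi_walk_def by blast+
  then have "set es \<subseteq> F - {e}" by (metis in_set_conv_nth subsetI)
  moreover have "ends ((es @ [e]) ! i) = {vs ! i, vs ! (Suc i mod length (es @ [e]))}"
    if "i < length (es @ [e])" for i
  proof (cases "i < length es")
    case True
    then show ?thesis using es(2) by (simp add: nth_append)
  next
    case False
    then have "i = length es" using that by simp
    then show ?thesis using ab(3) ends_vs by (simp add: insert_commute)
  qed
  ultimately have "multi_cycle F ends vs (es @ [e])"
    unfolding multi_cycle_def using w(2) des len e(1) by auto
  then show "\<exists>vs es. multi_cycle F ends vs es" by blast
qed

lemma wired_ends_pair:
  "wired_ends L {x, y} = {if x \<in> L then Some x else None, if y \<in> L then Some y else None}"
  by (simp add: wired_ends_def)

text \<open>A path from a set of vertices to the ghost has a first step leaving the set; conversely the vertices not joined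
  to the ghost form a set that no edge leaves.\<close>

lemma multi_connected_wired_iff:
  assumes T: "simple_edges T"
  shows "multi_connected (wired_verts L) T (wired_ends L) \<longleftrightarrow> cut_connected L T"
proof
  let ?r = "multi_adj T (wired_ends L) \<inter> wired_verts L \<times> wired_verts L"
  assume conn: "multi_connected (wired_verts L) T (wired_ends L)"
  show "cut_connected L T"
    unfolding cut_connected_def
  proof (intro allI impI)
    fix W assume W: "W \<subseteq> L" "W \<noteq> {}"
    then obtain v where v: "v \<in> W" by blast
    have "(Some v, None) \<in> ?r\<^sup>*"
      using conn v W unfolding multi_connected_def wired_verts_def by blast
    moreover have "\<exists>d\<in>T. d \<inter> W \<noteq> {} \<and> \<not> d \<subseteq> W"
      if "(x, y) \<in> ?r\<^sup>*" "x \<in> Some ` W" "y \<notin> Some ` W" for x y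
      using that
    proof (induction rule: rtrancl_induct)
      case (step y z)
      show ?case
      proof (cases "y \<in> Some ` W")
        case True
        obtain d where d: "d \<in> T" "wired_ends L d = {y, z}" using step.hyps(2) by (auto simp: multi_adj_def)
        have "y \<in> wired_ends L d" "z \<in> wired_ends L d" using d(2) by auto
        then obtain x1 x2 where x: "x1 \<in> d" "y = (if x1 \<in> L then Some x1 else None)"
            "x2 \<in> d" "z = (if x2 \<in> L then Some x2 else None)"
          unfolding wired_ends_def by blast
        have "x1 \<in> W" using x(2) True by (auto split: if_splits)
        moreover have "x2 \<notin> W" using x(4) step.prems(2) W(1) by (auto split: if_splits)
        ultimately have "x1 \<in> d \<inter> W" "x2 \<in> d" "x2 \<notin> W" using x by auto
        then show ?thesis using d(1) by blast
      qed (use step in blast)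
    qed simp
    ultimately show "\<exists>d\<in>T. d \<inter> W \<noteq> {} \<and> \<not> d \<subseteq> W" using v by blast
  qed
next
  let ?r = "multi_adj T (wired_ends L) \<inter> wired_verts L \<times> wired_verts L"
  assume cut: "cut_connected L T"
  define C where "C = {u \<in> L. (Some u, None) \<notin> ?r\<^sup>*}"
  have "C = {}"
  proof (rule ccontr)
    assume ne: "C \<noteq> {}"
    have "C \<subseteq> L" by (auto simp: C_def)
    from cut[unfolded cut_connected_def, rule_format, OF this ne]
    obtain d where d: "d \<in> T" "d \<inter> C \<noteq> {}" "\<not> d \<subseteq> C" by blast
    moreover have "card d = 2" using T d(1) by (auto simp: simple_edges_def)
    ultimately obtain x y where xy: "d = {x, y}" "x \<in> C" "y \<notin> C"
      by (auto simp: card_2_iff)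
    let ?y = "if y \<in> L then Some y else None"
    have "x \<in> L" using xy by (simp add: C_def)
    then have "(Some x, ?y) \<in> ?r"
      using d(1) xy by (auto simp: multi_adj_def wired_verts_def wired_ends_pair intro!: bexI[of _ d])
    moreover have "(?y, None) \<in> ?r\<^sup>*" using xy by (auto simp: C_def)
    ultimately have "(Some x, None) \<in> ?r\<^sup>*" by (rule converse_rtrancl_into_rtrancl)
    then show False using xy by (simp add: C_def)
  qed
  then have reach: "(x, None) \<in> ?r\<^sup>*" if "x \<in> wired_verts L" for x
    using that by (auto simp: wired_verts_def C_def)
  show "multi_connected (wired_verts L) T (wired_ends L)"
    unfolding multi_connected_def
    by (intro ballI) (rule rtrancl_trans[OF reach rtrancl_multi_adj_commute[OF reach]])
qed

text \<open>For connected edge sets, acyclic means minimal, and minimal means having as many edges as there are vertices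
  besides the ghost.\<close>

lemma wired_spanning_trees_eq:
  assumes "finite L" and E: "simple_edges E"
  shows "{T. multi_spanning_tree (wired_verts L) E (wired_ends L) T} = rooted_trees L E"
proof -
  have "(cut_connected L T \<and> (\<nexists>vs es. multi_cycle T (wired_ends L) vs es)) \<longleftrightarrow>
      card T = card L \<and> cut_connected L T" if "T \<subseteq> E" for T
  proof (cases "cut_connected L T")
    case True
    have T: "simple_edges T" using simple_edges_subset[OF E that] .
    have T': "simple_edges (T - {e})" for e using simple_edges_subset[OF T] by blast
    have ends: "\<exists>a\<in>wired_verts L. \<exists>b\<in>wired_verts L. wired_ends L e = {a, b}" if "e \<in> T" for e
    proof -
      obtain x y where "e = {x, y}" using T \<open>e \<in> T\<close> by (auto simp: simple_edges_def card_2_iff)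
      then show ?thesis by (auto simp: wired_ends_pair wired_verts_def)
    qed
    have "(\<exists>vs es. multi_cycle T (wired_ends L) vs es) \<longleftrightarrow> (\<exists>e\<in>T. cut_connected L (T - {e}))"
      using multi_cycle_iff_redundant_edge[of "wired_verts L" T "wired_ends L", OF _ ends] True
      by (simp add: multi_connected_wired_iff[OF T] multi_connected_wired_iff[OF T'])
    also have "\<dots> \<longleftrightarrow> card T \<noteq> card L"
    proof
      assume "\<exists>e\<in>T. cut_connected L (T - {e})"
      then obtain e where e: "e \<in> T" "cut_connected L (T - {e})" by blast
      have "card T = Suc (card (T - {e}))" using T e(1) by (intro card.remove) (auto simp: simple_edges_def)
      then show "card T \<noteq> card L" using cut_connected_card_le[OF assms(1) T' e(2)] by simp
    next
      assume "card T \<noteq> card L"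
      then show "\<exists>e\<in>T. cut_connected L (T - {e})"
        using minimal_cut_connected_card[OF assms(1) T True] by blast
    qed
    finally show ?thesis using True by blast
  qed simp
  then show ?thesis
    unfolding multi_spanning_tree_def rooted_trees_def
    using multi_connected_wired_iff[OF simple_edges_subset[OF E]] by blast
qed

section \<open>The triangular lattice\<close>

lemma unit_dirs_eq:
  "unit_dirs = {(1, 0), (1/2, sqrt 3 / 2), (-1/2, sqrt 3 / 2), (-1, 0), (-1/2, - sqrt 3 / 2), (1/2, - sqrt 3 / 2)}"
proof -
  have "{1..6::nat} = {1, 2, 3, 4, 5, 6}" by auto
  moreover have "lattice_dir 1 = (1, 0)" by (simp add: lattice_dir_def)
  moreover have "lattice_dir 2 = (1/2, sqrt 3 / 2)" by (simp add: lattice_dir_def cos_60 sin_60)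
  moreover have "lattice_dir 3 = (-1/2, sqrt 3 / 2)"
    using cos_120 sin_120 by (simp add: lattice_dir_def mult.commute)
  moreover have "lattice_dir 4 = (-1, 0)" by (simp add: lattice_dir_def)
  moreover have "pi * (real 5 - 1) / 3 = pi / 3 + pi" "pi * (real 6 - 1) / 3 = pi + (pi - pi / 3)" by simp_all
  then have "lattice_dir 5 = (-1/2, - sqrt 3 / 2)" "lattice_dir 6 = (1/2, - sqrt 3 / 2)"
    unfolding lattice_dir_def
    by (simp_all only: cos_add sin_add cos_diff sin_diff cos_pi sin_pi cos_60 sin_60) simp_all
  ultimately show ?thesis unfolding unit_dirs_def by simp
qed

lemma finite_unit_dirs [simp]: "finite unit_dirs"
  by (simp add: unit_dirs_eq)

lemma card_unit_dirs: "card unit_dirs = 6"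
  by (simp add: unit_dirs_eq)

lemma zero_notin_unit_dirs [simp]: "0 \<notin> unit_dirs"
  by (auto simp: unit_dirs_eq zero_prod_def)

lemma uminus_unit_dirs [simp]: "- e \<in> unit_dirs \<longleftrightarrow> e \<in> unit_dirs"
  by (cases e) (auto simp: unit_dirs_eq)

lemma nn_sym: "nn u v \<longleftrightarrow> nn v u"
  unfolding nn_def using uminus_unit_dirs[of "v - u"] by simp

lemma nn_irrefl [simp]: "\<not> nn u u"
  by (simp add: nn_def)

lemma nn_add_dir [simp]: "nn v (v + e) \<longleftrightarrow> e \<in> unit_dirs"
  by (simp add: nn_def)

lemma nbrs_eq: "{w. nn v w} = (+) v ` unit_dirs"
proof
  show "{w. nn v w} \<subseteq> (+) v ` unit_dirs"
  proof
    fix w assume "w \<in> {w. nn v w}"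
    then show "w \<in> (+) v ` unit_dirs" by (intro image_eqI[of _ _ "w - v"]) (auto simp: nn_def)
  qed
qed auto

lemma finite_nbrs [simp]: "finite {w. nn v w}"
  by (simp add: nbrs_eq)

lemma card_nbrs: "card {w. nn v w} = 6"
  by (simp add: nbrs_eq card_image card_unit_dirs)

lemma tri_lattice_nbr:
  assumes "v \<in> tri_lattice" "nn v w"
  shows "w \<in> tri_lattice"
proof -
  obtain a b :: int where v: "v = of_int a *\<^sub>R lattice_dir 1 + of_int b *\<^sub>R lattice_dir 2"
    using assms(1) by (auto simp: tri_lattice_def)
  have d: "lattice_dir 1 = (1, 0)" "lattice_dir 2 = (1/2, sqrt 3 / 2)"
    by (simp_all add: lattice_dir_def cos_60 sin_60)
  obtain e where e: "w = v + e" "e \<in> unit_dirs"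
    using assms(2) that[of "w - v"] by (auto simp: nn_def)
  have wit: "\<exists>i j :: int. e = of_int i *\<^sub>R lattice_dir 1 + of_int j *\<^sub>R lattice_dir 2"
    if "e = of_int i *\<^sub>R lattice_dir 1 + of_int j *\<^sub>R lattice_dir 2" for i j
    using that by blast
  have "\<exists>i j :: int. e = of_int i *\<^sub>R lattice_dir 1 + of_int j *\<^sub>R lattice_dir 2"
    using e(2) wit[of 1 0] wit[of 0 1] wit[of "-1" 1] wit[of "-1" 0] wit[of 0 "-1"] wit[of 1 "-1"]
    unfolding unit_dirs_eq d by auto
  then obtain i j :: int where "e = of_int i *\<^sub>R lattice_dir 1 + of_int j *\<^sub>R lattice_dir 2" by blast
  then have "w = of_int (a + i) *\<^sub>R lattice_dir 1 + of_int (b + j) *\<^sub>R lattice_dir 2"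
    unfolding e(1) v by (simp add: scaleR_add_left)
  then show ?thesis unfolding tri_lattice_def by blast
qed

text \<open>A point with maximal first coordinate has its right neighbour outside the set. Hence no finite set of sites is
  closed off, neither for the grains nor for the trees.\<close>

lemma exists_exposed_point:
  assumes "finite W" "W \<noteq> {}"
  obtains v w where "v \<in> W" "nn v w" "w \<notin> W"
proof -
  have "Max (fst ` W) \<in> fst ` W" using assms by (intro Max_in) auto
  then obtain v where "v \<in> W" "Max (fst ` W) = fst v" by auto
  moreover have "fst u \<le> Max (fst ` W)" if "u \<in> W" for u using assms(1) that by simp
  ultimately have v: "v \<in> W" "\<And>u. u \<in> W \<Longrightarrow> fst u \<le> fst v" by auto
  moreover have "nn v (v + (1, 0))" by (simp add: unit_dirs_eq)
  moreover have "v + (1, 0) \<notin> W" using v(2)[of "v + (1, 0)"] by auto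
  ultimately show ?thesis using that[of v "v + (1, 0)"] v(1) by simp
qed

lemma wired_edges_eq: "L \<subseteq> tri_lattice \<Longrightarrow> wired_edges L = {{u, w} | u w. u \<in> L \<and> nn u w}"
  unfolding wired_edges_def
  by (intro Collect_cong iff_exI conj_cong refl) (auto dest: tri_lattice_nbr)

lemma edges_at_vertex:
  assumes "L \<subseteq> tri_lattice" "v \<in> L"
  shows "{d \<in> wired_edges L. v \<in> d} = (\<lambda>w. {v, w}) ` {w. nn v w}"
proof (intro equalityI subsetI)
  fix d assume "d \<in> {d \<in> wired_edges L. v \<in> d}"
  then obtain u w where uw: "d = {u, w}" "nn u w" "v = u \<or> v = w"
    unfolding wired_edges_eq[OF assms(1)] by blast
  then show "d \<in> (\<lambda>w. {v, w}) ` {w. nn v w}"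
    using nn_sym[of u w] by (auto simp: insert_commute)
next
  fix d assume "d \<in> (\<lambda>w. {v, w}) ` {w. nn v w}"
  then show "d \<in> {d \<in> wired_edges L. v \<in> d}"
    unfolding wired_edges_eq[OF assms(1)] using assms(2) by blast
qed

lemma simple_edges_wired:
  assumes "finite L" "L \<subseteq> tri_lattice"
  shows "simple_edges (wired_edges L)"
proof -
  have "wired_edges L = (\<Union>v\<in>L. (\<lambda>w. {v, w}) ` {w. nn v w})"
    unfolding wired_edges_eq[OF assms(2)] by auto
  moreover have "card {u, w} = 2" if "nn u w" for u w using that by (cases "u = w") auto
  ultimately show ?thesis using assms(1) by (auto simp: simple_edges_def)
qed

lemma pair_in_wired_edges:
  assumes "L \<subseteq> tri_lattice" "u \<in> L"
  shows "{u, v} \<in> wired_edges L \<longleftrightarrow> nn u v"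
proof -
  have "{u, v} \<in> wired_edges L \<longleftrightarrow> {u, v} \<in> {d \<in> wired_edges L. u \<in> d}" by simp
  also have "\<dots> \<longleftrightarrow> nn u v" unfolding edges_at_vertex[OF assms] by (auto simp: doubleton_eq_iff)
  finally show ?thesis .
qed

lemma edge_degree_wired:
  assumes "L \<subseteq> tri_lattice" "v \<in> L"
  shows "edge_degree (wired_edges L) v = 6"
proof -
  have "inj_on (\<lambda>w. {v, w}) {w. nn v w}" by (auto simp: inj_on_def doubleton_eq_iff)
  then show ?thesis unfolding edge_degree_def edges_at_vertex[OF assms] by (simp add: card_image card_nbrs)
qed

lemma inner_degree_wired:
  assumes "L \<subseteq> tri_lattice" "v \<in> L" "v \<in> W"
  shows "inner_degree (wired_edges L) W v = card {w \<in> W. nn v w}"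
proof -
  have "{d \<in> wired_edges L. v \<in> d \<and> d \<subseteq> W} = {d \<in> {d \<in> wired_edges L. v \<in> d}. d \<subseteq> W}" by blast
  also have "\<dots> = (\<lambda>w. {v, w}) ` {w \<in> W. nn v w}"
    unfolding edges_at_vertex[OF assms(1,2)] using assms(3) by blast
  finally have "{d \<in> wired_edges L. v \<in> d \<and> d \<subseteq> W} = (\<lambda>w. {v, w}) ` {w \<in> W. nn v w}" .
  moreover have "inj_on (\<lambda>w. {v, w}) {w \<in> W. nn v w}" by (auto simp: inj_on_def doubleton_eq_iff)
  ultimately show ?thesis by (simp add: inner_degree_def card_image)
qed

lemma graph_laplacian_wired:
  assumes "L \<subseteq> tri_lattice" "u \<in> L"
  shows "graph_laplacian (wired_edges L) u v = - lattice_laplacian u v"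
  using pair_in_wired_edges[OF assms] edge_degree_wired[OF assms]
  by (auto simp: graph_laplacian_def lattice_laplacian_def)

section \<open>Stationary measures of random bijections\<close>

text \<open>Choosing the index first, each step is a bijection of \<open>R\<close> and preserves the uniform distribution.\<close>

lemma stationary_of_commuting_bijections:
  fixes a :: "'i \<Rightarrow> 's \<Rightarrow> 's"
  assumes I: "finite I" "I \<noteq> {}" and R: "finite R" "R \<noteq> {}"
    and bij: "\<And>i. i \<in> I \<Longrightarrow> bij_betw (a i) R R"
  shows "bind_pmf (pmf_of_set R) (\<lambda>s. map_pmf (\<lambda>i. a i s) (pmf_of_set I)) = pmf_of_set R"
proof -
  have "bind_pmf (pmf_of_set R) (\<lambda>s. map_pmf (\<lambda>i. a i s) (pmf_of_set I)) =
      bind_pmf (pmf_of_set I) (\<lambda>i. map_pmf (a i) (pmf_of_set R))"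
    unfolding map_pmf_def by (rule bind_commute_pmf)
  also have "\<dots> = bind_pmf (pmf_of_set I) (\<lambda>i. pmf_of_set R)"
    by (rule bind_pmf_cong) (use I R bij in \<open>auto simp: map_pmf_of_set_bij_betw\<close>)
  finally show ?thesis by simp
qed

text \<open>The set \<open>R\<close> is absorbing and reached from everywhere through \<open>m\<close>, so a stationary
  measure lives on \<open>R\<close>. On \<open>R\<close> its density is harmonic, and by the maximum principle it
  is constant.\<close>

lemma stationary_unique:
  fixes a :: "'i \<Rightarrow> 's \<Rightarrow> 's"
  assumes I: "finite I" "I \<noteq> {}" and R: "finite R" "m \<in> R"
    and bij: "\<And>i. i \<in> I \<Longrightarrow> bij_betw (a i) R R"
    and reach: "\<And>s. s \<in> C \<Longrightarrow> (s, m) \<in> {(s, a i s) | s i. i \<in> I}\<^sup>*"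
    and \<mu>C: "set_pmf \<mu> \<subseteq> C" and RC: "R \<subseteq> C"
    and stat: "bind_pmf \<mu> (\<lambda>s. map_pmf (\<lambda>i. a i s) (pmf_of_set I)) = \<mu>"
  shows "\<mu> = pmf_of_set R"
proof -
  let ?K = "\<lambda>s. map_pmf (\<lambda>i. a i s) (pmf_of_set I)"
  have supp_step: "a i s \<in> set_pmf \<mu>" if "s \<in> set_pmf \<mu>" "i \<in> I" for s i
  proof -
    have "a i s \<in> set_pmf (bind_pmf \<mu> ?K)" using that I by (auto simp: set_pmf_of_set)
    then show ?thesis unfolding stat .
  qed
  (* R is absorbing, so in equilibrium no mass can flow into it *)
  have absorb: "s \<in> R" if s: "s \<in> set_pmf \<mu>" and i: "i \<in> I" and stays: "a i s \<in> R" for s i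
  proof (rule ccontr)
    assume "s \<notin> R"
    have KR: "measure (measure_pmf (?K x)) R = 1" if "x \<in> R" for x
    proof -
      have "set_pmf (?K x) \<subseteq> R" using I bij that by (auto simp: set_pmf_of_set bij_betw_def)
      then show ?thesis by (simp add: measure_pmf.prob_eq_1 AE_measure_pmf_iff subset_iff)
    qed
    let ?g = "\<lambda>x. measure (measure_pmf (?K x)) R - indicator R x"
    have int: "integrable (measure_pmf \<mu>) (\<lambda>x. measure (measure_pmf (?K x)) R)"
      by (rule measure_pmf.integrable_const_bound[of _ 1]) auto
    have int': "integrable (measure_pmf \<mu>) (indicator R :: _ \<Rightarrow> real)"
      by (rule measure_pmf.integrable_const_bound[of _ 1]) (auto simp: indicator_def)
    have "measure (measure_pmf \<mu>) R = measure (measure_pmf (bind_pmf \<mu> ?K)) R" by (simp add: stat)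
    also have "\<dots> = (\<integral>x. measure (measure_pmf (?K x)) R \<partial>measure_pmf \<mu>)"
    proof -
      have *: "measure (measure_pmf p) R = pmf (map_pmf (\<lambda>y. y \<in> R) p) True" for p
        by (simp add: pmf_map vimage_def)
      show ?thesis unfolding * map_bind_pmf pmf_bind ..
    qed
    finally have "(\<integral>x. ?g x \<partial>measure_pmf \<mu>) = 0"
      using int int' by (simp add: Bochner_Integration.integral_diff)
    moreover have "?g x \<ge> 0" for x using KR by (cases "x \<in> R") auto
    ultimately have "AE x in measure_pmf \<mu>. ?g x = 0"
      using int int' by (subst (asm) integral_nonneg_eq_0_iff_AE) auto
    then have "?g s = 0" using s by (simp add: AE_measure_pmf_iff)
    then have "measure (measure_pmf (?K s)) R = 0" using \<open>s \<notin> R\<close> by simp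
    then have "set_pmf (?K s) \<inter> R = {}" using measure_pmf_zero_iff[of "?K s" R] by blast
    moreover have "a i s \<in> set_pmf (?K s)" using i I by (auto simp: set_pmf_of_set)
    ultimately show False using stays by blast
  qed
  have supp: "s \<in> R" if "s \<in> set_pmf \<mu>" for s
  proof -
    have "(s, m) \<in> {(s, a i s) | s i. i \<in> I}\<^sup>*" using reach that \<mu>C by blast
    then have "s \<in> set_pmf \<mu> \<longrightarrow> s \<in> R"
    proof (induction rule: converse_rtrancl_induct)
      case (step s t)
      then show ?case using supp_step absorb by blast
    qed (use R in simp)
    then show ?thesis using that by blast
  qed
  define f where "f = pmf \<mu>"
  define b where "b = (\<lambda>i. inv_into R (a i))"
  have ba: "b i (a i s) = s" and ab: "a i (b i s) = s" and bR: "b i s \<in> R" and aR: "a i s \<in> R"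
    if "i \<in> I" "s \<in> R" for i s
    using bij[OF that(1)] that(2) unfolding b_def
    by (auto simp: bij_betw_def f_inv_into_f inv_into_into)
  have mean: "real (card I) * f s = (\<Sum>i\<in>I. f (b i s))" if s: "s \<in> R" for s
  proof -
    have "f s = pmf (bind_pmf \<mu> ?K) s" unfolding f_def stat ..
    also have "bind_pmf \<mu> ?K = bind_pmf (pmf_of_set I) (\<lambda>i. map_pmf (a i) \<mu>)"
      unfolding map_pmf_def by (rule bind_commute_pmf)
    also have "pmf \<dots> s = (\<Sum>i\<in>I. pmf (map_pmf (a i) \<mu>) s) / card I"
      by (rule pmf_bind_pmf_of_set) (use I in auto)
    also have "(\<Sum>i\<in>I. pmf (map_pmf (a i) \<mu>) s) = (\<Sum>i\<in>I. f (b i s))"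
    proof (rule sum.cong[OF refl])
      fix i assume i: "i \<in> I"
      have "pmf (map_pmf (a i) \<mu>) s = measure (measure_pmf \<mu>) (a i -` {s} \<inter> set_pmf \<mu>)"
        by (simp add: pmf_map measure_Int_set_pmf)
      also have "a i -` {s} \<inter> set_pmf \<mu> = {b i s} \<inter> set_pmf \<mu>"
        using supp ba[OF i] ab[OF i s] by auto
      also have "measure (measure_pmf \<mu>) \<dots> = f (b i s)"
        by (simp add: measure_Int_set_pmf f_def pmf.rep_eq)
      finally show "pmf (map_pmf (a i) \<mu>) s = f (b i s)" .
    qed
    finally show ?thesis using I by (simp add: field_simps)
  qed
  (* at a maximum of f all terms of the mean are maximal, so b does not leave the set of maxima;
     being injective on this finite set, it is onto, and neither does a *)
  define M where "M = Max (f ` R)"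
  have fle: "f s \<le> M" if "s \<in> R" for s using R that by (simp add: M_def)
  define X where "X = {s \<in> R. f s = M}"
  have Xb: "b i s \<in> X" if i: "i \<in> I" and s: "s \<in> X" for i s
  proof -
    have sR: "s \<in> R" using s by (simp add: X_def)
    have "(\<Sum>j\<in>I. M - f (b j s)) = 0"
      using mean[OF sR] s by (simp add: sum_subtractf X_def)
    then have "M - f (b i s) = 0"
      using sum_nonneg_eq_0_iff[OF I(1), of "\<lambda>j. M - f (b j s)"] fle bR[OF _ sR] i by simp
    then show ?thesis using bR[OF i sR] by (simp add: X_def)
  qed
  have finX: "finite X" using R by (simp add: X_def)
  have Xa: "a i s \<in> X" if i: "i \<in> I" and s: "s \<in> X" for i s
  proof -
    have "inj_on (b i) X"
      by (rule inj_onI) (metis ab[OF i] X_def mem_Collect_eq)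
    then have "b i ` X = X"
      using Xb[OF i] finX by (intro card_subset_eq) (auto simp: card_image)
    then obtain t where "t \<in> X" "s = b i t" using s by blast
    then show ?thesis using ab[OF i, of t] by (simp add: X_def)
  qed
  have "M \<in> f ` R" unfolding M_def using R by (intro Max_in) auto
  then obtain s0 where "s0 \<in> X" by (auto simp: X_def)
  moreover have "t \<in> X" if "(s, t) \<in> {(s, a i s) | s i. i \<in> I}\<^sup>*" "s \<in> X" for s t
    using that by (induction rule: rtrancl_induct) (auto intro: Xa)
  ultimately have mX: "m \<in> X" using reach[of s0] RC by (auto simp: X_def)
  have RX: "s \<in> X" if "s \<in> R" for s
  proof -
    have "(s, m) \<in> {(s, a i s) | s i. i \<in> I}\<^sup>*" using reach that RC by blast
    then have "s \<in> R \<longrightarrow> s \<in> X"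
    proof (induction rule: converse_rtrancl_induct)
      case (step s t)
      then obtain i where i: "i \<in> I" "t = a i s" by blast
      show ?case
      proof
        assume "s \<in> R"
        then have "b i (a i s) \<in> X" using step i aR by (intro Xb) auto
        then show "s \<in> X" using ba[OF i(1) \<open>s \<in> R\<close>] by simp
      qed
    qed (use mX in simp)
    then show ?thesis using that by blast
  qed
  have f: "f s = M" if "s \<in> R" for s using RX[OF that] by (simp add: X_def)
  have "(\<Sum>s\<in>R. f s) = 1" unfolding f_def using R supp by (intro sum_pmf_eq_1) auto
  then have "real (card R) * M = 1" using f by simp
  then have M: "M = 1 / real (card R)" by (metis mult_eq_0_iff nonzero_eq_divide_eq mult.commute zero_neq_one)
  have "R \<noteq> {}" using R by blast
  note pmf_R = pmf_of_set[OF this R(1)]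
  show ?thesis
  proof (rule pmf_eqI)
    fix s
    show "pmf \<mu> s = pmf (pmf_of_set R) s"
    proof (cases "s \<in> R")
      case True
      then show ?thesis using f M by (simp add: f_def pmf_R)
    next
      case False
      then have "pmf \<mu> s = 0" using supp by (auto simp: set_pmf_iff)
      then show ?thesis using False by (simp add: pmf_R)
    qed
  qed
qed

section \<open>The Abelian sandpile\<close>

lemma topple_commute:
  assumes "v \<noteq> w" "\<rho> v > 6" "\<rho> w > 6"
  shows "topple L v (topple L w \<rho>) = topple L w (topple L v \<rho>)"
  using assms by (auto simp: topple_def fun_eq_iff restrict_def)

lemma topplingE:
  assumes "toppling L \<rho> \<sigma>"
  obtains v where "v \<in> L" "\<rho> v > 6" "\<sigma> = topple L v \<rho>"
  using assms unfolding toppling_def by blast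

lemma topplingI: "v \<in> L \<Longrightarrow> \<rho> v > 6 \<Longrightarrow> toppling L \<rho> (topple L v \<rho>)"
  unfolding toppling_def by blast

text \<open>A site that can topple can still do so after another one has, and the order does not matter.\<close>

lemma toppling_diamond:
  assumes "toppling L \<rho> \<sigma>" "toppling L \<rho> \<tau>" "\<sigma> \<noteq> \<tau>"
  shows "\<exists>\<xi>. toppling L \<sigma> \<xi> \<and> toppling L \<tau> \<xi>"
proof -
  obtain v w where v: "v \<in> L" "\<rho> v > 6" "\<sigma> = topple L v \<rho>" and w: "w \<in> L" "\<rho> w > 6" "\<tau> = topple L w \<rho>"
    using assms(1,2) by (auto simp: toppling_def)
  have ne: "v \<noteq> w" using assms(3) v w by auto
  have "topple L v \<rho> w > 6" "topple L w \<rho> v > 6" using v w ne by (auto simp: topple_def)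
  then show ?thesis
    using v w topple_commute[OF ne v(2) w(2), of L] unfolding toppling_def by metis
qed

text \<open>The function \<open>C - |v|\<^sup>2\<close> is strictly superharmonic, and for large \<open>C\<close> it is nonnegative on the sites and
  their neighbours. So its pairing with the configuration is nonnegative and drops by at least one in
  every toppling; grains lost at the boundary only make it smaller.\<close>

lemma toppling_potential:
  assumes "finite L"
  shows "\<exists>m :: (point \<Rightarrow> nat) \<Rightarrow> nat. \<forall>\<rho> \<rho>'. toppling L \<rho> \<rho>' \<longrightarrow> m \<rho>' < m \<rho>"
proof -
  define q :: "point \<Rightarrow> real" where "q = (\<lambda>v. (fst v)\<^sup>2 + (snd v)\<^sup>2)"
  define C where "C = Max (insert 0 (q ` (\<Union>v\<in>L. insert v {w. nn v w})))"
  define h where "h = (\<lambda>v. C - q v)"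
  have fin: "finite (insert 0 (q ` (\<Union>v\<in>L. insert v {w. nn v w})))" using assms by simp
  have h0: "h v \<ge> 0" if "v \<in> L" for v
    unfolding h_def C_def using Max_ge[OF fin, of "q v"] that by auto
  have h1: "h w \<ge> 0" if "v \<in> L" "nn v w" for v w
    unfolding h_def C_def using Max_ge[OF fin, of "q w"] that by auto
  have sup: "(\<Sum>w | nn v w. h w) = 6 * h v - 6" for v
  proof -
    have "(\<Sum>w | nn v w. h w) = (\<Sum>e\<in>unit_dirs. h (v + e))"
      unfolding nbrs_eq by (simp add: sum.reindex)
    also have "\<dots> = 6 * h v - 6"
      by (cases v) (simp add: unit_dirs_eq h_def q_def power2_eq_square field_simps)
    finally show ?thesis .
  qed
  define \<Phi> where "\<Phi> = (\<lambda>\<rho>. \<Sum>v\<in>L. real (\<rho> v) * h v)"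
  have dec: "\<Phi> \<rho>' \<le> \<Phi> \<rho> - 1" if t: "toppling L \<rho> \<rho>'" for \<rho> \<rho>'
  proof -
    obtain v where v: "v \<in> L" "\<rho> v > 6" "\<rho>' = topple L v \<rho>" using topplingE[OF t] .
    have "\<Phi> \<rho>' = (\<Sum>w\<in>L. real (\<rho> w) * h w - 6 * (of_bool (w = v) * h w) + of_bool (nn v w) * h w)"
      unfolding \<Phi>_def using v by (intro sum.cong) (auto simp: topple_def of_nat_diff algebra_simps)
    also have "\<dots> = \<Phi> \<rho> - 6 * h v + (\<Sum>w\<in>{w \<in> L. nn v w}. h w)"
      using assms v(1)
      by (simp add: sum.distrib sum_subtractf \<Phi>_def sum_distrib_left[symmetric] of_bool_def
          if_distrib[of "\<lambda>x. x * _"] sum.delta sum.inter_filter cong: if_cong)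
    also have "(\<Sum>w\<in>{w \<in> L. nn v w}. h w) \<le> (\<Sum>w | nn v w. h w)"
      using h1[OF v(1)] by (intro sum_mono2) auto
    finally show ?thesis using sup[of v] by simp
  qed
  have pos: "\<Phi> \<rho> \<ge> 0" for \<rho> unfolding \<Phi>_def using h0 by (intro sum_nonneg) auto
  show ?thesis
  proof (intro exI[of _ "\<lambda>\<rho>. nat \<lfloor>\<Phi> \<rho>\<rfloor>"] allI impI)
    fix \<rho> \<rho>' assume "toppling L \<rho> \<rho>'"
    from dec[OF this] pos[of \<rho>'] show "nat \<lfloor>\<Phi> \<rho>'\<rfloor> < nat \<lfloor>\<Phi> \<rho>\<rfloor>" by linarith
  qed
qed

definition stable :: "point set \<Rightarrow> (point \<Rightarrow> nat) \<Rightarrow> bool" where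
  "stable L \<rho> \<longleftrightarrow> (\<forall>v\<in>L. \<rho> v \<le> 6)"

lemma stable_iff: "stable L \<rho> \<longleftrightarrow> (\<nexists>\<rho>'. toppling L \<rho> \<rho>')"
  unfolding stable_def toppling_def by (meson not_le)

text \<open>Newman's argument: termination and the diamond property.\<close>

lemma stabilization_unique:
  assumes "finite L"
  shows "\<exists>!\<sigma>. (toppling L)\<^sup>*\<^sup>* \<rho> \<sigma> \<and> stable L \<sigma>"
proof -
  obtain m :: "(point \<Rightarrow> nat) \<Rightarrow> nat" where m: "\<And>\<rho> \<rho>'. toppling L \<rho> \<rho>' \<Longrightarrow> m \<rho>' < m \<rho>"
    using toppling_potential[OF assms] by blast
  show ?thesis
  proof (induction "m \<rho>" arbitrary: \<rho> rule: less_induct)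
    case less
    show ?case
    proof (cases "stable L \<rho>")
      case True
      then have "\<sigma> = \<rho>" if "(toppling L)\<^sup>*\<^sup>* \<rho> \<sigma>" for \<sigma>
        using that by (auto simp: stable_iff elim: converse_rtranclpE)
      then show ?thesis using True by blast
    next
      case False
      then obtain \<tau> where \<tau>: "toppling L \<rho> \<tau>" by (auto simp: stable_iff)
      from less[OF m[OF \<tau>]] obtain \<sigma> where
        \<sigma>: "(toppling L)\<^sup>*\<^sup>* \<tau> \<sigma>" "stable L \<sigma>" and uniq: "\<And>x. (toppling L)\<^sup>*\<^sup>* \<tau> x \<Longrightarrow> stable L x \<Longrightarrow> x = \<sigma>"
        by blast
      show ?thesis
      proof (rule ex1I[of _ \<sigma>])
        show "(toppling L)\<^sup>*\<^sup>* \<rho> \<sigma> \<and> stable L \<sigma>"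
          using \<tau> \<sigma> by (blast intro: converse_rtranclp_into_rtranclp)
        fix x assume x: "(toppling L)\<^sup>*\<^sup>* \<rho> x \<and> stable L x"
        then obtain \<xi> where \<xi>: "toppling L \<rho> \<xi>" "(toppling L)\<^sup>*\<^sup>* \<xi> x"
          using False by (auto elim: converse_rtranclpE)
        show "x = \<sigma>"
        proof (cases "\<xi> = \<tau>")
          case True
          then show ?thesis using uniq x \<xi> by blast
        next
          case False
          obtain \<zeta> where \<zeta>: "toppling L \<xi> \<zeta>" "toppling L \<tau> \<zeta>"
            using toppling_diamond[OF \<xi>(1) \<tau> False] by blast
          have "m \<zeta> < m \<rho>" using m[OF \<tau>] m[OF \<zeta>(2)] by simp
          from less[OF this] obtain y where y: "(toppling L)\<^sup>*\<^sup>* \<zeta> y" "stable L y" by blast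
          have "y = \<sigma>" using y \<zeta>(2) by (intro uniq) (auto intro: converse_rtranclp_into_rtranclp)
          moreover have "y = x"
            using less[OF m[OF \<xi>(1)]] x \<xi>(2) y \<zeta>(1) by (blast intro: converse_rtranclp_into_rtranclp)
          ultimately show ?thesis by simp
        qed
      qed
    qed
  qed
qed

lemma stabilize_works:
  assumes "finite L"
  shows "(toppling L)\<^sup>*\<^sup>* \<rho> (stabilize L \<rho>)" "stable L (stabilize L \<rho>)"
  using theI'[OF stabilization_unique[OF assms, of \<rho>]]
  by (simp_all add: stabilize_def stable_def)

lemma stabilize_eqI:
  assumes "finite L" "(toppling L)\<^sup>*\<^sup>* \<rho> \<sigma>" "stable L \<sigma>"
  shows "stabilize L \<rho> = \<sigma>"
  using stabilization_unique[OF assms(1), of \<rho>] stabilize_works[OF assms(1), of \<rho>] assms(2,3) by blast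

lemma stabilize_toppling:
  assumes "finite L" "(toppling L)\<^sup>*\<^sup>* \<rho> \<sigma>"
  shows "stabilize L \<rho> = stabilize L \<sigma>"
  by (rule stabilize_eqI[OF assms(1)])
    (use stabilize_works[OF assms(1), of \<sigma>] assms(2) in \<open>auto intro: rtranclp_trans\<close>)

definition add_grains :: "point set \<Rightarrow> (point \<Rightarrow> nat) \<Rightarrow> (point \<Rightarrow> nat) \<Rightarrow> (point \<Rightarrow> nat)" where
  "add_grains L x \<rho> = (\<lambda>v\<in>L. \<rho> v + x v)"

definition addition_op :: "point set \<Rightarrow> (point \<Rightarrow> nat) \<Rightarrow> (point \<Rightarrow> nat) \<Rightarrow> (point \<Rightarrow> nat)" where
  "addition_op L x \<rho> = stabilize L (add_grains L x \<rho>)"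

lemma toppling_add_grains:
  assumes "toppling L \<rho> \<sigma>"
  shows "toppling L (add_grains L x \<rho>) (add_grains L x \<sigma>)"
proof -
  obtain v where v: "v \<in> L" "\<rho> v > 6" "\<sigma> = topple L v \<rho>" using topplingE[OF assms] .
  have "add_grains L x \<sigma> = topple L v (add_grains L x \<rho>)"
    using v by (auto simp: add_grains_def topple_def fun_eq_iff restrict_def)
  moreover have "add_grains L x \<rho> v > 6" using v by (simp add: add_grains_def)
  ultimately show ?thesis using topplingI[OF v(1), of "add_grains L x \<rho>"] by simp
qed

lemma topplings_add_grains:
  "(toppling L)\<^sup>*\<^sup>* \<rho> \<sigma> \<Longrightarrow> (toppling L)\<^sup>*\<^sup>* (add_grains L x \<rho>) (add_grains L x \<sigma>)"
  by (induction rule: rtranclp_induct) (auto intro: toppling_add_grains rtranclp.rtrancl_into_rtrancl)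

text \<open>Legal topplings remain legal when grains are added, so grains can be added before or after stabilisation. In
  particular the operators commute.\<close>

lemma addition_op_add:
  assumes "finite L"
  shows "addition_op L x (addition_op L y \<rho>) = addition_op L (\<lambda>v. x v + y v) \<rho>"
proof -
  have "add_grains L x (add_grains L y \<rho>) = add_grains L (\<lambda>v. x v + y v) \<rho>"
    by (auto simp: add_grains_def fun_eq_iff restrict_def)
  then show ?thesis
    unfolding addition_op_def
    using stabilize_toppling[OF assms topplings_add_grains[OF stabilize_works(1)[OF assms]], of x "add_grains L y \<rho>"]
    by simp
qed

definition no_forbidden_set :: "point set \<Rightarrow> (point \<Rightarrow> nat) \<Rightarrow> bool" where
  "no_forbidden_set L \<rho> \<longleftrightarrow> \<rho> \<in> extensional L \<and> (\<forall>v\<in>L. 1 \<le> \<rho> v) \<and>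
     (\<forall>W\<subseteq>L. W \<noteq> {} \<longrightarrow> (\<exists>v\<in>W. card {w \<in> W. nn v w} < \<rho> v))"

lemma no_forbidden_set_add_grains:
  assumes "no_forbidden_set L \<rho>"
  shows "no_forbidden_set L (add_grains L x \<rho>)"
  unfolding no_forbidden_set_def
proof (intro conjI allI impI)
  show "add_grains L x \<rho> \<in> extensional L" by (simp add: add_grains_def)
  show "\<forall>v\<in>L. 1 \<le> add_grains L x \<rho> v"
    using assms by (auto simp: no_forbidden_set_def add_grains_def intro: trans_le_add1)
  fix W assume W: "W \<subseteq> L" "W \<noteq> {}"
  then obtain v where v: "v \<in> W" "card {w \<in> W. nn v w} < \<rho> v"
    using assms unfolding no_forbidden_set_def by blast
  then show "\<exists>v\<in>W. card {w \<in> W. nn v w} < add_grains L x \<rho> v"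
    using W by (intro bexI[of _ v]) (auto simp: add_grains_def)
qed

lemma card_nbrs_Diff:
  assumes "finite W" "v \<in> W"
  shows "card {w \<in> W. nn u w} = card {w \<in> W - {v}. nn u w} + of_bool (nn u v)"
proof (cases "nn u v")
  case True
  then have "{w \<in> W. nn u w} = insert v {w \<in> W - {v}. nn u w}" using assms(2) by blast
  then show ?thesis using True assms(1) by simp
next
  case False
  then have "{w \<in> W. nn u w} = {w \<in> W - {v}. nn u w}" by blast
  then show ?thesis using False by simp
qed

text \<open>Suppose \<open>v\<close> topples and \<open>W\<close> is forbidden afterwards. If \<open>v\<close> is not in
  \<open>W\<close>, heights on \<open>W\<close> did not decrease and \<open>W\<close> was forbidden before.
  Otherwise \<open>W - {v}\<close> was forbidden before: each of its sites received from \<open>v\<close> just the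
  grain that its degree in \<open>W\<close> loses.\<close>

lemma no_forbidden_set_toppling:
  assumes "finite L" "no_forbidden_set L \<rho>" "toppling L \<rho> \<sigma>"
  shows "no_forbidden_set L \<sigma>"
proof -
  obtain v where v: "v \<in> L" "\<rho> v > 6" "\<sigma> = topple L v \<rho>" using topplingE[OF assms(3)] .
  have \<sigma>: "\<sigma> w = (if w = v then \<rho> w - 6 else \<rho> w + of_bool (nn v w))" if "w \<in> L" for w
    using that v by (auto simp: topple_def)
  have pos: "1 \<le> \<rho> w" if "w \<in> L" for w using assms(2) that by (auto simp: no_forbidden_set_def)
  show ?thesis
    unfolding no_forbidden_set_def
  proof (intro conjI allI impI ballI)
    show "\<sigma> \<in> extensional L" using v by (simp add: topple_def)
    show pos': "1 \<le> \<sigma> w" if "w \<in> L" for w using \<sigma>[OF that] pos[OF that] v(2) by auto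
    fix W assume W: "W \<subseteq> L" "W \<noteq> {}"
    have finW: "finite W" using assms(1) W finite_subset by blast
    show "\<exists>u\<in>W. card {w \<in> W. nn u w} < \<sigma> u"
    proof (cases "v \<in> W")
      case False
      obtain u where u: "u \<in> W" "card {w \<in> W. nn u w} < \<rho> u"
        using assms(2) W unfolding no_forbidden_set_def by blast
      moreover have "u \<in> L" "u \<noteq> v" using u W False by blast+
      then have "\<rho> u \<le> \<sigma> u" using \<sigma>[of u] by simp
      ultimately show ?thesis by (intro bexI[of _ u]) auto
    next
      case True
      show ?thesis
      proof (cases "W = {v}")
        case True
        have none: "{w \<in> W. nn v w} = {}" unfolding True by auto
        have "card {w \<in> W. nn v w} < \<sigma> v" unfolding none using pos'[OF v(1)] by simp
        then show ?thesis unfolding True by blast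
      next
        case False
        then have "W - {v} \<subseteq> L" "W - {v} \<noteq> {}" using W True by auto
        then obtain u where u: "u \<in> W - {v}" "card {w \<in> W - {v}. nn u w} < \<rho> u"
          using assms(2) unfolding no_forbidden_set_def by blast
        then have "card {w \<in> W. nn u w} < \<sigma> u"
          using \<sigma>[of u] W card_nbrs_Diff[OF finW True, of u] nn_sym[of u v] by auto
        then show ?thesis using u by blast
      qed
    qed
  qed
qed

lemma no_forbidden_set_topplings:
  assumes "finite L" "no_forbidden_set L \<rho>" "(toppling L)\<^sup>*\<^sup>* \<rho> \<sigma>"
  shows "no_forbidden_set L \<sigma>"
  using assms(3,2) by (induction rule: rtranclp_induct) (auto intro: no_forbidden_set_toppling[OF assms(1)])

definition recurrent_sandpiles :: "point set \<Rightarrow> (point \<Rightarrow> nat) set" where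
  "recurrent_sandpiles L = {\<rho>. no_forbidden_set L \<rho> \<and> stable L \<rho>}"

lemma recurrent_sandpiles_eq:
  assumes "L \<subseteq> tri_lattice"
  shows "recurrent_sandpiles L = recurrent_configs L (wired_edges L)"
proof -
  have *: "(\<forall>W\<subseteq>L. W \<noteq> {} \<longrightarrow> (\<exists>v\<in>W. card {w \<in> W. nn v w} < \<rho> v)) \<longleftrightarrow>
      (\<forall>W\<subseteq>L. W \<noteq> {} \<longrightarrow> (\<exists>v\<in>W. inner_degree (wired_edges L) W v < \<rho> v))" for \<rho> :: "point \<Rightarrow> nat"
  proof (intro all_cong imp_cong refl bex_cong)
    fix W v assume "W \<subseteq> L" "v \<in> W"
    then show "card {w \<in> W. nn v w} < \<rho> v \<longleftrightarrow> inner_degree (wired_edges L) W v < \<rho> v"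
      by (subst inner_degree_wired[OF assms]) blast+
  qed
  show ?thesis
    unfolding recurrent_sandpiles_def recurrent_configs_def no_forbidden_set_def stable_def *
    by (auto simp: edge_degree_wired[OF assms] PiE_def)
qed

lemma addition_op_recurrent:
  assumes "finite L" "\<rho> \<in> recurrent_sandpiles L"
  shows "addition_op L x \<rho> \<in> recurrent_sandpiles L"
  unfolding recurrent_sandpiles_def addition_op_def
  using assms stabilize_works[OF assms(1), of "add_grains L x \<rho>"]
    no_forbidden_set_topplings[OF assms(1) no_forbidden_set_add_grains]
  by (auto simp: recurrent_sandpiles_def)

definition boundary_degree :: "point set \<Rightarrow> point \<Rightarrow> nat" where
  "boundary_degree L v = 6 - card {w \<in> L. nn v w}"

lemma card_nbrs_in_le: "card {w \<in> W. nn v w} \<le> 6"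
  using card_mono[of "{w. nn v w}" "{w \<in> W. nn v w}"] by (auto simp: card_nbrs)

text \<open>Dhar's burning algorithm: one grain along each edge from outside makes every site topple exactly once,
  which returns the configuration. As long as the set \<open>U\<close> of sites that have not yet toppled is
  nonempty, it is not forbidden, and this provides a site that can topple next.\<close>

lemma burning:
  assumes "finite L" "\<rho> \<in> recurrent_sandpiles L"
  shows "addition_op L (boundary_degree L) \<rho> = \<rho>"
proof -
  (* the configuration when exactly the sites outside U have toppled; the subtraction is never truncated,
     because a site burns only with more grains than unburnt neighbours *)
  define conf where "conf = (\<lambda>U. \<lambda>w\<in>L. if w \<in> U then \<rho> w + (6 - card {u \<in> U. nn w u}) else \<rho> w - card {u \<in> U. nn w u})"
  have \<rho>: "no_forbidden_set L \<rho>" "stable L \<rho>" using assms(2) by (auto simp: recurrent_sandpiles_def)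
  have "(toppling L)\<^sup>*\<^sup>* (conf U) (conf {})"
    if "finite U" "U \<subseteq> L" "\<And>w. w \<in> L - U \<Longrightarrow> card {u \<in> U. nn w u} \<le> \<rho> w" for U
    using that
  proof (induction "card U" arbitrary: U)
    case (Suc n)
    have "U \<noteq> {}" using Suc.hyps(2) by auto
    then obtain v where v: "v \<in> U" "card {w \<in> U. nn v w} < \<rho> v"
      using \<rho>(1) Suc.prems(2) unfolding no_forbidden_set_def by blast
    have vL: "v \<in> L" using v Suc.prems(2) by blast
    have cd: "card {u \<in> U. nn w u} = card {u \<in> U - {v}. nn w u} + of_bool (nn w v)" for w
      by (rule card_nbrs_Diff[OF Suc.prems(1) v(1)])
    have "topple L v (conf U) = conf (U - {v})"
    proof
      fix w
      show "topple L v (conf U) w = conf (U - {v}) w"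
        using cd[of w] nn_sym[of v w] v vL Suc.prems(3)[of w] card_nbrs_in_le[of U w]
        by (auto simp: topple_def conf_def)
    qed
    moreover have "conf U v > 6" using v vL by (auto simp: conf_def)
    ultimately have "toppling L (conf U) (conf (U - {v}))" using topplingI[OF vL, of "conf U"] by simp
    moreover have "(toppling L)\<^sup>*\<^sup>* (conf (U - {v})) (conf {})"
    proof (rule Suc.hyps(1))
      show "n = card (U - {v})" using Suc.hyps(2) v(1) by simp
      fix w assume w: "w \<in> L - (U - {v})"
      show "card {u \<in> U - {v}. nn w u} \<le> \<rho> w"
        using cd[of w] v(2) Suc.prems(3)[of w] w by (cases "w = v") auto
    qed (use Suc.prems in auto)
    ultimately show ?case by (rule converse_rtranclp_into_rtranclp)
  qed simp
  from this[of L] have "(toppling L)\<^sup>*\<^sup>* (conf L) (conf {})" using assms(1) by simp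
  moreover have "conf L = add_grains L (boundary_degree L) \<rho>"
    by (auto simp: conf_def add_grains_def boundary_degree_def)
  moreover have "conf {} = \<rho>"
    using \<rho>(1) by (auto simp: conf_def no_forbidden_set_def extensional_def fun_eq_iff)
  ultimately show ?thesis unfolding addition_op_def using \<rho>(2) assms(1) by (simp add: stabilize_eqI)
qed

section \<open>The stationary measure of the sandpile\<close>

lemma addition_op_inj_add:
  assumes "finite L" "inj_on (addition_op L (\<lambda>v. x v + y v)) (recurrent_sandpiles L)"
  shows "inj_on (addition_op L y) (recurrent_sandpiles L)"
  using assms(2) by (auto simp: inj_on_def addition_op_add[OF assms(1), symmetric])

lemma addition_op_inj_sum:
  assumes "finite L" "inj_on (addition_op L x) (recurrent_sandpiles L)" "inj_on (addition_op L y) (recurrent_sandpiles L)"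
  shows "inj_on (addition_op L (\<lambda>v. x v + y v)) (recurrent_sandpiles L)"
proof -
  have "inj_on (addition_op L x \<circ> addition_op L y) (recurrent_sandpiles L)"
    using assms addition_op_recurrent[OF assms(1)]
    by (intro comp_inj_on) (auto intro: inj_on_subset)
  then show ?thesis by (simp add: o_def addition_op_add[OF assms(1)])
qed

definition grain :: "point \<Rightarrow> point \<Rightarrow> nat" where
  "grain v w = of_bool (w = v)"

text \<open>Six additional grains at a site that is not empty make it topple at once, leaving one grain at each neighbour.\<close>

lemma addition_op_six_grains:
  assumes "finite L" "\<rho> \<in> recurrent_sandpiles L" "v \<in> L"
  shows "addition_op L (\<lambda>w. 6 * grain v w) \<rho> = addition_op L (\<lambda>w. of_bool (nn v w)) \<rho>"
proof -
  have "1 \<le> \<rho> v" using assms by (auto simp: recurrent_sandpiles_def no_forbidden_set_def)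
  then have "toppling L (add_grains L (\<lambda>w. 6 * grain v w) \<rho>) (topple L v (add_grains L (\<lambda>w. 6 * grain v w) \<rho>))"
    using assms(3) by (intro topplingI) (auto simp: add_grains_def grain_def)
  moreover have "topple L v (add_grains L (\<lambda>w. 6 * grain v w) \<rho>) = add_grains L (\<lambda>w. of_bool (nn v w)) \<rho>"
    by (auto simp: topple_def add_grains_def grain_def fun_eq_iff restrict_def)
  ultimately show ?thesis
    unfolding addition_op_def using stabilize_toppling[OF assms(1) r_into_rtranclp] by metis
qed

text \<open>By burning, a certain sum of grains containing each site next to the boundary acts as the identity on recurrent
  configurations; a factor of an injective product of commuting maps is injective. If the grain at
  \<open>w\<close> acts injectively, so do six of them, which act like one grain at each neighbour of
  \<open>w\<close>, and hence the grain at any neighbour does. A site not reached in this way cannot be exposed in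
  the set of all such sites, so there is none.\<close>

lemma inj_on_add_grain:
  assumes "finite L" "v \<in> L"
  shows "inj_on (addition_op L (grain v)) (recurrent_sandpiles L)"
proof -
  let ?R = "recurrent_sandpiles L"
  have split: "inj_on (addition_op L (grain v)) ?R"
    if "inj_on (addition_op L x) ?R" "x v \<ge> 1" for x v
  proof -
    have "(\<lambda>w. (x w - grain v w) + grain v w) = x" using that(2) by (auto simp: grain_def fun_eq_iff)
    then show ?thesis using addition_op_inj_add[OF assms(1), of "\<lambda>w. x w - grain v w" "grain v"] that(1) by simp
  qed
  define W where "W = {v \<in> L. \<not> inj_on (addition_op L (grain v)) ?R}"
  have "W = {}"
  proof (rule ccontr)
    assume "W \<noteq> {}"
    moreover have "finite W" using assms(1) by (simp add: W_def)
    ultimately obtain v w where vw: "v \<in> W" "nn v w" "w \<notin> W" using exists_exposed_point[of W] by metis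
    show False
    proof (cases "w \<in> L")
      case False
      have "inj_on (addition_op L (boundary_degree L)) ?R"
        using burning[OF assms(1)] by (auto simp: inj_on_def)
      moreover have "{u \<in> L. nn v u} \<subset> {u. nn v u}" using False vw(2) by blast
      then have "card {u \<in> L. nn v u} < 6"
        using psubset_card_mono[OF finite_nbrs] card_nbrs by metis
      then have "boundary_degree L v \<ge> 1" by (simp add: boundary_degree_def)
      ultimately show False using split vw(1) by (auto simp: W_def)
    next
      case True
      let ?g = "grain w"
      have g: "inj_on (addition_op L ?g) ?R" using True vw(3) by (simp add: W_def)
      note s = addition_op_inj_sum[OF assms(1)]
      have "(\<lambda>u. 6 * grain w u) = (\<lambda>u. ?g u + (?g u + (?g u + (?g u + (?g u + ?g u)))))"
        by (simp add: fun_eq_iff)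
      then have "inj_on (addition_op L (\<lambda>u. 6 * grain w u)) ?R"
        using s[OF g s[OF g s[OF g s[OF g s[OF g g]]]]] by simp
      then have "inj_on (addition_op L (\<lambda>u. of_bool (nn w u))) ?R"
        using addition_op_six_grains[OF assms(1) _ True] by (auto simp: inj_on_def)
      moreover have "of_bool (nn w v) \<ge> (1::nat)" using vw(2) nn_sym by simp
      ultimately show False using split[of "\<lambda>u. of_bool (nn w u)" v] vw(1) by (simp add: W_def)
    qed
  qed
  then show ?thesis using assms(2) unfolding W_def by blast
qed

text \<open>In any set of sites, an exposed point has fewer than six neighbours in the set.\<close>

lemma max_config_recurrent:
  assumes "finite L"
  shows "(\<lambda>v\<in>L. 6) \<in> recurrent_sandpiles L"
  unfolding recurrent_sandpiles_def no_forbidden_set_def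
proof (intro CollectI conjI allI impI)
  fix W assume W: "W \<subseteq> L" "W \<noteq> {}"
  then have "finite W" using assms finite_subset by blast
  then obtain v w where vw: "v \<in> W" "nn v w" "w \<notin> W" using exists_exposed_point[of W] W by metis
  then have "{u \<in> W. nn v u} \<subset> {u. nn v u}" by blast
  then have "card {u \<in> W. nn v u} < 6" using psubset_card_mono[OF finite_nbrs] card_nbrs by metis
  then show "\<exists>v\<in>W. card {w \<in> W. nn v w} < (\<lambda>v\<in>L. 6) v" using vw W by (intro bexI[of _ v]) auto
qed (auto simp: stable_def)

lemma finite_recurrent_sandpiles:
  assumes "finite L"
  shows "finite (recurrent_sandpiles L)"
proof (rule finite_subset)
  show "recurrent_sandpiles L \<subseteq> PiE L (\<lambda>_. {..6})"
    by (auto simp: recurrent_sandpiles_def no_forbidden_set_def stable_def PiE_def Pi_def)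
qed (use assms in \<open>auto intro: finite_PiE\<close>)

lemma add_grain_stable:
  assumes "finite L" "\<rho> \<in> sandpile_configs L" "v \<in> L" "\<rho> v < 6"
  shows "addition_op L (grain v) \<rho> = \<rho>(v := \<rho> v + 1)"
proof -
  have "add_grains L (grain v) \<rho> = \<rho>(v := \<rho> v + 1)"
    using assms by (auto simp: add_grains_def grain_def fun_eq_iff sandpile_configs_def PiE_def extensional_def)
  moreover have "stable L (\<rho>(v := \<rho> v + 1))"
    using assms by (auto simp: stable_def sandpile_configs_def PiE_def Pi_def)
  ultimately show ?thesis
    unfolding addition_op_def using stabilize_eqI[OF assms(1) rtranclp.rtrancl_refl] by simp
qed

text \<open>Grains can be put on sites of height less than six one after the other, without any toppling.\<close>

lemma reach_max_config:
  assumes "finite L" "\<rho> \<in> sandpile_configs L"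
  shows "(\<rho>, \<lambda>v\<in>L. 6) \<in> {(\<rho>, addition_op L (grain v) \<rho>) | \<rho> v. v \<in> L}\<^sup>*"
  using assms(2)
proof (induction "\<Sum>v\<in>L. 6 - \<rho> v" arbitrary: \<rho> rule: less_induct)
  case less
  show ?case
  proof (cases "\<exists>v\<in>L. \<rho> v < 6")
    case False
    then have "\<rho> = (\<lambda>v\<in>L. 6)"
      using less.prems by (fastforce simp: sandpile_configs_def PiE_def Pi_def extensional_def fun_eq_iff)
    then show ?thesis by simp
  next
    case True
    then obtain v where v: "v \<in> L" "\<rho> v < 6" by blast
    let ?\<sigma> = "\<rho>(v := \<rho> v + 1)"
    have "?\<sigma> \<in> sandpile_configs L"
      using less.prems v by (auto simp: sandpile_configs_def PiE_def Pi_def extensional_def)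
    moreover have "(\<Sum>u\<in>L. 6 - ?\<sigma> u) < (\<Sum>u\<in>L. 6 - \<rho> u)"
      using v assms(1) by (intro sum_strict_mono_ex1) auto
    ultimately have "(?\<sigma>, \<lambda>v\<in>L. 6) \<in> {(\<rho>, addition_op L (grain v) \<rho>) | \<rho> v. v \<in> L}\<^sup>*"
      using less.hyps by blast
    moreover have "(\<rho>, ?\<sigma>) \<in> {(\<rho>, addition_op L (grain v) \<rho>) | \<rho> v. v \<in> L}"
      unfolding add_grain_stable[OF assms(1) less.prems v, symmetric] using v(1) by blast
    ultimately show ?thesis by (rule converse_rtrancl_into_rtrancl[rotated])
  qed
qed

theorem sandpile_stationary_uniform:
  assumes "finite L" "L \<noteq> {}"
  shows "sandpile_stationary L = pmf_of_set (recurrent_sandpiles L)"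
proof -
  let ?R = "recurrent_sandpiles L" and ?C = "sandpile_configs L"
  let ?a = "\<lambda>v. addition_op L (grain v)"
  have RC: "?R \<subseteq> ?C"
    by (auto simp: recurrent_sandpiles_def no_forbidden_set_def stable_def sandpile_configs_def PiE_def Pi_def)
  have bij: "bij_betw (?a v) ?R ?R" if "v \<in> L" for v
    unfolding bij_betw_def
    using inj_on_add_grain[OF assms(1) that] addition_op_recurrent[OF assms(1)]
    by (intro conjI endo_inj_surj[OF finite_recurrent_sandpiles[OF assms(1)]]) auto
  have ne: "?R \<noteq> {}" using max_config_recurrent[OF assms(1)] by blast
  have step: "sandpile_step L \<rho> = map_pmf (\<lambda>v. ?a v \<rho>) (pmf_of_set L)" if "\<rho> \<in> ?C" for \<rho>
    unfolding sandpile_step_def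
  proof (rule map_pmf_cong[OF refl])
    fix v assume "v \<in> set_pmf (pmf_of_set L)"
    then have "v \<in> L" using assms by simp
    then have "add_grains L (grain v) \<rho> = \<rho>(v := \<rho> v + 1)"
      using that by (auto simp: add_grains_def grain_def fun_eq_iff sandpile_configs_def PiE_def extensional_def)
    then show "stabilize L (\<rho>(v := \<rho> v + 1)) = ?a v \<rho>" by (simp add: addition_op_def)
  qed
  have bind: "bind_pmf \<mu> (sandpile_step L) = bind_pmf \<mu> (\<lambda>\<rho>. map_pmf (\<lambda>v. ?a v \<rho>) (pmf_of_set L))"
    if "set_pmf \<mu> \<subseteq> ?C" for \<mu>
    by (rule bind_pmf_cong[OF refl]) (use that step in blast)
  have suppR: "set_pmf (pmf_of_set ?R) = ?R"
    using ne finite_recurrent_sandpiles[OF assms(1)] by simp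
  show ?thesis
    unfolding sandpile_stationary_def
  proof (rule the_equality)
    have "bind_pmf (pmf_of_set ?R) (sandpile_step L) = pmf_of_set ?R"
      using stationary_of_commuting_bijections[OF assms finite_recurrent_sandpiles[OF assms(1)] ne bij] RC
      by (simp add: bind suppR)
    then show "set_pmf (pmf_of_set ?R) \<subseteq> ?C \<and> bind_pmf (pmf_of_set ?R) (sandpile_step L) = pmf_of_set ?R"
      using suppR RC by simp
  next
    fix \<mu> assume \<mu>: "set_pmf \<mu> \<subseteq> ?C \<and> bind_pmf \<mu> (sandpile_step L) = \<mu>"
    show "\<mu> = pmf_of_set ?R"
    proof (rule stationary_unique[OF assms finite_recurrent_sandpiles[OF assms(1)] max_config_recurrent[OF assms(1)]
          bij reach_max_config[OF assms(1)] _ RC])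
      show "bind_pmf \<mu> (\<lambda>\<rho>. map_pmf (\<lambda>v. ?a v \<rho>) (pmf_of_set L)) = \<mu>" 
        by (rule trans[OF bind[symmetric]]) (use \<mu> in auto)
    qed (use \<mu> in auto)
  qed
qed

section \<open>Height one and leaves\<close>

text \<open>\<open>B\<close> is a set of pairwise non-adjacent sites, which are going to be removed, or to become leaves.\<close>

locale pendant_set =
  fixes L :: "'a set" and F :: "'a set set" and B :: "'a set"
  assumes finL: "finite L" and F: "simple_edges F" and BL: "B \<subseteq> L"
    and indep: "\<And>d. d \<in> F \<Longrightarrow> \<not> d \<subseteq> B"
    and deg_pos: "\<And>v. v \<in> B \<Longrightarrow> 1 \<le> edge_degree F v"
begin

definition rest :: "'a set set" where
  "rest = {d \<in> F. d \<inter> B = {}}"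

definition links :: "'a \<Rightarrow> nat" where
  "links u = card {d \<in> F. u \<in> d \<and> d \<inter> B \<noteq> {}}"

lemma finF: "finite F" using F by (simp add: simple_edges_def)

lemma finB: "finite B" using finL BL finite_subset by blast

lemma edge_eq: "d \<in> F \<Longrightarrow> u \<in> d \<Longrightarrow> v \<in> d \<Longrightarrow> u \<noteq> v \<Longrightarrow> d = {u, v}"
  using F by (auto simp: simple_edges_def card_2_iff)

text \<open>The edges at \<open>u\<close> either avoid \<open>B\<close> or count as links to \<open>B\<close>.\<close>

lemma edge_degree_rest: "edge_degree F u = edge_degree rest u + links u"
proof -
  have "{d \<in> F. u \<in> d} = {d \<in> rest. u \<in> d} \<union> {d \<in> F. u \<in> d \<and> d \<inter> B \<noteq> {}}"
    by (auto simp: rest_def)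
  moreover have "{d \<in> rest. u \<in> d} \<inter> {d \<in> F. u \<in> d \<and> d \<inter> B \<noteq> {}} = {}"
    by (auto simp: rest_def)
  ultimately show ?thesis
    using finF by (simp add: edge_degree_def links_def card_Un_disjoint rest_def)
qed

text \<open>Adding all adjacent sites of \<open>B\<close> to \<open>W\<close>. At height one such a site cannot prevent the
  enlarged set from being forbidden, while each of its links raises by one the height needed in \<open>W\<close>.\<close>

definition closure_in_B :: "'a set \<Rightarrow> 'a set" where
  "closure_in_B W = W \<union> {v \<in> B. \<exists>d\<in>F. v \<in> d \<and> d \<inter> W \<noteq> {}}"

lemma inner_degree_closure:
  assumes "W \<subseteq> L - B" "u \<in> W"
  shows "inner_degree F (closure_in_B W) u = inner_degree rest W u + links u"
proof -
  have "{d \<in> F. u \<in> d \<and> d \<subseteq> closure_in_B W} = {d \<in> rest. u \<in> d \<and> d \<subseteq> W} \<union> {d \<in> F. u \<in> d \<and> d \<inter> B \<noteq> {}}"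
  proof (intro equalityI subsetI)
    fix d assume "d \<in> {d \<in> F. u \<in> d \<and> d \<subseteq> closure_in_B W}"
    then show "d \<in> {d \<in> rest. u \<in> d \<and> d \<subseteq> W} \<union> {d \<in> F. u \<in> d \<and> d \<inter> B \<noteq> {}}"
      by (auto simp: rest_def closure_in_B_def)
  next
    fix d assume d: "d \<in> {d \<in> rest. u \<in> d \<and> d \<subseteq> W} \<union> {d \<in> F. u \<in> d \<and> d \<inter> B \<noteq> {}}"
    show "d \<in> {d \<in> F. u \<in> d \<and> d \<subseteq> closure_in_B W}"
    proof (cases "d \<in> rest")
      case True
      then show ?thesis using d by (auto simp: rest_def closure_in_B_def)
    next
      case False
      then obtain v where v: "d \<in> F" "u \<in> d" "v \<in> d" "v \<in> B" using d by auto
      then have "d = {u, v}" using edge_eq[of d u v] assms by auto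
      then show ?thesis using v assms by (auto simp: closure_in_B_def)
    qed
  qed
  moreover have "{d \<in> rest. u \<in> d \<and> d \<subseteq> W} \<inter> {d \<in> F. u \<in> d \<and> d \<inter> B \<noteq> {}} = {}"
    by (auto simp: rest_def)
  ultimately show ?thesis
    using finF by (simp add: inner_degree_def links_def card_Un_disjoint rest_def)
qed

lemma inner_degree_le_rest:
  assumes "u \<notin> B"
  shows "inner_degree F W u \<le> inner_degree rest (W - B) u + links u"
proof -
  have "inner_degree F W u \<le> card ({d \<in> rest. u \<in> d \<and> d \<subseteq> W - B} \<union> {d \<in> F. u \<in> d \<and> d \<inter> B \<noteq> {}})"
    unfolding inner_degree_def using finF by (intro card_mono) (auto simp: rest_def)
  also have "\<dots> \<le> inner_degree rest (W - B) u + links u"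
    unfolding inner_degree_def links_def by (rule card_Un_le)
  finally show ?thesis .
qed

text \<open>Apply the condition to the closure of \<open>W\<close>. The site that it provides does not lie in
  \<open>B\<close>, because a site of \<open>B\<close> in the closure has a neighbour there and height only one.\<close>

lemma recurrent_restrict:
  assumes \<rho>: "\<rho> \<in> recurrent_configs L F" and one: "\<And>v. v \<in> B \<Longrightarrow> \<rho> v = 1"
    and W: "W \<subseteq> L - B" "W \<noteq> {}"
  shows "\<exists>u\<in>W. inner_degree rest W u + links u < \<rho> u"
proof -
  have "closure_in_B W \<subseteq> L" "closure_in_B W \<noteq> {}" using W BL by (auto simp: closure_in_B_def)
  from recurrent_configsD(4)[OF \<rho> this]
  obtain u where u: "u \<in> closure_in_B W" "inner_degree F (closure_in_B W) u < \<rho> u" by blast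
  have "u \<in> W"
  proof (rule ccontr)
    assume "u \<notin> W"
    then obtain d where d: "u \<in> B" "d \<in> F" "u \<in> d" "d \<inter> W \<noteq> {}"
      using u(1) by (auto simp: closure_in_B_def)
    then obtain w where w: "w \<in> d" "w \<in> W" by blast
    have "d = {u, w}" using edge_eq[OF d(2,3) w(1)] \<open>u \<notin> W\<close> w(2) by blast
    then have "d \<subseteq> closure_in_B W" using u(1) w(2) by (auto simp: closure_in_B_def)
    then have "d \<in> {d \<in> F. u \<in> d \<and> d \<subseteq> closure_in_B W}" using d by blast
    then have "inner_degree F (closure_in_B W) u \<ge> 1"
      unfolding inner_degree_def using finF card_gt_0_iff[of "{d \<in> F. u \<in> d \<and> d \<subseteq> closure_in_B W}"] by fastforce
    then show False using u(2) one[OF d(1)] by simp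
  qed
  then show ?thesis using u inner_degree_closure[OF W(1)] by (intro bexI[of _ u]) auto
qed

lemma recurrent_extend:
  assumes \<sigma>: "\<sigma> \<in> recurrent_configs (L - B) rest"
  shows "(\<lambda>u\<in>L. if u \<in> B then 1 else \<sigma> u + links u) \<in> recurrent_configs L F" (is "?\<rho> \<in> _")
  unfolding recurrent_configs_def
proof (intro CollectI conjI ballI allI impI)
  fix W assume W: "W \<subseteq> L" "W \<noteq> {}"
  show "\<exists>v\<in>W. inner_degree F W v < ?\<rho> v"
  proof (cases "W \<subseteq> B")
    case True
    then have no_edge: "{d \<in> F. v \<in> d \<and> d \<subseteq> W} = {}" for v using indep by blast
    have none: "inner_degree F W v = 0" for v unfolding inner_degree_def no_edge by simp
    obtain v where "v \<in> W" using W by blast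
    then show ?thesis using True W by (intro bexI[of _ v]) (auto simp: none)
  next
    case False
    then have "W - B \<noteq> {}" "W - B \<subseteq> L - B" using W by auto
    from recurrent_configsD(4)[OF \<sigma> this(2,1)]
    obtain u where u: "u \<in> W - B" "inner_degree rest (W - B) u < \<sigma> u" by blast
    then have "inner_degree F W u < ?\<rho> u" using inner_degree_le_rest[of u W] W by auto
    then show ?thesis using u by blast
  qed
next
  fix v assume v: "v \<in> L"
  show "1 \<le> ?\<rho> v" using recurrent_configsD(2)[OF \<sigma>, of v] v by auto
  show "?\<rho> v \<le> edge_degree F v"
    using recurrent_configsD(3)[OF \<sigma>, of v] v deg_pos[of v] edge_degree_rest[of v] by auto
qed auto

text \<open>Removing \<open>B\<close> lowers both the height and the degree of a site by its number of links to
  \<open>B\<close>.\<close>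

lemma card_recurrent_all_one:
  "card {\<rho> \<in> recurrent_configs L F. \<forall>v\<in>B. \<rho> v = 1} = card (recurrent_configs (L - B) rest)"
proof (rule bij_betw_same_card[of "\<lambda>\<rho>. \<lambda>u\<in>L - B. \<rho> u - links u"], rule bij_betwI)
  let ?A = "{\<rho> \<in> recurrent_configs L F. \<forall>v\<in>B. \<rho> v = 1}"
  let ?g = "\<lambda>\<sigma>. \<lambda>u\<in>L. if u \<in> B then 1 else \<sigma> u + links u"
  have gt: "links u < \<rho> u" if "\<rho> \<in> ?A" "u \<in> L - B" for \<rho> u
    using recurrent_restrict[of \<rho> "{u}"] that by auto
  show "(\<lambda>\<rho>. \<lambda>u\<in>L - B. \<rho> u - links u) \<in> ?A \<rightarrow> recurrent_configs (L - B) rest"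
  proof
    fix \<rho> assume \<rho>: "\<rho> \<in> ?A"
    show "(\<lambda>u\<in>L - B. \<rho> u - links u) \<in> recurrent_configs (L - B) rest"
      unfolding recurrent_configs_def
    proof (intro CollectI conjI ballI allI impI)
      fix v assume v: "v \<in> L - B"
      show "1 \<le> (\<lambda>u\<in>L - B. \<rho> u - links u) v" using gt[OF \<rho> v] v by simp
      have "\<rho> v \<le> edge_degree F v" using \<rho> v recurrent_configsD(3) by auto
      then show "(\<lambda>u\<in>L - B. \<rho> u - links u) v \<le> edge_degree rest v"
        using v edge_degree_rest[of v] by simp
    next
      fix W assume W: "W \<subseteq> L - B" "W \<noteq> {}"
      have "\<exists>u\<in>W. inner_degree rest W u + links u < \<rho> u"
        using recurrent_restrict[OF _ _ W] \<rho> by blast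
      then obtain u where u: "u \<in> W" "inner_degree rest W u + links u < \<rho> u" by blast
      moreover have "u \<in> L - B" using u(1) W by blast
      ultimately show "\<exists>v\<in>W. inner_degree rest W v < (\<lambda>u\<in>L - B. \<rho> u - links u) v"
        by (intro bexI[of _ u]) auto
    qed auto
  qed
  show "?g \<in> recurrent_configs (L - B) rest \<rightarrow> ?A"
    using recurrent_extend BL by auto
  show "?g (\<lambda>u\<in>L - B. \<rho> u - links u) = \<rho>" if "\<rho> \<in> ?A" for \<rho>
  proof
    fix u
    have "\<rho> \<in> extensional L" using that by (auto simp: recurrent_configs_def PiE_def)
    then show "?g (\<lambda>u\<in>L - B. \<rho> u - links u) u = \<rho> u"
      using gt[OF that, of u] that by (auto simp: extensional_def)
  qed
  show "(\<lambda>u\<in>L - B. ?g \<sigma> u - links u) = \<sigma>" if "\<sigma> \<in> recurrent_configs (L - B) rest" for \<sigma>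
  proof
    fix u
    have "\<sigma> \<in> extensional (L - B)" using that by (auto simp: recurrent_configs_def PiE_def)
    then show "(\<lambda>u\<in>L - B. ?g \<sigma> u - links u) u = \<sigma> u" by (auto simp: extensional_def)
  qed
qed

definition attach :: "'a set set \<Rightarrow> ('a \<Rightarrow> 'a set) \<Rightarrow> 'a set set" where
  "attach T g = T \<union> g ` B"

definition pendant_choices :: "('a \<Rightarrow> 'a set) set" where
  "pendant_choices = PiE B (\<lambda>v. {d \<in> F. v \<in> d})"

lemma pendant_unique:
  assumes "g \<in> pendant_choices" "u \<in> B" "v \<in> B" "v \<in> g u"
  shows "u = v"
proof (rule ccontr)
  assume "u \<noteq> v"
  moreover have "g u \<in> F" "u \<in> g u" using assms by (auto simp: pendant_choices_def)
  ultimately have "g u = {u, v}" using edge_eq[of "g u" u v] assms(4) by blast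
  then show False using indep[OF \<open>g u \<in> F\<close>] assms by auto
qed

lemma pendant_other_end:
  assumes "g \<in> pendant_choices" "v \<in> B"
  obtains w where "g v = {v, w}" "w \<notin> B" "w \<noteq> v"
proof -
  have gv: "g v \<in> F" "v \<in> g v" using assms by (auto simp: pendant_choices_def)
  then have "card (g v) = 2" using F by (simp add: simple_edges_def)
  then obtain x y where "g v = {x, y}" "x \<noteq> y" by (auto simp: card_2_iff)
  then obtain w where w: "g v = {v, w}" "w \<noteq> v" using gv(2) by (metis empty_iff insertE insert_commute)
  moreover have "w \<notin> B" using indep[OF gv(1)] w assms by auto
  ultimately show ?thesis using that by blast
qed

text \<open>To find an edge of \<open>T\<close> leaving a set of sites outside \<open>B\<close>, enlarge the set by the
  leaves hanging on it; then no leaf edge leaves it. Conversely, a set inside \<open>B\<close> is left by its leaf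
  edges, which end outside \<open>B\<close>.\<close>

lemma cut_connected_attach:
  assumes "T \<subseteq> rest" "g \<in> pendant_choices"
  shows "cut_connected L (attach T g) \<longleftrightarrow> cut_connected (L - B) T"
proof
  assume L: "cut_connected L (attach T g)"
  show "cut_connected (L - B) T"
    unfolding cut_connected_def
  proof (intro allI impI)
    fix W assume W: "W \<subseteq> L - B" "W \<noteq> {}"
    define W' where "W' = W \<union> {v \<in> B. g v \<inter> W \<noteq> {}}"
    have "W' \<subseteq> L" "W' \<noteq> {}" using W BL by (auto simp: W'_def)
    from L[unfolded cut_connected_def, rule_format, OF this]
    obtain d where d: "d \<in> attach T g" "d \<inter> W' \<noteq> {}" "\<not> d \<subseteq> W'" by blast
    have "d \<in> T"
    proof (rule ccontr)
      assume "d \<notin> T"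
      then obtain v where v: "v \<in> B" "d = g v" using d(1) by (auto simp: attach_def)
      obtain w where w: "g v = {v, w}" "w \<notin> B" "w \<noteq> v" by (rule pendant_other_end[OF assms(2) v(1)])
      have "v \<notin> W" using v(1) W by blast
      have "v \<in> W' \<longleftrightarrow> w \<in> W" using v(1) w \<open>v \<notin> W\<close> by (auto simp: W'_def)
      moreover have "w \<in> W' \<longleftrightarrow> w \<in> W" using w by (auto simp: W'_def)
      ultimately show False using d(2,3) unfolding v(2) w(1) by auto
    qed
    moreover have "d \<inter> B = {}" using \<open>d \<in> T\<close> assms(1) by (auto simp: rest_def)
    then have "d \<inter> W \<noteq> {}" "\<not> d \<subseteq> W" using d(2,3) by (auto simp: W'_def)
    ultimately show "\<exists>d\<in>T. d \<inter> W \<noteq> {} \<and> \<not> d \<subseteq> W" by blast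
  qed
next
  assume R: "cut_connected (L - B) T"
  show "cut_connected L (attach T g)"
    unfolding cut_connected_def
  proof (intro allI impI)
    fix W assume W: "W \<subseteq> L" "W \<noteq> {}"
    show "\<exists>d\<in>attach T g. d \<inter> W \<noteq> {} \<and> \<not> d \<subseteq> W"
    proof (cases "W \<subseteq> B")
      case True
      obtain v where v: "v \<in> W" using W by blast
      then have "v \<in> B" using True by blast
      then obtain w where "g v = {v, w}" "w \<notin> B" "w \<noteq> v" by (rule pendant_other_end[OF assms(2)])
      then show ?thesis using v True \<open>v \<in> B\<close> by (intro bexI[of _ "g v"]) (auto simp: attach_def)
    next
      case False
      then have "W - B \<subseteq> L - B" "W - B \<noteq> {}" using W by auto
      from R[unfolded cut_connected_def, rule_format, OF this]
      obtain d where d: "d \<in> T" "d \<inter> (W - B) \<noteq> {}" "\<not> d \<subseteq> W - B" by blast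
      moreover have "d \<inter> B = {}" using d(1) assms(1) by (auto simp: rest_def)
      ultimately show ?thesis by (intro bexI[of _ d]) (auto simp: attach_def)
    qed
  qed
qed

lemma edges_at_attach:
  assumes "T \<subseteq> rest" "g \<in> pendant_choices" "v \<in> B"
  shows "{d \<in> attach T g. v \<in> d} = {g v}"
proof (intro equalityI subsetI)
  fix d assume "d \<in> {d \<in> attach T g. v \<in> d}"
  then have d: "d \<in> T \<or> d \<in> g ` B" "v \<in> d" by (auto simp: attach_def)
  moreover have "d \<notin> T" using d(2) assms(1,3) by (auto simp: rest_def)
  ultimately show "d \<in> {g v}" using pendant_unique[OF assms(2) _ assms(3)] by auto
next
  fix d assume "d \<in> {g v}"
  then show "d \<in> {d \<in> attach T g. v \<in> d}" using assms by (auto simp: attach_def pendant_choices_def)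
qed

lemma card_attach:
  assumes "T \<subseteq> rest" "g \<in> pendant_choices"
  shows "card (attach T g) = card T + card B"
proof -
  have "T \<inter> g ` B = {}" using assms by (auto simp: rest_def pendant_choices_def)
  moreover have "inj_on g B"
  proof (rule inj_onI)
    fix u v assume uv: "u \<in> B" "v \<in> B" "g u = g v"
    then have "v \<in> g u" using assms(2) by (auto simp: pendant_choices_def)
    then show "u = v" by (rule pendant_unique[OF assms(2) uv(1,2)])
  qed
  moreover have "finite T" using assms(1) finF by (auto simp: rest_def intro: finite_subset)
  ultimately show ?thesis using finB by (simp add: attach_def card_Un_disjoint card_image)
qed

lemma attach_Int_rest:
  assumes "T \<subseteq> rest" "g \<in> pendant_choices"
  shows "attach T g \<inter> rest = T"
  using assms by (auto simp: attach_def rest_def pendant_choices_def)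

text \<open>A tree in which all sites of \<open>B\<close> are leaves consists of a tree on the remaining sites and a free
  choice of an edge for every site of \<open>B\<close>.\<close>

lemma card_rooted_trees_all_leaves:
  "card {T \<in> rooted_trees L F. \<forall>v\<in>B. edge_degree T v = 1} =
    (\<Prod>v\<in>B. edge_degree F v) * card (rooted_trees (L - B) rest)"
proof -
  let ?A = "{T \<in> rooted_trees L F. \<forall>v\<in>B. edge_degree T v = 1}"
  have cL: "card L = card (L - B) + card B"
    using card_Diff_subset[OF finB BL] card_mono[OF finL BL] by simp
  have "bij_betw (\<lambda>(T, g). attach T g) (rooted_trees (L - B) rest \<times> pendant_choices) ?A"
    unfolding bij_betw_def
  proof
    show "inj_on (\<lambda>(T, g). attach T g) (rooted_trees (L - B) rest \<times> pendant_choices)"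
    proof (rule inj_onI, clarify)
      fix T g S h
      assume 1: "T \<in> rooted_trees (L - B) rest" "g \<in> pendant_choices" "S \<in> rooted_trees (L - B) rest"
        "h \<in> pendant_choices" and eq: "attach T g = attach S h"
      then have "T \<subseteq> rest" "S \<subseteq> rest" by (auto simp: rooted_trees_def)
      note TS = this
      have "T = S" using attach_Int_rest[OF TS(1) 1(2)] attach_Int_rest[OF TS(2) 1(4)] eq by simp
      moreover have "g v = h v" if "v \<in> B" for v
        using edges_at_attach[OF TS(1) 1(2) that] edges_at_attach[OF TS(2) 1(4) that] eq by simp
      then have "g = h" using 1(2,4) unfolding pendant_choices_def by (intro PiE_ext) auto
      ultimately show "T = S \<and> g = h" by blast
    qed
    show "(\<lambda>(T, g). attach T g) ` (rooted_trees (L - B) rest \<times> pendant_choices) = ?A"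
    proof (intro equalityI subsetI)
      fix X assume "X \<in> (\<lambda>(T, g). attach T g) ` (rooted_trees (L - B) rest \<times> pendant_choices)"
      then obtain T g where X: "X = attach T g" "T \<in> rooted_trees (L - B) rest" "g \<in> pendant_choices" by auto
      then have T: "T \<subseteq> rest" by (auto simp: rooted_trees_def)
      have "X \<subseteq> F" using T X by (auto simp: attach_def rest_def pendant_choices_def)
      moreover have "card X = card L" using card_attach[OF T X(3)] X cL by (simp add: rooted_trees_def)
      moreover have "cut_connected L X" using cut_connected_attach[OF T X(3)] X by (simp add: rooted_trees_def)
      moreover have "edge_degree X v = 1" if "v \<in> B" for v
        using edges_at_attach[OF T X(3) that] X(1) by (simp add: edge_degree_def)
      ultimately show "X \<in> ?A" by (simp add: rooted_trees_def)
    next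
      fix X assume X: "X \<in> ?A"
      have "\<exists>d. {d \<in> X. v \<in> d} = {d}" if "v \<in> B" for v
        using X that by (auto simp: edge_degree_def card_1_singleton_iff)
      then obtain g0 where g0: "\<And>v. v \<in> B \<Longrightarrow> {d \<in> X. v \<in> d} = {g0 v}" by metis
      define g where "g = restrict g0 B"
      have XF: "X \<subseteq> F" using X by (auto simp: rooted_trees_def)
      have gX: "g v \<in> X" "v \<in> g v" if "v \<in> B" for v using g0[OF that] that by (auto simp: g_def)
      have g: "g \<in> pendant_choices"
        using gX XF by (auto simp: pendant_choices_def g_def)
      define T where "T = X \<inter> rest"
      have T: "T \<subseteq> rest" by (simp add: T_def)
      have XT: "X = attach T g"
      proof (intro equalityI subsetI)
        fix d assume d: "d \<in> X"
        show "d \<in> attach T g"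
        proof (cases "d \<inter> B = {}")
          case True
          then show ?thesis using d XF by (auto simp: attach_def T_def rest_def)
        next
          case False
          then obtain v where v: "v \<in> d" "v \<in> B" by blast
          then have "d \<in> {g0 v}" using g0[OF v(2)] d by blast
          then show ?thesis using v by (auto simp: attach_def g_def)
        qed
      qed (use gX in \<open>auto simp: attach_def T_def\<close>)
      have "card T = card (L - B)" using card_attach[OF T g] XT X cL by (simp add: rooted_trees_def)
      moreover have "cut_connected (L - B) T" using cut_connected_attach[OF T g] XT X by (simp add: rooted_trees_def)
      ultimately have "T \<in> rooted_trees (L - B) rest" using T by (simp add: rooted_trees_def)
      then show "X \<in> (\<lambda>(T, g). attach T g) ` (rooted_trees (L - B) rest \<times> pendant_choices)"
        using XT g by (intro image_eqI[of _ _ "(T, g)"]) auto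
    qed
  qed
  then have "card ?A = card (rooted_trees (L - B) rest \<times> pendant_choices)"
    by (rule bij_betw_same_card[symmetric])
  moreover have "card pendant_choices = (\<Prod>v\<in>B. edge_degree F v)"
    using finB by (simp add: pendant_choices_def card_PiE edge_degree_def)
  ultimately show ?thesis by (simp add: card_cartesian_product)
qed

end

theorem card_recurrent_all_one_eq_leaves:
  assumes "pendant_set L F B"
  shows "(\<Prod>v\<in>B. edge_degree F v) * card {\<rho> \<in> recurrent_configs L F. \<forall>v\<in>B. \<rho> v = 1} =
    card {T \<in> rooted_trees L F. \<forall>v\<in>B. edge_degree T v = 1}"
proof -
  interpret pendant_set L F B by fact
  have "simple_edges rest" using F by (rule simple_edges_subset) (auto simp: rest_def)
  then have "card (recurrent_configs (L - B) rest) = card (rooted_trees (L - B) rest)"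
    using finL by (intro card_recurrent_configs) auto
  then show ?thesis unfolding card_recurrent_all_one card_rooted_trees_all_leaves by simp
qed

section \<open>Even elements of a Grassmann algebra\<close>

definition even_elem :: "'g grassmann \<Rightarrow> bool" where
  "even_elem f \<longleftrightarrow> (\<forall>S. gcoeff f S \<noteq> 0 \<longrightarrow> even (card S))"

lemma gcoeff_simps [simp]:
  "gcoeff 0 S = 0" "gcoeff (f + g) S = gcoeff f S + gcoeff g S"
  "gcoeff (f - g) S = gcoeff f S - gcoeff g S" "gcoeff (- f) S = - gcoeff f S"
  "gcoeff (c *\<^sub>R f) S = c * gcoeff f S" "gcoeff (gvar x) S = of_bool (S = {x})"
  by (simp_all add: zero_grassmann.rep_eq plus_grassmann.rep_eq minus_grassmann.rep_eq
      uminus_grassmann.rep_eq scaleR_grassmann.rep_eq gvar.rep_eq)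

lemma gcoeff_one: "gcoeff 1 S = of_bool (S = {})"
  by (simp add: one_grassmann.rep_eq)

text \<open>Every pair is inverted in exactly one of the two orders, and the number of pairs is even.\<close>

lemma shuffle_sign_swap:
  assumes "finite A" "finite B" "A \<inter> B = {}" "even (card A)"
  shows "shuffle_sign A B = shuffle_sign B A"
proof -
  let ?X = "{(a, b). a \<in> A \<and> b \<in> B \<and> b < a}" and ?Y = "{(b, a). b \<in> B \<and> a \<in> A \<and> a < b}"
  have fin: "finite ?X" "finite ?Y"
    by (rule finite_subset[of _ "A \<times> B"], use assms in auto) (rule finite_subset[of _ "B \<times> A"], use assms in auto)
  have "card ?Y = card (prod.swap ` ?Y)" by (simp add: card_image)
  moreover have "A \<times> B = ?X \<union> prod.swap ` ?Y" using assms(3) by force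
  moreover have "?X \<inter> prod.swap ` ?Y = {}" by auto
  ultimately have "card (A \<times> B) = card ?X + card ?Y" using fin by (simp add: card_Un_disjoint)
  then have "even (card ?X + card ?Y)" using assms(4) by (metis card_cartesian_product dvd_mult2)
  then have "even (card ?X) \<longleftrightarrow> even (card ?Y)" by simp
  then show ?thesis unfolding shuffle_sign_def minus_one_power_iff by presburger
qed

lemma even_elem_commute:
  fixes f g :: "'g::linorder grassmann"
  assumes "even_elem f"
  shows "f * g = g * f"
proof (rule grassmann_eqI)
  fix S :: "'g set" assume S: "finite S"
  have "gcoeff (f * g) S = (\<Sum>A\<in>Pow S. shuffle_sign (S - A) A * gcoeff g (S - A) * gcoeff f A)"
    unfolding gcoeff_times[OF S]
  proof (rule sum.cong[OF refl])
    fix A assume A: "A \<in> Pow S"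
    have fin: "finite A" using A S finite_subset by auto
    show "shuffle_sign A (S - A) * gcoeff f A * gcoeff g (S - A) =
        shuffle_sign (S - A) A * gcoeff g (S - A) * gcoeff f A"
    proof (cases "gcoeff f A = 0")
      case False
      then have "even (card A)" using assms by (auto simp: even_elem_def)
      then show ?thesis using shuffle_sign_swap[of A "S - A"] fin S by simp
    qed simp
  qed
  also have "\<dots> = (\<Sum>A\<in>Pow S. shuffle_sign A (S - A) * gcoeff g A * gcoeff f (S - A))"
    by (rule sum.reindex_bij_witness[of _ "\<lambda>A. S - A" "\<lambda>A. S - A"]) (auto simp: double_diff)
  also have "\<dots> = gcoeff (g * f) S" by (simp add: gcoeff_times[OF S])
  finally show "gcoeff (f * g) S = gcoeff (g * f) S" .
qed

lemma even_elem_mult: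
  fixes f g :: "'g::linorder grassmann"
  assumes "even_elem f" "even_elem g"
  shows "even_elem (f * g)"
  unfolding even_elem_def
proof (intro allI impI)
  fix S assume S: "gcoeff (f * g) S \<noteq> 0"
  then have fin: "finite S" by (metis gcoeff_infinite)
  obtain A where A: "A \<subseteq> S" "gcoeff f A \<noteq> 0" "gcoeff g (S - A) \<noteq> 0"
    using S unfolding gcoeff_times[OF fin] by (force elim: sum.not_neutral_contains_not_neutral)
  then have "even (card A)" "even (card (S - A))" using assms by (auto simp: even_elem_def)
  moreover have "card S = card A + card (S - A)"
    using A(1) fin by (metis card_Diff_subset card_mono finite_subset le_add_diff_inverse)
  ultimately show "even (card S)" by simp
qed

text \<open>The even elements form a commutative ring, in which all products and exponentials of this theory can be computed
  with the ordinary rules for finite sums and products.\<close>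

typedef (overloaded) ('g::linorder) even_grassmann = "{f :: 'g grassmann. even_elem f}"
  morphisms of_even to_even
  by (rule exI[of _ 0]) (simp add: even_elem_def)

setup_lifting type_definition_even_grassmann

instantiation even_grassmann :: (linorder) "{comm_ring_1, real_algebra_1}"
begin

lift_definition zero_even_grassmann :: "'a even_grassmann" is 0 by (simp add: even_elem_def)
lift_definition one_even_grassmann :: "'a even_grassmann" is 1 by (simp add: even_elem_def gcoeff_one)
lift_definition plus_even_grassmann :: "'a even_grassmann \<Rightarrow> 'a even_grassmann \<Rightarrow> 'a even_grassmann"
  is "(+)" unfolding even_elem_def gcoeff_simps by (metis add.right_neutral)
lift_definition minus_even_grassmann :: "'a even_grassmann \<Rightarrow> 'a even_grassmann \<Rightarrow> 'a even_grassmann"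
  is "(-)" unfolding even_elem_def gcoeff_simps by (metis diff_zero)
lift_definition uminus_even_grassmann :: "'a even_grassmann \<Rightarrow> 'a even_grassmann"
  is uminus by (simp add: even_elem_def)
lift_definition times_even_grassmann :: "'a even_grassmann \<Rightarrow> 'a even_grassmann \<Rightarrow> 'a even_grassmann"
  is "(*)" by (rule even_elem_mult)
lift_definition scaleR_even_grassmann :: "real \<Rightarrow> 'a even_grassmann \<Rightarrow> 'a even_grassmann"
  is "(*\<^sub>R)" by (simp add: even_elem_def)

instance
proof
  fix a b c :: "'a even_grassmann" and r s :: real
  show "a * b = b * a" by transfer (rule even_elem_commute)
qed (transfer; simp add: algebra_simps; fail)+

end

lemma of_even_simps [simp]:
  "of_even 0 = 0" "of_even 1 = 1" "of_even (a + b) = of_even a + of_even b"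
  "of_even (a - b) = of_even a - of_even b" "of_even (- a) = - of_even a"
  "of_even (a * b) = of_even a * of_even b" "of_even (r *\<^sub>R a) = r *\<^sub>R of_even a"
  by (transfer; simp)+

lemma of_even_sum: "of_even (sum f I) = (\<Sum>i\<in>I. of_even (f i))"
  by (induction I rule: infinite_finite_induct) auto

lemma of_even_power: "of_even (a ^ k) = of_even a ^ k"
  by (induction k) auto

lemma of_even_eq_0_iff: "of_even a = 0 \<longleftrightarrow> a = 0"
  using of_even_inject[of a 0] by simp

lemma comm_prod_of_even: "comm_prod (\<lambda>i. of_even (w i)) I = of_even (\<Prod>i\<in>I. w i)"
proof -
  have comm: "of_even (w i) * of_even (w j) = of_even (w j) * of_even (w i)" for i j
    unfolding of_even_simps(6)[symmetric] by (simp only: mult.commute)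
  interpret comp_fun_commute "\<lambda>i. (*) (of_even (w i))"
    by standard (simp add: fun_eq_iff comm flip: mult.assoc)
  show ?thesis unfolding comm_prod_def
  proof (induction I rule: infinite_finite_induct)
    case (insert i I)
    then show ?case by (simp only: fold_insert prod.insert of_even_simps not_False_eq_True)
  qed simp_all
qed

section \<open>Exponentials of nilpotent elements\<close>

text \<open>The defining series of \<^const>\<open>gexp\<close>, but in the commutative ring of even elements.\<close>

definition nexp :: "'a::{real_algebra_1, comm_ring_1} \<Rightarrow> 'a" where
  "nexp a = (\<Sum>k | a ^ k \<noteq> 0. (1 / fact k) *\<^sub>R a ^ k)"

lemma nexp_eq:
  assumes "a ^ N = 0"
  shows "nexp a = (\<Sum>k<N. (1 / fact k) *\<^sub>R a ^ k)"
proof -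
  have "a ^ k = 0" if "\<not> k < N" for k
    using assms that by (metis le_add_diff_inverse mult_zero_left not_less power_add)
  then have "{k. a ^ k \<noteq> 0} \<subseteq> {..<N}" by auto
  then show ?thesis unfolding nexp_def by (intro sum.mono_neutral_left) auto
qed

lemma gexp_of_even: "gexp (of_even a) = of_even (nexp a)"
  by (simp add: gexp_def nexp_def of_even_sum of_even_power[symmetric] of_even_eq_0_iff)

lemma power_Suc_add_square_zero:
  fixes a x :: "'a::comm_ring_1"
  assumes "x * x = 0"
  shows "(a + x) ^ Suc k = a ^ Suc k + of_nat (Suc k) * a ^ k * x"
proof (induction k)
  case (Suc k)
  have "(a + x) ^ Suc (Suc k) = (a + x) * (a ^ Suc k + of_nat (Suc k) * a ^ k * x)"
    using Suc by simp
  also have "\<dots> = a ^ Suc (Suc k) + of_nat (Suc (Suc k)) * a ^ Suc k * x + of_nat (Suc k) * a ^ k * (x * x)"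
    by (simp add: algebra_simps)
  finally show ?case by (simp add: assms)
qed simp

text \<open>The binomial expansion of \<open>(a + x) ^ k\<close> stops after the term linear in \<open>x\<close>.\<close>

lemma nexp_add_square_zero:
  fixes a x :: "'a::{real_algebra_1, comm_ring_1}"
  assumes "a ^ N = 0" "x * x = 0"
  shows "(a + x) ^ Suc N = 0" "nexp (a + x) = nexp a * (1 + x)"
proof -
  show z: "(a + x) ^ Suc N = 0"
    unfolding power_Suc_add_square_zero[OF assms(2)] using assms(1) by simp
  have term_eq: "(1 / fact (Suc k)) *\<^sub>R (a + x) ^ Suc k = (1 / fact (Suc k)) *\<^sub>R a ^ Suc k + (1 / fact k) *\<^sub>R a ^ k * x" for k
  proof -
    have "(1 / fact (Suc k)) *\<^sub>R (of_nat (Suc k) * a ^ k * x) = ((1 / fact (Suc k)) * real (Suc k)) *\<^sub>R (a ^ k * x)"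
      by (simp only: mult.assoc scaleR_conv_of_real of_real_mult of_real_of_nat_eq)
    also have "(1 / fact (Suc k)) * real (Suc k) = 1 / fact k" by (simp add: fact_Suc del: of_nat_Suc)
    finally show ?thesis
      unfolding power_Suc_add_square_zero[OF assms(2)] by (simp add: scaleR_add_right)
  qed
  have "nexp (a + x) = (\<Sum>k<Suc N. (1 / fact k) *\<^sub>R (a + x) ^ k)" by (rule nexp_eq[OF z])
  also have "\<dots> = 1 + (\<Sum>k<N. (1 / fact (Suc k)) *\<^sub>R (a + x) ^ Suc k)"
    by (subst sum.lessThan_Suc_shift) (simp del: power_Suc fact_Suc)
  also have "\<dots> = (1 + (\<Sum>k<N. (1 / fact (Suc k)) *\<^sub>R a ^ Suc k)) + (\<Sum>k<N. (1 / fact k) *\<^sub>R a ^ k) * x"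
    by (simp only: term_eq sum.distrib sum_distrib_right add.assoc)
  also have "1 + (\<Sum>k<N. (1 / fact (Suc k)) *\<^sub>R a ^ Suc k) = (\<Sum>k<Suc N. (1 / fact k) *\<^sub>R a ^ k)"
    by (subst sum.lessThan_Suc_shift) (simp del: power_Suc fact_Suc)
  also have "\<dots> = nexp a"
    using nexp_eq[of a "Suc N"] assms(1) by simp
  also have "(\<Sum>k<N. (1 / fact k) *\<^sub>R a ^ k) = nexp a" by (rule nexp_eq[OF assms(1), symmetric])
  finally show "nexp (a + x) = nexp a * (1 + x)" by (simp add: algebra_simps)
qed

lemma nexp_add_sum:
  fixes a :: "'a::{real_algebra_1, comm_ring_1}"
  assumes "finite I" "a ^ N = 0" "\<And>i. i \<in> I \<Longrightarrow> x i * x i = 0"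
  shows "(a + sum x I) ^ (N + card I) = 0 \<and> nexp (a + sum x I) = nexp a * (\<Prod>i\<in>I. 1 + x i)"
  using assms(1,3)
proof (induction I rule: finite_induct)
  case (insert i I)
  have IH: "(a + sum x I) ^ (N + card I) = 0" "nexp (a + sum x I) = nexp a * (\<Prod>i\<in>I. 1 + x i)"
    using insert by auto
  have eq: "a + sum x (insert i I) = (a + sum x I) + x i" using insert.hyps by simp
  have "x i * x i = 0" using insert.prems by simp
  from nexp_add_square_zero[OF IH(1) this]
  show ?case using insert.hyps IH(2) unfolding eq by (simp add: mult_ac)
qed (use assms in simp)

lemma nexp_sum:
  fixes x :: "'i \<Rightarrow> 'a::{real_algebra_1, comm_ring_1}"
  assumes "finite I" "\<And>i. i \<in> I \<Longrightarrow> x i * x i = 0"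
  shows "sum x I ^ Suc (card I) = 0" "nexp (sum x I) = (\<Prod>i\<in>I. 1 + x i)"
proof -
  have "nexp (0::'a) = 1" using nexp_eq[of "0::'a" 1] by simp
  then show "sum x I ^ Suc (card I) = 0" "nexp (sum x I) = (\<Prod>i\<in>I. 1 + x i)"
    using nexp_add_sum[of I "0::'a" 1 x] assms by auto
qed

section \<open>Berezin integration\<close>

lemma gvar_mult:
  fixes x y :: "'g::linorder"
  shows "gcoeff (gvar x * gvar y) S = (if x \<noteq> y \<and> S = {x, y} then if y < x then -1 else 1 else 0)"
proof (cases "finite S")
  case S: True
  have "gcoeff (gvar x * gvar y) S = (\<Sum>A\<in>Pow S. if A = {x} then shuffle_sign {x} (S - {x}) * of_bool (S - {x} = {y}) else 0)"
    unfolding gcoeff_times[OF S] by (rule sum.cong) auto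
  also have "\<dots> = (if x \<in> S then shuffle_sign {x} (S - {x}) * of_bool (S - {x} = {y}) else 0)"
    using S by (simp add: sum.delta)
  also have "\<dots> = (if x \<noteq> y \<and> S = {x, y} then if y < x then -1 else 1 else 0)"
  proof -
    have "x \<in> S \<and> S - {x} = {y} \<longleftrightarrow> x \<noteq> y \<and> S = {x, y}" by auto
    moreover have "{(a, b). a = x \<and> b = y \<and> b < a} = (if y < x then {(x, y)} else {})" by auto
    ultimately show ?thesis by (auto simp: shuffle_sign_def)
  qed
  finally show ?thesis .
qed auto

lemma gvar_square [simp]: "gvar x * gvar x = (0 :: 'g::linorder grassmann)"
  by (rule grassmann_eqI) (simp add: gvar_mult)

lemma gvar_anticommute: "gvar x * gvar y = - (gvar y * gvar x :: 'g::linorder grassmann)"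
  by (rule grassmann_eqI) (auto simp: gvar_mult insert_commute)

text \<open>Elements of the subalgebra generated by the other generators; on these a derivative vanishes and left
  multiplication with the generator is inverted by it.\<close>

definition free_of :: "'g \<Rightarrow> 'g grassmann \<Rightarrow> bool" where
  "free_of x f \<longleftrightarrow> (\<forall>S. x \<in> S \<longrightarrow> gcoeff f S = 0)"

lemma free_of_simps [simp]:
  "free_of x 0" "free_of x (gvar y) \<longleftrightarrow> x \<noteq> y"
  by (auto simp: free_of_def)

lemma free_of_one [simp]: "free_of x (1 :: 'g::linorder grassmann)"
  by (auto simp: free_of_def gcoeff_one)

lemma free_of_mult:
  fixes f g :: "'g::linorder grassmann"
  assumes "free_of x f" "free_of x g"
  shows "free_of x (f * g)"
  unfolding free_of_def
proof (intro allI impI)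
  fix S assume x: "x \<in> S"
  show "gcoeff (f * g) S = 0"
  proof (cases "finite S")
    case S: True
    have "gcoeff f A = 0 \<or> gcoeff g (S - A) = 0" if "A \<in> Pow S" for A
      using assms x by (cases "x \<in> A") (auto simp: free_of_def)
    then show ?thesis unfolding gcoeff_times[OF S] by (intro sum.neutral) auto
  qed simp
qed

lemma gcoeff_gderiv:
  "gcoeff (gderiv x f) S = (if x \<in> S then 0 else (-1) ^ card {y \<in> S. y < x} * gcoeff f (insert x S))"
  by (simp add: gderiv.rep_eq)

lemma gderiv_free_of: "free_of x f \<Longrightarrow> gderiv x f = 0"
  by (rule grassmann_eqI) (auto simp: gcoeff_gderiv free_of_def)

lemma gderiv_linear [simp]:
  "gderiv x 0 = 0" "gderiv x (f + g) = gderiv x f + gderiv x g" "gderiv x (c *\<^sub>R f) = c *\<^sub>R gderiv x f"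
  "gderiv x (- f) = - gderiv x f"
  by (rule grassmann_eqI; simp add: gcoeff_gderiv algebra_simps)+

lemma gderiv_gvar_mult:
  fixes f :: "'g::linorder grassmann"
  assumes "free_of x f"
  shows "gderiv x (gvar x * f) = f"
proof (rule grassmann_eqI)
  fix S :: "'g set" assume S: "finite S"
  show "gcoeff (gderiv x (gvar x * f)) S = gcoeff f S"
  proof (cases "x \<in> S")
    case True
    then show ?thesis using assms by (auto simp: gcoeff_gderiv free_of_def)
  next
    case False
    have "gcoeff (gvar x * f) (insert x S) =
        (\<Sum>A\<in>Pow (insert x S). if A = {x} then shuffle_sign {x} S * gcoeff f S else 0)"
      unfolding gcoeff_times[OF finite.insertI[OF S]] using False by (intro sum.cong) auto
    also have "\<dots> = shuffle_sign {x} S * gcoeff f S" using S by (simp add: sum.delta)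
    also have "shuffle_sign {x} S = (-1) ^ card {y \<in> S. y < x}"
    proof -
      have "{(a, b). a \<in> {x} \<and> b \<in> S \<and> b < a} = Pair x ` {y \<in> S. y < x}" by auto
      then show ?thesis by (simp add: shuffle_sign_def card_image inj_on_def)
    qed
    finally show ?thesis using False by (simp add: gcoeff_gderiv power_mult_distrib[symmetric] flip: mult.assoc)
  qed
qed

lemma gderiv_anticommute:
  fixes f :: "'g::linorder grassmann"
  shows "gderiv x (gderiv y f) = - gderiv y (gderiv x f)"
proof (rule grassmann_eqI)
  fix S :: "'g set" assume S: "finite S"
  show "gcoeff (gderiv x (gderiv y f)) S = gcoeff (- gderiv y (gderiv x f)) S"
  proof (cases "x = y \<or> x \<in> S \<or> y \<in> S")
    case True
    then show ?thesis by (auto simp: gcoeff_gderiv)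
  next
    case False
    have c: "card {z \<in> insert a S. z < b} = card {z \<in> S. z < b} + of_bool (a < b)" if "a \<notin> S" for a b
    proof (cases "a < b")
      case True
      then have "{z \<in> insert a S. z < b} = insert a {z \<in> S. z < b}" by auto
      then show ?thesis using True that S by simp
    next
      case False
      then have "{z \<in> insert a S. z < b} = {z \<in> S. z < b}" by auto
      then show ?thesis using False by simp
    qed
    have "x < y \<longleftrightarrow> \<not> y < x" using False by auto
    then show ?thesis using False c[of x y] c[of y x]
      by (auto simp: gcoeff_gderiv insert_commute power_add)
  qed
qed

definition site_deriv :: "point \<Rightarrow> gen grassmann \<Rightarrow> gen grassmann" where
  "site_deriv v F = gderiv (PsiBar v) (gderiv (Psi v) F)"

lemma site_deriv_commute: "site_deriv v (site_deriv w F) = site_deriv w (site_deriv v F)"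
proof -
  let ?a = "gderiv (PsiBar v)" and ?b = "gderiv (Psi v)" and ?c = "gderiv (PsiBar w)" and ?d = "gderiv (Psi w)"
  have "?a (?b (?c (?d F))) = - ?a (?c (?b (?d F)))" by (simp add: gderiv_anticommute[of "Psi v" "PsiBar w"])
  also have "\<dots> = ?c (?a (?b (?d F)))" by (simp add: gderiv_anticommute[of "PsiBar v" "PsiBar w"])
  also have "\<dots> = - ?c (?a (?d (?b F)))" by (simp add: gderiv_anticommute[of "Psi v" "Psi w"])
  also have "\<dots> = ?c (?d (?a (?b F)))" by (simp add: gderiv_anticommute[of "PsiBar v" "Psi w"])
  finally show ?thesis by (simp add: site_deriv_def)
qed

interpretation site_deriv: comp_fun_commute site_deriv
  by standard (simp add: fun_eq_iff site_deriv_commute)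

definition sites_deriv :: "point set \<Rightarrow> gen grassmann \<Rightarrow> gen grassmann" where
  "sites_deriv L F = Finite_Set.fold site_deriv F L"

lemma berezin_eq: "berezin L F = gcoeff (sites_deriv L F) {}"
  by (simp add: berezin_def sites_deriv_def site_deriv_def[abs_def])

lemma sites_deriv_insert:
  "finite L \<Longrightarrow> v \<notin> L \<Longrightarrow> sites_deriv (insert v L) F = sites_deriv L (site_deriv v F)"
  by (simp add: sites_deriv_def site_deriv.fold_fun_left_comm)

lemma sites_deriv_empty [simp]: "sites_deriv {} F = F"
  by (simp add: sites_deriv_def)

lemma sites_deriv_linear:
  assumes "finite L"
  shows "sites_deriv L 0 = 0" "sites_deriv L (F + G) = sites_deriv L F + sites_deriv L G"
    "sites_deriv L (c *\<^sub>R F) = c *\<^sub>R sites_deriv L F"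
  using assms
  by (induction L arbitrary: F G rule: finite_induct) (simp_all add: sites_deriv_insert site_deriv_def)

lemma berezin_linear:
  assumes "finite L"
  shows "berezin L 0 = 0" "berezin L (F + G) = berezin L F + berezin L G"
    "berezin L (c *\<^sub>R F) = c * berezin L F"
  using sites_deriv_linear[OF assms] by (simp_all add: berezin_eq)

lemma berezin_sum: "finite L \<Longrightarrow> berezin L (sum f I) = (\<Sum>i\<in>I. berezin L (f i))"
  by (induction I rule: infinite_finite_induct) (simp_all add: berezin_linear)

lift_definition psi_pair :: "point \<Rightarrow> point \<Rightarrow> gen even_grassmann" is "\<lambda>u v. psi u * psibar v"
  by (auto simp: even_elem_def psi_def psibar_def gvar_mult)

lemma of_even_psi_pair: "of_even (psi_pair u v) = psi u * psibar v"
  by (rule psi_pair.rep_eq)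

text \<open>Besides commutativity this is the only rule needed for computing with pairs \<open>\<psi>\<^sub>u
  \<psi>bar\<^sub>v\<close>: exchanging the second indices costs a sign. A product with a repeated first or second
  index therefore vanishes.\<close>

lemma psi_pair_exchange: "psi_pair a b * psi_pair c d = - (psi_pair a d * psi_pair c b)"
proof -
  have ac: "gvar x * gvar y = - (gvar y * gvar x)" for x y :: gen by (rule gvar_anticommute)
  have "psi a * psibar b * (psi c * psibar d) = psi a * (psibar b * psi c) * psibar d" by (simp add: mult.assoc)
  also have "\<dots> = - (psi a * (psi c * psibar b) * psibar d)"
    unfolding psi_def psibar_def ac[of "PsiBar b" "Psi c"] by simp
  also have "\<dots> = - (psi a * psi c * (psibar b * psibar d))" by (simp add: mult.assoc)
  also have "\<dots> = psi a * psi c * (psibar d * psibar b)"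
    unfolding psi_def psibar_def ac[of "PsiBar b" "PsiBar d"] by simp
  also have "\<dots> = psi a * (psi c * psibar d) * psibar b" by (simp add: mult.assoc)
  also have "\<dots> = - (psi a * (psibar d * psi c) * psibar b)"
    unfolding psi_def psibar_def ac[of "Psi c" "PsiBar d"] by simp
  also have "\<dots> = - (psi a * psibar d * (psi c * psibar b))" by (simp add: mult.assoc)
  finally have "of_even (psi_pair a b * psi_pair c d) = of_even (- (psi_pair a d * psi_pair c b))"
    by (simp add: of_even_psi_pair)
  then show ?thesis unfolding of_even_inject .
qed

lemma psi_pair_same_right [simp]: "psi_pair a b * psi_pair c b = 0"
proof -
  have "psi_pair a b * psi_pair c b = - (psi_pair a b * psi_pair c b)" by (rule psi_pair_exchange)
  then have "2 *\<^sub>R (psi_pair a b * psi_pair c b) = 0" by (simp add: scaleR_2 eq_neg_iff_add_eq_0)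
  then show ?thesis by simp
qed

lemma psi_pair_same_left [simp]: "psi_pair a b * psi_pair a d = 0"
proof -
  have "psi_pair a b * psi_pair a d = - (psi_pair a d * psi_pair a b)" by (rule psi_pair_exchange)
  also have "\<dots> = - (psi_pair a b * psi_pair a d)" by (simp add: mult.commute)
  finally have "2 *\<^sub>R (psi_pair a b * psi_pair a d) = 0" by (simp add: scaleR_2 eq_neg_iff_add_eq_0)
  then show ?thesis by simp
qed

lemma prod_psi_pair_permute:
  assumes "finite L" "p permutes L"
  shows "(\<Prod>u\<in>L. psi_pair u (p u)) = of_int (sign p) * (\<Prod>u\<in>L. psi_pair u u)"
  using assms
proof (induction rule: permutes_rev_induct)
  case (swap a b p)
  have ab: "b \<in> L - {a}" using swap by auto
  let ?q = "p \<circ> Transposition.transpose a b"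
  have rest: "(\<Prod>u\<in>L - {a} - {b}. psi_pair u (?q u)) = (\<Prod>u\<in>L - {a} - {b}. psi_pair u (p u))"
    by (rule prod.cong) (auto simp: Transposition.transpose_def)
  have "(\<Prod>u\<in>L. psi_pair u (?q u)) = psi_pair a (p b) * (psi_pair b (p a) * (\<Prod>u\<in>L - {a} - {b}. psi_pair u (p u)))"
    using assms(1) swap(1) ab rest by (subst prod.remove[of L a], simp, simp, subst prod.remove[of "L - {a}" b]) auto
  also have "\<dots> = psi_pair a (p b) * psi_pair b (p a) * (\<Prod>u\<in>L - {a} - {b}. psi_pair u (p u))" by (simp add: mult.assoc)
  also have "\<dots> = - (psi_pair a (p a) * (psi_pair b (p b) * (\<Prod>u\<in>L - {a} - {b}. psi_pair u (p u))))"
    unfolding psi_pair_exchange[of a "p b" b "p a"] by (simp add: mult.assoc)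
  also have "psi_pair a (p a) * (psi_pair b (p b) * (\<Prod>u\<in>L - {a} - {b}. psi_pair u (p u))) = (\<Prod>u\<in>L. psi_pair u (p u))"
    using assms(1) swap(1) ab by (subst prod.remove[of L a], simp, simp, subst prod.remove[of "L - {a}" b]) auto
  also have "\<dots> = of_int (sign p) * (\<Prod>u\<in>L. psi_pair u u)" by (rule swap.IH)
  also have "- (of_int (sign p) * (\<Prod>u\<in>L. psi_pair u u)) = of_int (sign ?q) * (\<Prod>u\<in>L. psi_pair u u)"
  proof -
    have "permutation p" using swap assms(1) by (auto simp: permutation_permutes)
    then show ?thesis using swap(3) by (simp add: sign_compose permutation_swap_id sign_swap_id)
  qed
  finally show ?case .
qed simp

lemma free_of_prod_psi_pair:
  assumes "v \<notin> J"
  shows "free_of (Psi v) (of_even (\<Prod>u\<in>J. psi_pair u (p u)))"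
  using assms
  by (induction J rule: infinite_finite_induct)
     (auto intro!: free_of_mult simp: of_even_psi_pair psi_def psibar_def)

lemma free_of_prod_psi_pair_bar:
  assumes "v \<notin> p ` J"
  shows "free_of (PsiBar v) (of_even (\<Prod>u\<in>J. psi_pair u (p u)))"
  using assms
  by (induction J rule: infinite_finite_induct)
     (auto intro!: free_of_mult simp: of_even_psi_pair psi_def psibar_def)

lemma berezin_prod_missing:
  assumes "finite L" "J \<subset> L"
  shows "berezin L (of_even (\<Prod>u\<in>J. psi_pair u (p u))) = 0"
proof -
  obtain v where v: "v \<in> L" "v \<notin> J" using assms(2) by blast
  then have L: "L = insert v (L - {v})" by blast
  have "sites_deriv L (of_even (\<Prod>u\<in>J. psi_pair u (p u))) = 0"
    using assms(1) by (subst L, subst sites_deriv_insert)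
      (auto simp: site_deriv_def gderiv_free_of[OF free_of_prod_psi_pair[OF v(2)]] sites_deriv_linear)
  then show ?thesis by (simp add: berezin_eq)
qed

lemma berezin_prod_diagonal:
  assumes "finite L"
  shows "berezin L (of_even (\<Prod>u\<in>L. psi_pair u u)) = 1"
proof -
  have "sites_deriv L (of_even (\<Prod>u\<in>L. psi_pair u u)) = 1"
    using assms
  proof (induction L rule: finite_induct)
    case (insert v L)
    let ?F = "of_even (\<Prod>u\<in>L. psi_pair u u)"
    have f1: "free_of (Psi v) ?F" "free_of (PsiBar v) ?F"
      using free_of_prod_psi_pair[of v L "\<lambda>u. u"] free_of_prod_psi_pair_bar[of v "\<lambda>u. u" L] insert.hyps by auto
    have "site_deriv v (psi v * (psibar v * ?F)) = ?F"
      using f1 by (simp add: site_deriv_def psi_def psibar_def gderiv_gvar_mult free_of_mult)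
    then show ?case using insert by (simp add: sites_deriv_insert of_even_psi_pair mult.assoc)
  qed simp
  then show ?thesis by (simp add: berezin_eq gcoeff_one)
qed

lemma prod_psi_pair_not_inj:
  assumes "finite L" "\<not> inj_on p L"
  shows "(\<Prod>u\<in>L. psi_pair u (p u)) = 0"
proof -
  obtain a b where ab: "a \<in> L" "b \<in> L - {a}" "p a = p b" using assms(2) by (auto simp: inj_on_def)
  have "(\<Prod>u\<in>L. psi_pair u (p u)) = psi_pair a (p b) * psi_pair b (p b) * (\<Prod>u\<in>L - {a} - {b}. psi_pair u (p u))"
    using assms(1) ab by (simp add: prod.remove[of L a] prod.remove[of "L - {a}" b] mult.assoc del: psi_pair_same_right)
  then show ?thesis by simp
qed

text \<open>Multiply out. Products that miss a generator integrate to zero and products with a repeated one vanish, so that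
  the permutations of \<open>L\<close> remain; the exchange rule produces their signs.\<close>

lemma berezin_prod_eq_det:
  assumes "finite L"
  shows "berezin L (of_even (\<Prod>u\<in>L. 1 + (\<Sum>v\<in>L. A u v *\<^sub>R psi_pair u v))) = det_on L A"
proof -
  let ?b = "\<lambda>J p. berezin L (of_even (\<Prod>u\<in>J. psi_pair u (p u)))"
  have scal: "(\<Prod>u\<in>J. A u (p u) *\<^sub>R psi_pair u (p u)) = (\<Prod>u\<in>J. A u (p u)) *\<^sub>R (\<Prod>u\<in>J. psi_pair u (p u))" for J p
    by (induction J rule: infinite_finite_induct) (simp_all add: mult_ac)
  have "(\<Prod>u\<in>L. 1 + (\<Sum>v\<in>L. A u v *\<^sub>R psi_pair u v)) =
      (\<Sum>J\<in>Pow L. \<Prod>u\<in>J. \<Sum>v\<in>L. A u v *\<^sub>R psi_pair u v)"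
    using prod_add[OF assms, of "\<lambda>u. \<Sum>v\<in>L. A u v *\<^sub>R psi_pair u v" "\<lambda>_. 1"] by (simp add: add.commute)
  also have "\<dots> = (\<Sum>J\<in>Pow L. \<Sum>p\<in>J \<rightarrow>\<^sub>E L. (\<Prod>u\<in>J. A u (p u)) *\<^sub>R (\<Prod>u\<in>J. psi_pair u (p u)))"
  proof (rule sum.cong[OF refl])
    fix J assume "J \<in> Pow L"
    then have "finite J" using assms finite_subset by auto
    then show "(\<Prod>u\<in>J. \<Sum>v\<in>L. A u v *\<^sub>R psi_pair u v) =
        (\<Sum>p\<in>J \<rightarrow>\<^sub>E L. (\<Prod>u\<in>J. A u (p u)) *\<^sub>R (\<Prod>u\<in>J. psi_pair u (p u)))"
      using assms by (simp add: prod_sum_PiE scal)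
  qed
  finally have "berezin L (of_even (\<Prod>u\<in>L. 1 + (\<Sum>v\<in>L. A u v *\<^sub>R psi_pair u v))) =
      (\<Sum>J\<in>Pow L. \<Sum>p\<in>J \<rightarrow>\<^sub>E L. (\<Prod>u\<in>J. A u (p u)) * ?b J p)"
    by (simp add: of_even_sum berezin_sum[OF assms] berezin_linear[OF assms])
  also have "\<dots> = (\<Sum>J\<in>{L}. \<Sum>p\<in>J \<rightarrow>\<^sub>E L. (\<Prod>u\<in>J. A u (p u)) * ?b J p)"
  proof (rule sum.mono_neutral_right)
    have "?b J p = 0" if "J \<in> Pow L - {L}" for J p
      using that by (intro berezin_prod_missing assms) auto
    then show "\<forall>J\<in>Pow L - {L}. (\<Sum>p\<in>J \<rightarrow>\<^sub>E L. (\<Prod>u\<in>J. A u (p u)) * ?b J p) = 0"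
      by (intro ballI sum.neutral) simp
  qed (use assms in auto)
  also have "\<dots> = (\<Sum>p\<in>L \<rightarrow>\<^sub>E L. (\<Prod>u\<in>L. A u (p u)) * ?b L p)" by simp
  also have "\<dots> = (\<Sum>p\<in>{p \<in> L \<rightarrow>\<^sub>E L. inj_on p L}. (\<Prod>u\<in>L. A u (p u)) * ?b L p)"
    using assms by (intro sum.mono_neutral_right)
      (auto intro: finite_PiE simp: prod_psi_pair_not_inj berezin_linear)
  also have "\<dots> = (\<Sum>p | p permutes L. (\<Prod>u\<in>L. A u (p u)) * ?b L p)"
  proof (rule sum.reindex_bij_witness[of _ "\<lambda>p. restrict p L" "\<lambda>p x. if x \<in> L then p x else x"])
    fix p assume p: "p \<in> {p \<in> L \<rightarrow>\<^sub>E L. inj_on p L}"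
    then show "restrict (\<lambda>x. if x \<in> L then p x else x) L = p"
      by (auto simp: fun_eq_iff PiE_def extensional_def)
    have "p ` L \<subseteq> L" "inj_on p L" using p by auto
    then have "bij_betw p L L" using endo_inj_surj[OF assms] by (simp add: bij_betw_def)
    then have "bij_betw (\<lambda>x. if x \<in> L then p x else x) L L"
      by (rule bij_betw_cong[THEN iffD1, rotated]) auto
    then show "(\<lambda>x. if x \<in> L then p x else x) \<in> {p. p permutes L}"
      by (auto intro: bij_imp_permutes)
    have "(\<Prod>u\<in>L. A u (if u \<in> L then p u else u)) = (\<Prod>u\<in>L. A u (p u))"
      "(\<Prod>u\<in>L. psi_pair u (if u \<in> L then p u else u)) = (\<Prod>u\<in>L. psi_pair u (p u))"
      by (auto intro: prod.cong)
    then show "(\<Prod>u\<in>L. A u ((\<lambda>x. if x \<in> L then p x else x) u)) * ?b L (\<lambda>x. if x \<in> L then p x else x) =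
        (\<Prod>u\<in>L. A u (p u)) * ?b L p" by simp
  next
    fix p assume p: "p \<in> {p. p permutes L}"
    then show "(\<lambda>x. if x \<in> L then restrict p L x else x) = p"
      by (auto simp: fun_eq_iff permutes_not_in)
    show "restrict p L \<in> {p \<in> L \<rightarrow>\<^sub>E L. inj_on p L}"
      using p by (auto simp: permutes_in_image permutes_inj_on inj_on_restrict_eq)
  qed
  also have "\<dots> = det_on L A"
    unfolding det_on_def
  proof (rule sum.cong[OF refl])
    fix p assume p: "p \<in> {p. p permutes L}"
    have "of_even (of_int (sign p) * (\<Prod>u\<in>L. psi_pair u u)) = real_of_int (sign p) *\<^sub>R of_even (\<Prod>u\<in>L. psi_pair u u)"
      by (metis of_even_simps(7) of_real_of_int_eq scaleR_conv_of_real)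
    then show "(\<Prod>u\<in>L. A u (p u)) * ?b L p = of_int (sign p) * (\<Prod>i\<in>L. A i (p i))"
      using p assms by (simp add: prod_psi_pair_permute berezin_linear berezin_prod_diagonal)
  qed
  finally show ?thesis .
qed

section \<open>Fermionic expectations\<close>

text \<open>The even element \<open>(\<psi>\<^sub>w - \<psi>\<^sub>v) (\<psi>bar\<^sub>w - \<psi>bar\<^sub>v)\<close> for
  the edge \<open>f = (v, w)\<close>, multiplied out.\<close>

definition zeta :: "dedge \<Rightarrow> gen even_grassmann" where
  "zeta f = psi_pair (snd f) (snd f) - psi_pair (snd f) (fst f) - psi_pair (fst f) (snd f) + psi_pair (fst f) (fst f)"

definition incidence :: "dedge \<Rightarrow> point \<Rightarrow> real" where
  "incidence f u = of_bool (u = snd f) - of_bool (u = fst f)"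

lemma of_even_zeta: "of_even (zeta (v, v + e)) = grad psi e v * grad psibar e v"
  by (simp add: zeta_def of_even_psi_pair grad_def algebra_simps)

lemma zeta_square: "zeta f * zeta f = 0"
proof -
  have "psi_pair a b * psi_pair b a = - (psi_pair a a * psi_pair b b)" for a b
    by (rule psi_pair_exchange)
  then show ?thesis
    by (simp add: zeta_def algebra_simps psi_pair_exchange[of "snd f" "snd f" "fst f" "fst f"])
qed

definition quad_form :: "point set \<Rightarrow> (point \<Rightarrow> point \<Rightarrow> real) \<Rightarrow> gen even_grassmann" where
  "quad_form L A = (\<Sum>u\<in>L. \<Sum>v\<in>L. A u v *\<^sub>R psi_pair u v)"

lemma row_square: "(\<Sum>v\<in>L. A u v *\<^sub>R psi_pair u v) * (\<Sum>v\<in>L. A u v *\<^sub>R psi_pair u v) = 0"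
  by (simp add: sum_product)

lemma quad_form_nilpotent: "finite L \<Longrightarrow> quad_form L A ^ Suc (card L) = 0"
  unfolding quad_form_def by (rule nexp_sum(1)) (simp_all add: row_square)

lemma berezin_nexp_quad_form:
  assumes "finite L"
  shows "berezin L (of_even (nexp (quad_form L A))) = det_on L A"
proof -
  have "nexp (quad_form L A) = (\<Prod>u\<in>L. 1 + (\<Sum>v\<in>L. A u v *\<^sub>R psi_pair u v))"
    unfolding quad_form_def by (rule nexp_sum(2)) (use assms in \<open>simp_all add: row_square\<close>)
  then show ?thesis by (simp only: berezin_prod_eq_det[OF assms])
qed

lemma fgff_of_even:
  "fgff L (of_even X) =
    berezin L (of_even (nexp (quad_form L (\<lambda>u v. - lattice_laplacian u v)) * X)) / det_on L (\<lambda>u v. - lattice_laplacian u v)"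
proof -
  have "(\<Sum>u\<in>L. \<Sum>v\<in>L. psi u * (- lattice_laplacian u v) *\<^sub>R psibar v) =
      of_even (quad_form L (\<lambda>u v. - lattice_laplacian u v))"
    by (simp add: quad_form_def of_even_sum of_even_psi_pair)
  then show ?thesis by (simp add: fgff_def gexp_of_even)
qed

lemma fgff_linear:
  assumes "finite L"
  shows "fgff L (of_even (X + Y)) = fgff L (of_even X) + fgff L (of_even Y)"
    "fgff L (of_even (c *\<^sub>R X)) = c * fgff L (of_even X)"
  by (simp_all only: fgff_of_even distrib_left mult_scaleR_right)
    (simp_all only: of_even_simps(3,7) berezin_linear[OF assms] add_divide_distrib times_divide_eq_right)

lemma fgff_sum:
  assumes "finite L"
  shows "fgff L (of_even (\<Sum>i\<in>I. X i)) = (\<Sum>i\<in>I. fgff L (of_even (X i)))"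
proof -
  have "fgff L (of_even 0) = 0" using fgff_linear(2)[OF assms, of 0 0] by simp
  then show ?thesis
    by (induction I rule: infinite_finite_induct) (simp_all only: fgff_linear(1)[OF assms] sum.infinite sum.empty sum.insert not_False_eq_True)
qed

definition edges_within :: "point set \<Rightarrow> dedge set" where
  "edges_within L = {f. fst f \<in> L \<and> snd f \<in> L}"

lemma zeta_eq_quad_form:
  assumes "finite L" "f \<in> edges_within L"
  shows "zeta f = quad_form L (\<lambda>u v. incidence f u * incidence f v)"
proof -
  have "(\<Sum>v\<in>L. (incidence f u * incidence f v) *\<^sub>R psi_pair u v) =
      incidence f u *\<^sub>R (psi_pair u (snd f) - psi_pair u (fst f))" for u
    using assms
    by (simp add: incidence_def edges_within_def algebra_simps sum.distrib sum_subtractf of_bool_def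
        if_distrib[of "\<lambda>c. c *\<^sub>R _"] if_distrib[of "\<lambda>c. _ * c"] sum.delta cong: if_cong)
  then have "quad_form L (\<lambda>u v. incidence f u * incidence f v) =
      (\<Sum>u\<in>L. incidence f u *\<^sub>R (psi_pair u (snd f) - psi_pair u (fst f)))"
    by (simp add: quad_form_def)
  also have "\<dots> = zeta f"
    using assms
    by (simp add: incidence_def edges_within_def zeta_def algebra_simps sum.distrib sum_subtractf of_bool_def
        if_distrib[of "\<lambda>c. c *\<^sub>R _"] sum.delta cong: if_cong)
  finally show ?thesis by simp
qed

text \<open>The product is the exponential of \<open>- (\<Sum>f\<in>E. zeta f)\<close>, so it can be absorbed into the
  Gaussian weight, where it changes the quadratic form.\<close>

lemma fgff_prod_one_minus_zeta:
  assumes "finite L" "finite E" "E \<subseteq> edges_within L"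
  shows "fgff L (of_even (\<Prod>f\<in>E. 1 - zeta f)) =
    det_on L (\<lambda>u v. - lattice_laplacian u v - (\<Sum>f\<in>E. incidence f u * incidence f v)) /
    det_on L (\<lambda>u v. - lattice_laplacian u v)"
proof -
  let ?A = "\<lambda>u v. - lattice_laplacian u v"
  have "quad_form L ?A + (\<Sum>f\<in>E. - zeta f) =
      quad_form L (\<lambda>u v. ?A u v - (\<Sum>f\<in>E. incidence f u * incidence f v))"
  proof -
    have "(\<Sum>f\<in>E. zeta f) = (\<Sum>f\<in>E. quad_form L (\<lambda>u v. incidence f u * incidence f v))"
      using assms by (intro sum.cong refl zeta_eq_quad_form) auto
    also have "\<dots> = quad_form L (\<lambda>u v. \<Sum>f\<in>E. incidence f u * incidence f v)"
      unfolding quad_form_def scaleR_sum_left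
      by (subst sum.swap, rule sum.cong[OF refl], rule sum.swap)
    finally show ?thesis
      by (simp add: quad_form_def sum_negf scaleR_diff_left sum_subtractf)
  qed
  moreover have "nexp (quad_form L ?A + (\<Sum>f\<in>E. - zeta f)) = nexp (quad_form L ?A) * (\<Prod>f\<in>E. 1 + - zeta f)"
    by (rule nexp_add_sum[OF assms(2) quad_form_nilpotent[OF assms(1)], THEN conjunct2]) (simp add: zeta_square)
  ultimately have "nexp (quad_form L ?A) * (\<Prod>f\<in>E. 1 - zeta f) =
      nexp (quad_form L (\<lambda>u v. ?A u v - (\<Sum>f\<in>E. incidence f u * incidence f v)))" by simp
  then show ?thesis
    by (simp only: fgff_of_even berezin_nexp_quad_form[OF assms(1)])
qed

text \<open>Moebius inversion on the lattice of subsets, in the form of a uniqueness statement.\<close>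

lemma subset_sums_determine:
  fixes g h :: "'a set \<Rightarrow> real"
  assumes "finite E" "\<And>E'. E' \<subseteq> E \<Longrightarrow> (\<Sum>S\<in>Pow E'. g S) = (\<Sum>S\<in>Pow E'. h S)"
  shows "g E = h E"
  using assms
proof (induction "card E" arbitrary: E rule: less_induct)
  case less
  have "g S = h S" if "S \<in> Pow E - {E}" for S
  proof (rule less.hyps)
    show "card S < card E" using that less.prems(1) by (auto intro: psubset_card_mono)
    show "finite S" using that less.prems(1) finite_subset by auto
  qed (use that less.prems(2) in auto)
  then have "(\<Sum>S\<in>Pow E - {E}. g S) = (\<Sum>S\<in>Pow E - {E}. h S)" by (rule sum.cong[OF refl])
  moreover have "(\<Sum>S\<in>Pow E. g S) = g E + (\<Sum>S\<in>Pow E - {E}. g S)"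
    "(\<Sum>S\<in>Pow E. h S) = h E + (\<Sum>S\<in>Pow E - {E}. h S)"
    using less.prems(1) by (auto intro!: sum.remove)
  ultimately show ?case using less.prems(2)[of E] by simp
qed

lemma prod_one_minus:
  fixes x :: "'a \<Rightarrow> 'b::comm_ring_1"
  assumes "finite E"
  shows "(\<Prod>f\<in>E. 1 - x f) = (\<Sum>S\<in>Pow E. (-1) ^ card S * (\<Prod>f\<in>S. x f))"
  using prod_add[OF assms, of "\<lambda>f. - x f" "\<lambda>_. 1"] by (simp add: prod_uminus)

definition wired_pair :: "dedge \<Rightarrow> point set" where
  "wired_pair f = {fst f, snd f}"

text \<open>The Laplacian is the sum of the rank one matrices of its edges.\<close>

lemma graph_laplacian_delete:
  assumes "finite F" "wired_pair f \<in> F" "fst f \<noteq> snd f"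
  shows "graph_laplacian (F - {wired_pair f}) u v = graph_laplacian F u v - incidence f u * incidence f v"
proof (cases "u = v")
  case True
  then show ?thesis
    using edge_degree_Diff[OF assms(1,2), of u] assms(3)
    by (auto simp: graph_laplacian_def incidence_def wired_pair_def)
next
  case False
  then show ?thesis
    using assms(2,3) by (auto simp: graph_laplacian_def incidence_def wired_pair_def doubleton_eq_iff insert_commute)
qed

lemma graph_laplacian_delete_set:
  assumes "finite F" "finite E" "inj_on wired_pair E" "wired_pair ` E \<subseteq> F" "\<And>f. f \<in> E \<Longrightarrow> fst f \<noteq> snd f"
  shows "graph_laplacian (F - wired_pair ` E) u v = graph_laplacian F u v - (\<Sum>f\<in>E. incidence f u * incidence f v)"
  using assms(2-)
proof (induction E rule: finite_induct)
  case (insert f E)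
  have "F - wired_pair ` insert f E = (F - wired_pair ` E) - {wired_pair f}" by auto
  moreover have "wired_pair f \<notin> wired_pair ` E" using insert.prems(1) insert.hyps by auto
  then have "graph_laplacian ((F - wired_pair ` E) - {wired_pair f}) u v =
      graph_laplacian (F - wired_pair ` E) u v - incidence f u * incidence f v"
    using insert.prems assms(1) by (intro graph_laplacian_delete) auto
  moreover have "graph_laplacian (F - wired_pair ` E) u v =
      graph_laplacian F u v - (\<Sum>f\<in>E. incidence f u * incidence f v)"
    using insert.prems by (intro insert.IH) auto
  ultimately show ?case using insert.hyps by simp
qed simp

section \<open>Transfer currents\<close>

locale finite_domain =
  fixes L :: "point set"
  assumes fin: "finite L" and lattice: "L \<subseteq> tri_lattice"
begin

abbreviation "wired \<equiv> wired_edges L"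

abbreviation "neg_laplacian \<equiv> (\<lambda>u v. - lattice_laplacian u v)"

abbreviation "spanning_trees \<equiv> rooted_trees L wired"

lemma simple_wired: "simple_edges wired"
  by (rule simple_edges_wired[OF fin lattice])

lemma wired_trees: "wired_spanning_trees L = spanning_trees"
  unfolding wired_spanning_trees_def by (rule wired_spanning_trees_eq[OF fin simple_wired])

lemma det_laplacian: "det_on L neg_laplacian = real (card spanning_trees)"
proof -
  have "det_on L neg_laplacian = det_on L (graph_laplacian wired)"
    by (rule det_on_cong) (simp add: graph_laplacian_wired[OF lattice])
  then show ?thesis using matrix_tree[OF fin simple_wired] by simp
qed

lemma card_recurrent: "card (recurrent_sandpiles L) = card spanning_trees"
  unfolding recurrent_sandpiles_eq[OF lattice] by (rule card_recurrent_configs[OF fin simple_wired])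

lemma card_trees_pos: "card spanning_trees > 0"
  using max_config_recurrent[OF fin] finite_recurrent_sandpiles[OF fin] card_gt_0_iff
  unfolding card_recurrent[symmetric] by blast

lemma finite_trees: "finite spanning_trees" by (rule finite_rooted_trees[OF simple_wired])

lemma det_laplacian_nonzero: "det_on L neg_laplacian \<noteq> 0"
  using det_laplacian card_trees_pos by simp

lemma green_inverse:
  "u \<in> L \<Longrightarrow> w \<in> L \<Longrightarrow> (\<Sum>v\<in>L. neg_laplacian u v * green L v w) = of_bool (u = w)"
  unfolding green_def by (rule inverse_on_works(1)[OF fin det_laplacian_nonzero])

lemma transfer_current_eq:
  assumes "f \<in> edges_within L" "g \<in> edges_within L"
  shows "(\<Sum>u\<in>L. \<Sum>v\<in>L. incidence f u * green L u v * incidence g v) = transfer_current L f g"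
proof -
  have "(\<Sum>v\<in>L. incidence f u * green L u v * incidence g v) =
      incidence f u * (green L u (snd g) - green L u (fst g))" for u
    using assms fin
    by (simp add: incidence_def edges_within_def algebra_simps sum.distrib sum_subtractf of_bool_def
        if_distrib[of "\<lambda>c. _ * c"] sum.delta cong: if_cong)
  then have "(\<Sum>u\<in>L. \<Sum>v\<in>L. incidence f u * green L u v * incidence g v) =
      (\<Sum>u\<in>L. incidence f u * (green L u (snd g) - green L u (fst g)))" by simp
  also have "\<dots> = green L (snd f) (snd g) - green L (snd f) (fst g) - (green L (fst f) (snd g) - green L (fst f) (fst g))"
    using assms fin
    by (simp add: incidence_def edges_within_def left_diff_distrib sum_subtractf of_bool_def
        if_distrib[of "\<lambda>c. c * _"] sum.delta cong: if_cong)
  also have "\<dots> = transfer_current L f g"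
    by (simp add: transfer_current_def mixed_diff_def edge_dir_def)
  finally show ?thesis .
qed

text \<open>The common value of both inclusion-exclusion sums, as an alternating sum of minors.\<close>

lemma det_update_ratio:
  assumes "finite E" "E \<subseteq> edges_within L"
  shows "det_on L (\<lambda>u v. neg_laplacian u v - (\<Sum>f\<in>E. incidence f u * incidence f v)) / det_on L neg_laplacian =
    (\<Sum>S\<in>Pow E. (-1) ^ card S * det_on S (transfer_current L))"
proof -
  have "det_on L (\<lambda>u v. neg_laplacian u v - (\<Sum>f\<in>E. incidence f u * incidence f v)) / det_on L neg_laplacian =
      det_on E (\<lambda>f g. of_bool (f = g) - (\<Sum>u\<in>L. \<Sum>v\<in>L. incidence f u * green L u v * incidence g v))"
    using det_on_low_rank_update[OF fin assms(1) green_inverse, of incidence incidence] det_laplacian_nonzero by simp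
  also have "\<dots> = det_on E (\<lambda>f g. of_bool (f = g) + - transfer_current L f g)"
  proof (rule det_on_cong)
    fix f g assume "f \<in> E" "g \<in> E"
    then show "of_bool (f = g) - (\<Sum>u\<in>L. \<Sum>v\<in>L. incidence f u * green L u v * incidence g v) =
        of_bool (f = g) + - transfer_current L f g"
      using transfer_current_eq[of f g] assms(2) by auto
  qed
  also have "\<dots> = (\<Sum>S\<in>Pow E. det_on S (\<lambda>f g. - transfer_current L f g))"
    by (rule det_on_add_identity[OF assms(1)])
  also have "\<dots> = (\<Sum>S\<in>Pow E. (-1) ^ card S * det_on S (transfer_current L))"
    using assms(1) by (intro sum.cong refl det_on_uminus) (auto intro: finite_subset)
  finally show ?thesis .
qed

text \<open>The determinantal formula for fermionic moments, read off from its inclusion-exclusion sums.\<close>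

lemma fgff_prod_zeta:
  assumes "finite E" "E \<subseteq> edges_within L"
  shows "fgff L (of_even (\<Prod>f\<in>E. zeta f)) = det_on E (transfer_current L)"
proof -
  let ?g = "\<lambda>S. (-1) ^ card S * fgff L (of_even (\<Prod>f\<in>S. zeta f))"
  let ?h = "\<lambda>S. (-1) ^ card S * det_on S (transfer_current L)"
  have "?g E = ?h E"
  proof (rule subset_sums_determine[OF assms(1)])
    fix E' assume "E' \<subseteq> E"
    then have E': "finite E'" "E' \<subseteq> edges_within L" using assms finite_subset by auto
    have sgn: "(-1) ^ k * x = ((-1) ^ k) *\<^sub>R x" for k and x :: "gen even_grassmann"
      by (simp add: scaleR_conv_of_real)
    have "(\<Sum>S\<in>Pow E'. ?g S) = fgff L (of_even (\<Prod>f\<in>E'. 1 - zeta f))"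
      unfolding prod_one_minus[OF E'(1)] sgn by (simp only: fgff_sum[OF fin] fgff_linear(2)[OF fin])
    also have "\<dots> = (\<Sum>S\<in>Pow E'. ?h S)"
      unfolding fgff_prod_one_minus_zeta[OF fin E'] by (rule det_update_ratio[OF E'])
    finally show "(\<Sum>S\<in>Pow E'. ?g S) = (\<Sum>S\<in>Pow E'. ?h S)" .
  qed
  then show ?thesis by simp
qed

text \<open>The transfer current theorem. The inclusion-exclusion sum counts the trees avoiding \<open>E'\<close>, that is,
  the spanning trees of a graph with fewer edges, to which the matrix-tree theorem applies.\<close>

lemma card_trees_containing:
  assumes "finite E" "E \<subseteq> edges_within L" "inj_on wired_pair E" "wired_pair ` E \<subseteq> wired"
  shows "real (card {T \<in> spanning_trees. wired_pair ` E \<subseteq> T}) / real (card spanning_trees) = det_on E (transfer_current L)"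
proof -
  let ?p = "\<lambda>S. real (card {T \<in> spanning_trees. wired_pair ` S \<subseteq> T}) / real (card spanning_trees)"
  let ?g = "\<lambda>S. (-1) ^ card S * ?p S"
  let ?h = "\<lambda>S. (-1) ^ card S * det_on S (transfer_current L)"
  have "?g E = ?h E"
  proof (rule subset_sums_determine[OF assms(1)])
    fix E' assume sub: "E' \<subseteq> E"
    then have E': "finite E'" "E' \<subseteq> edges_within L" "inj_on wired_pair E'" "wired_pair ` E' \<subseteq> wired"
      using assms finite_subset by (auto intro: inj_on_subset)
    have ne: "fst f \<noteq> snd f" if "f \<in> E'" for f
    proof
      assume "fst f = snd f"
      then have "card (wired_pair f) = 1" by (simp add: wired_pair_def)
      then show False using that E'(4) simple_wired by (auto simp: simple_edges_def)
    qed
    have count: "real (card {T \<in> spanning_trees. P T}) = (\<Sum>T\<in>spanning_trees. of_bool (P T))" for P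
      using finite_trees by (simp add: sum_of_bool_eq Int_def)
    have "(\<Sum>S\<in>Pow E'. (-1) ^ card S * real (card {T \<in> spanning_trees. wired_pair ` S \<subseteq> T})) =
        (\<Sum>T\<in>spanning_trees. \<Sum>S\<in>Pow E'. (-1) ^ card S * of_bool (wired_pair ` S \<subseteq> T))"
      unfolding count sum_distrib_left by (rule sum.swap)
    also have "\<dots> = (\<Sum>T\<in>spanning_trees. \<Prod>f\<in>E'. 1 - of_bool (wired_pair f \<in> T))"
    proof (rule sum.cong[OF refl])
      fix T
      have "(of_bool (wired_pair ` S \<subseteq> T) :: real) = (\<Prod>f\<in>S. of_bool (wired_pair f \<in> T))" if "S \<in> Pow E'" for S
        using that E'(1) finite_subset[of S E'] by (auto simp: image_subset_iff)
      then show "(\<Sum>S\<in>Pow E'. (-1) ^ card S * of_bool (wired_pair ` S \<subseteq> T)) =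
          (\<Prod>f\<in>E'. 1 - (of_bool (wired_pair f \<in> T) :: real))"
        unfolding prod_one_minus[OF E'(1)] by (intro sum.cong) auto
    qed
    also have "\<dots> = (\<Sum>T\<in>spanning_trees. of_bool (wired_pair ` E' \<inter> T = {}))"
    proof (rule sum.cong[OF refl])
      fix T
      have "(1::real) - of_bool b = of_bool (\<not> b)" for b by simp
      then show "(\<Prod>f\<in>E'. (1::real) - of_bool (wired_pair f \<in> T)) = of_bool (wired_pair ` E' \<inter> T = {})"
        using E'(1) by (auto simp: disjoint_iff)
    qed
    also have "\<dots> = real (card (rooted_trees L (wired - wired_pair ` E')))"
      unfolding count[symmetric]
      by (intro arg_cong[where f="\<lambda>S. real (card S)"]) (auto simp: rooted_trees_def)
    also have "\<dots> = det_on L (graph_laplacian (wired - wired_pair ` E'))"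
      by (rule matrix_tree[OF fin simple_edges_subset[OF simple_wired]]) auto
    also have "\<dots> = det_on L (\<lambda>u v. neg_laplacian u v - (\<Sum>f\<in>E'. incidence f u * incidence f v))"
    proof (rule det_on_cong)
      fix u v assume "u \<in> L"
      have "finite wired" using simple_wired by (simp add: simple_edges_def)
      then show "graph_laplacian (wired - wired_pair ` E') u v = neg_laplacian u v - (\<Sum>f\<in>E'. incidence f u * incidence f v)"
        using graph_laplacian_delete_set[OF _ E'(1,3,4) ne] graph_laplacian_wired[OF lattice \<open>u \<in> L\<close>] by simp
    qed
    finally have "(\<Sum>S\<in>Pow E'. (-1) ^ card S * real (card {T \<in> spanning_trees. wired_pair ` S \<subseteq> T})) / det_on L neg_laplacian =
        (\<Sum>S\<in>Pow E'. ?h S)"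
      using det_update_ratio[OF E'(1,2)] by simp
    then show "(\<Sum>S\<in>Pow E'. ?g S) = (\<Sum>S\<in>Pow E'. ?h S)"
      by (simp add: det_laplacian sum_divide_distrib)
  qed
  then show ?thesis by (simp only: mult_cancel_left power_eq_0_iff) simp
qed

end

section \<open>Cumulants\<close>

lemma cumulant_of_moments_cong:
  assumes "\<And>B. B \<subseteq> V \<Longrightarrow> B \<noteq> {} \<Longrightarrow> m B = m' B"
  shows "cumulant_of_moments m V = cumulant_of_moments m' V"
  unfolding cumulant_of_moments_def
proof (intro sum.cong refl arg_cong2[where f="(*)"] prod.cong)
  fix P B assume "P \<in> {P. partition_on V P}" "B \<in> P"
  then show "m B = m' B" by (intro assms) (auto simp: partition_on_def)
qed

lemma card_partition_blocks_avoiding: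
  assumes "finite V" "partition_on V P" "x \<in> V"
  shows "card {D \<in> P. x \<notin> D} = card P - 1"
proof -
  obtain D0 where D0: "D0 \<in> P" "x \<in> D0" using assms by (auto simp: partition_on_def)
  have "D = D0" if "D \<in> P" "x \<in> D" for D
    using that D0 assms(2) by (auto simp: partition_on_def disjoint_def)
  then have "{D \<in> P. x \<notin> D} = P - {D0}" using D0 by blast
  moreover have "finite P" using finite_elements[OF assms(1,2)] .
  ultimately show ?thesis using D0 by simp
qed

text \<open>Insert the definition of the cumulants: a partition of \<open>C\<close> together with \<open>V - C\<close> is a
  partition of \<open>V\<close> with a marked block avoiding \<open>x\<close>. A partition with \<open>k >
  1\<close> blocks arises from \<open>C = V\<close> with weight \<open>(-1)\<^bsup>k-1\<^esup> (k - 1)!\<close>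
  and from its \<open>k - 1\<close> markings with weight \<open>(-1)\<^bsup>k-2\<^esup> (k - 2)!\<close> each, so
  that everything cancels except for \<open>k = 1\<close>.\<close>

lemma cumulant_recursion:
  assumes V: "finite V" and x: "x \<in> V" and m1: "m {} = 1"
  shows "(\<Sum>C | x \<in> C \<and> C \<subseteq> V. cumulant_of_moments m C * m (V - C)) = m V"
proof -
  define w :: "nat \<Rightarrow> real" where "w = (\<lambda>k. fact (k - 1) * (-1) ^ (k - 1))"
  let ?\<Pi> = "\<lambda>C. {P. partition_on C P}"
  have fin\<Pi>: "finite (?\<Pi> C)" if "C \<subseteq> V" for C
    using finite_subset[OF that V] by (rule finitely_many_partition_on)
  have finS: "finite {C. x \<in> C \<and> C \<subset> V}" using V by (auto intro: finite_subset[of _ "Pow V"])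
  have finP: "finite P" if "P \<in> ?\<Pi> V" for P using finite_elements[OF V] that by auto
  have split: "{C. x \<in> C \<and> C \<subseteq> V} = insert V {C. x \<in> C \<and> C \<subset> V}" using x by auto
  have "(\<Sum>C | x \<in> C \<and> C \<subset> V. cumulant_of_moments m C * m (V - C)) =
      (\<Sum>C | x \<in> C \<and> C \<subset> V. \<Sum>P\<in>?\<Pi> C. w (card P) * ((\<Prod>B\<in>P. m B) * m (V - C)))"
    by (simp add: cumulant_of_moments_def w_def sum_distrib_left sum_distrib_right mult_ac)
  also have "\<dots> = (\<Sum>(C, P)\<in>(SIGMA C:{C. x \<in> C \<and> C \<subset> V}. ?\<Pi> C). w (card P) * ((\<Prod>B\<in>P. m B) * m (V - C)))"
    using finS fin\<Pi> by (intro sum.Sigma) auto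
  also have "\<dots> = (\<Sum>(P, D)\<in>(SIGMA P:?\<Pi> V. {D \<in> P. x \<notin> D}). w (card P - 1) * (\<Prod>B\<in>P. m B))"
  proof (rule sum.reindex_bij_witness[of _ "\<lambda>(P, D). (V - D, P - {D})" "\<lambda>(C, P). (insert (V - C) P, V - C)"])
    fix p assume "p \<in> (SIGMA C:{C. x \<in> C \<and> C \<subset> V}. ?\<Pi> C)"
    then obtain C P where p: "p = (C, P)" "x \<in> C" "C \<subset> V" "partition_on C P" by auto
    have UP: "\<Union>P = C" using p(4) by (simp add: partition_on_def)
    have notin: "V - C \<notin> P" using UP p(3) by blast
    have "partition_on V (insert (V - C) P)"
    proof (subst partition_on_insert)
      show "disjnt (V - C) (\<Union>P)" using UP by (auto simp: disjnt_def)
      have "V - (V - C) = C" using p(3) by blast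
      then show "partition_on (V - (V - C)) P \<and> V - C \<subseteq> V \<and> V - C \<noteq> {}" using p by auto
    qed
    then show "(case p of (C, P) \<Rightarrow> (insert (V - C) P, V - C)) \<in> (SIGMA P:?\<Pi> V. {D \<in> P. x \<notin> D})"
      using p by auto
    have "V - (V - C) = C" using p(3) by blast
    then show "(case (case p of (C, P) \<Rightarrow> (insert (V - C) P, V - C)) of (P, D) \<Rightarrow> (V - D, P - {D})) = p"
      using p notin by simp
    have "finite P" using finite_elements[OF finite_subset[OF _ V] p(4)] p(3) by auto
    then show "(case (case p of (C, P) \<Rightarrow> (insert (V - C) P, V - C)) of (P, D) \<Rightarrow> w (card P - 1) * (\<Prod>B\<in>P. m B)) =
        (case p of (C, P) \<Rightarrow> w (card P) * ((\<Prod>B\<in>P. m B) * m (V - C)))"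
      using notin p by (simp add: mult_ac)
  next
    fix q assume "q \<in> (SIGMA P:?\<Pi> V. {D \<in> P. x \<notin> D})"
    then obtain P D where q: "q = (P, D)" "partition_on V P" "D \<in> P" "x \<notin> D" by auto
    have DV: "D \<subseteq> V" "D \<noteq> {}" using q by (auto simp: partition_on_def)
    have ins: "insert D (P - {D}) = P" using q by blast
    have "disjnt D (\<Union>(P - {D}))"
      using q(2,3) unfolding partition_on_def disjoint_def disjnt_def by blast
    then have "partition_on (V - D) (P - {D})"
      using partition_on_insert[of D "P - {D}" V] q(2) ins by simp
    then show "(case q of (P, D) \<Rightarrow> (V - D, P - {D})) \<in> (SIGMA C:{C. x \<in> C \<and> C \<subset> V}. ?\<Pi> C)"
      using q x DV by auto
    have "V - (V - D) = D" using DV by blast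
    then show "(case (case q of (P, D) \<Rightarrow> (V - D, P - {D})) of (C, P) \<Rightarrow> (insert (V - C) P, V - C)) = q"
      using q ins by simp
  qed
  also have "\<dots> = (\<Sum>P\<in>?\<Pi> V. \<Sum>D | D \<in> P \<and> x \<notin> D. w (card P - 1) * (\<Prod>B\<in>P. m B))"
    using fin\<Pi>[OF order.refl] finP by (intro sum.Sigma[symmetric]) auto
  also have "\<dots> = (\<Sum>P\<in>?\<Pi> V. real (card P - 1) * w (card P - 1) * (\<Prod>B\<in>P. m B))"
    using card_partition_blocks_avoiding[OF V _ x] by (intro sum.cong) auto
  finally have rest: "(\<Sum>C | x \<in> C \<and> C \<subset> V. cumulant_of_moments m C * m (V - C)) =
    (\<Sum>P\<in>?\<Pi> V. real (card P - 1) * w (card P - 1) * (\<Prod>B\<in>P. m B))" .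
  have "(\<Sum>C | x \<in> C \<and> C \<subseteq> V. cumulant_of_moments m C * m (V - C)) =
      cumulant_of_moments m V * m (V - V) + (\<Sum>C | x \<in> C \<and> C \<subset> V. cumulant_of_moments m C * m (V - C))"
    unfolding split using finS by (subst sum.insert) auto
  also have "\<dots> = (\<Sum>P\<in>?\<Pi> V. (w (card P) + real (card P - 1) * w (card P - 1)) * (\<Prod>B\<in>P. m B))"
    unfolding rest by (simp add: cumulant_of_moments_def w_def m1 sum.distrib distrib_right)
  also have "\<dots> = (\<Sum>P\<in>?\<Pi> V. if P = {V} then m V else 0)"
  proof (rule sum.cong[OF refl])
    fix P assume P: "P \<in> ?\<Pi> V"
    show "(w (card P) + real (card P - 1) * w (card P - 1)) * (\<Prod>B\<in>P. m B) = (if P = {V} then m V else 0)"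
    proof (cases "card P \<le> 1")
      case True
      moreover have "P \<noteq> {}" using P x by (auto simp: partition_on_def)
      ultimately have "card P = 1" using finP[OF P] by (metis One_nat_def card_0_eq le_Suc_eq le_zero_eq)
      then obtain D where "P = {D}" by (auto simp: card_1_singleton_iff)
      then have "P = {V}" using P by (simp add: partition_on_def)
      then show ?thesis by (simp add: w_def)
    next
      case False
      then obtain k where k: "card P = Suc (Suc k)" by (metis One_nat_def Suc_le_D not_less_eq_eq)
      have "P \<noteq> {V}" using k by auto
      moreover have "w (card P) + real (card P - 1) * w (card P - 1) = 0"
        unfolding k by (simp add: w_def)
      ultimately show ?thesis by simp
    qed
  qed
  also have "\<dots> = m V"
  proof -
    have "partition_on V {V}" using x by (auto simp: partition_on_def)
    then show ?thesis using fin\<Pi>[OF order.refl] by (simp add: sum.delta)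
  qed
  finally show ?thesis .
qed

lemma cumulant_of_moments_eqI:
  assumes "finite V" "V \<noteq> {}" "m {} = 1"
    and rec: "\<And>B x. B \<subseteq> V \<Longrightarrow> x \<in> B \<Longrightarrow> (\<Sum>C | x \<in> C \<and> C \<subseteq> B. k C * m (B - C)) = m B"
  shows "cumulant_of_moments m V = k V"
proof -
  have "cumulant_of_moments m B = k B" if "B \<subseteq> V" "B \<noteq> {}" for B
    using that
  proof (induction "card B" arbitrary: B rule: less_induct)
    case less
    have finB: "finite B" using less.prems assms(1) finite_subset by blast
    obtain x where x: "x \<in> B" using less.prems by blast
    have fin: "finite {C. x \<in> C \<and> C \<subset> B}" using finB by (auto intro: finite_subset[of _ "Pow B"])
    have split: "{C. x \<in> C \<and> C \<subseteq> B} = insert B {C. x \<in> C \<and> C \<subset> B}" using x by auto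
    have "cumulant_of_moments m C = k C" if "C \<in> {C. x \<in> C \<and> C \<subset> B}" for C
      using that less.prems finB by (intro less.hyps) (auto intro: psubset_card_mono)
    then have "(\<Sum>C | x \<in> C \<and> C \<subset> B. cumulant_of_moments m C * m (B - C)) = (\<Sum>C | x \<in> C \<and> C \<subset> B. k C * m (B - C))"
      by (intro sum.cong) auto
    moreover have "(\<Sum>C | x \<in> C \<and> C \<subseteq> B. cumulant_of_moments m C * m (B - C)) = (\<Sum>C | x \<in> C \<and> C \<subseteq> B. k C * m (B - C))"
      using cumulant_recursion[of B x m] rec[OF less.prems(1) x] finB x assms(3) by simp
    ultimately show ?case unfolding split using fin assms(3) by simp
  qed
  then show ?thesis using assms(2) by blast
qed

section \<open>Connected permutations\<close>

text \<open>Connectedness of the graph of \<open>\<tau>\<close> is expressed by site sets that \<open>\<tau>\<close> neither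
  enters nor leaves, which avoids paths.\<close>

definition preserves_sites :: "dedge set \<Rightarrow> (dedge \<Rightarrow> dedge) \<Rightarrow> point set \<Rightarrow> bool" where
  "preserves_sites E \<tau> X \<longleftrightarrow> (\<forall>f\<in>E. fst f \<in> X \<longleftrightarrow> fst (\<tau> f) \<in> X)"

text \<open>The smallest such set containing \<open>x\<close>.\<close>

definition is_component :: "point set \<Rightarrow> point \<Rightarrow> dedge set \<Rightarrow> (dedge \<Rightarrow> dedge) \<Rightarrow> point set \<Rightarrow> bool" where
  "is_component B x E \<tau> C \<longleftrightarrow> x \<in> C \<and> C \<subseteq> B \<and> preserves_sites E \<tau> C \<and>
     (\<forall>X\<subseteq>C. x \<in> X \<and> preserves_sites E \<tau> X \<longrightarrow> X = C)"

lemma multi_adj_perm_graph: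
  assumes "\<tau> permutes E"
  shows "(y, z) \<in> multi_adj (perm_graph_edges E \<tau>) (\<lambda>d. fst ` d) \<longleftrightarrow>
    y \<noteq> z \<and> (\<exists>f\<in>E. (fst f = y \<and> fst (\<tau> f) = z) \<or> (fst f = z \<and> fst (\<tau> f) = y))"
proof
  assume "(y, z) \<in> multi_adj (perm_graph_edges E \<tau>) (\<lambda>d. fst ` d)"
  then obtain f f' where f: "f \<in> E" "f' \<in> E" "fst f \<noteq> fst f'" "\<tau> f = f' \<or> \<tau> f' = f" "{fst f, fst f'} = {y, z}"
    by (auto simp: multi_adj_def perm_graph_edges_def)
  then show "y \<noteq> z \<and> (\<exists>f\<in>E. (fst f = y \<and> fst (\<tau> f) = z) \<or> (fst f = z \<and> fst (\<tau> f) = y))"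
    unfolding doubleton_eq_iff by metis
next
  assume yz: "y \<noteq> z \<and> (\<exists>f\<in>E. (fst f = y \<and> fst (\<tau> f) = z) \<or> (fst f = z \<and> fst (\<tau> f) = y))"
  then obtain f where f: "f \<in> E" "(fst f = y \<and> fst (\<tau> f) = z) \<or> (fst f = z \<and> fst (\<tau> f) = y)" by blast
  have "\<tau> f \<in> E" using f(1) permutes_in_image[OF assms] by simp
  moreover have "fst f \<noteq> fst (\<tau> f)" using f(2) yz by auto
  ultimately have "{f, \<tau> f} \<in> perm_graph_edges E \<tau>"
    unfolding perm_graph_edges_def using f(1) by (intro CollectI exI[of _ f] exI[of _ "\<tau> f"]) simp
  moreover have "fst ` {f, \<tau> f} = {y, z}" using f(2) by auto
  ultimately show "(y, z) \<in> multi_adj (perm_graph_edges E \<tau>) (\<lambda>d. fst ` d)"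
    unfolding multi_adj_def by blast
qed

lemma fst_edges_from: "f \<in> edges_from V \<Longrightarrow> fst f \<in> V"
  by (auto simp: edges_from_def)

lemma fst_in_sites:
  assumes "E \<subseteq> edges_from C" "f \<in> E"
  shows "fst f \<in> C" "\<tau> permutes E \<Longrightarrow> fst (\<tau> f) \<in> C"
  using assms permutes_in_image[of \<tau> E f] by (blast intro: fst_edges_from)+

text \<open>A path starting in an invariant set stays in it; the sites reached from \<open>x\<close> form an invariant set.\<close>

lemma multi_connected_iff_component:
  assumes \<tau>: "\<tau> permutes E" and E: "E \<subseteq> edges_from C" and x: "x \<in> C"
  shows "multi_connected C (perm_graph_edges E \<tau>) (\<lambda>d. fst ` d) \<longleftrightarrow> is_component C x E \<tau> C"
proof -
  let ?r = "multi_adj (perm_graph_edges E \<tau>) (\<lambda>d. fst ` d) \<inter> C \<times> C"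
  have tl: "fst f \<in> C" "fst (\<tau> f) \<in> C" if "f \<in> E" for f
    using fst_in_sites[OF E that] \<tau> by auto
  show ?thesis
  proof
    assume conn: "multi_connected C (perm_graph_edges E \<tau>) (\<lambda>d. fst ` d)"
    have "X = C" if X: "X \<subseteq> C" "x \<in> X" "preserves_sites E \<tau> X" for X
    proof -
      have "y \<in> X" if "(x, y) \<in> ?r\<^sup>*" for y
        using that
      proof (induction rule: rtrancl_induct)
        case (step y z)
        then have "\<exists>f\<in>E. (fst f = y \<and> fst (\<tau> f) = z) \<or> (fst f = z \<and> fst (\<tau> f) = y)"
          using multi_adj_perm_graph[OF \<tau>] by blast
        then show ?case using X(3) step.IH unfolding preserves_sites_def by metis
      qed (rule X(2))
      then show "X = C" using conn x X(1) unfolding multi_connected_def by blast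
    qed
    moreover have "preserves_sites E \<tau> C" using tl by (simp add: preserves_sites_def)
    ultimately show "is_component C x E \<tau> C" using x by (simp add: is_component_def)
  next
    assume comp: "is_component C x E \<tau> C"
    define X where "X = {y \<in> C. (x, y) \<in> ?r\<^sup>*}"
    have sym: "sym ?r" by (auto simp: sym_def multi_adj_def insert_commute)
    have step: "z \<in> X" if "y \<in> X" "z \<in> C" "(y, z) \<in> ?r" for y z
      using that unfolding X_def by (blast intro: rtrancl_into_rtrancl)
    have edge: "(fst f, fst (\<tau> f)) \<in> ?r" "(fst (\<tau> f), fst f) \<in> ?r" if "f \<in> E" "fst f \<noteq> fst (\<tau> f)" for f
    proof -
      have "(fst f, fst (\<tau> f)) \<in> multi_adj (perm_graph_edges E \<tau>) (\<lambda>d. fst ` d)"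
        unfolding multi_adj_perm_graph[OF \<tau>] using that by blast
      then show "(fst f, fst (\<tau> f)) \<in> ?r" using tl[OF that(1)] by simp
      then show "(fst (\<tau> f), fst f) \<in> ?r" by (rule symD[OF sym])
    qed
    have "preserves_sites E \<tau> X"
      unfolding preserves_sites_def
    proof
      fix f assume f: "f \<in> E"
      show "fst f \<in> X \<longleftrightarrow> fst (\<tau> f) \<in> X"
        using step[of "fst f" "fst (\<tau> f)"] step[of "fst (\<tau> f)" "fst f"] edge[OF f] tl[OF f]
        by (cases "fst f = fst (\<tau> f)") (simp, blast)
    qed
    moreover have "X \<subseteq> C" "x \<in> X" using x by (auto simp: X_def)
    ultimately have "X = C" using comp unfolding is_component_def by blast
    then have xy: "(x, y) \<in> ?r\<^sup>*" if "y \<in> C" for y using that by (auto simp: X_def)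
    have yx: "(y, x) \<in> ?r\<^sup>*" if "y \<in> C" for y
      using symD[OF sym_rtrancl[OF sym] xy[OF that]] .
    show "multi_connected C (perm_graph_edges E \<tau>) (\<lambda>d. fst ` d)"
      unfolding multi_connected_def using rtrancl_trans[OF yx xy] by blast
  qed
qed

lemma ex1_component:
  assumes "x \<in> B" "E \<subseteq> edges_from B" "\<tau> permutes E"
  shows "\<exists>!C. is_component B x E \<tau> C"
proof (rule ex_ex1I)
  define C where "C = \<Inter>{X. X \<subseteq> B \<and> x \<in> X \<and> preserves_sites E \<tau> X}"
  have "fst f \<in> B" "fst (\<tau> f) \<in> B" if "f \<in> E" for f
    using fst_in_sites[OF assms(2) that] assms(3) by auto
  then have "preserves_sites E \<tau> B" by (simp add: preserves_sites_def)
  then have B: "B \<in> {X. X \<subseteq> B \<and> x \<in> X \<and> preserves_sites E \<tau> X}" using assms(1) by simp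
  have "preserves_sites E \<tau> C" unfolding C_def preserves_sites_def by blast
  moreover have "x \<in> C" "C \<subseteq> B" using B by (auto simp: C_def)
  moreover have "X = C" if "X \<subseteq> C" "x \<in> X" "preserves_sites E \<tau> X" for X
  proof
    show "C \<subseteq> X" unfolding C_def by (rule Inter_lower) (use that \<open>C \<subseteq> B\<close> in auto)
  qed (rule that(1))
  ultimately show "\<exists>C. is_component B x E \<tau> C" unfolding is_component_def by blast
next
  fix C C' assume C: "is_component B x E \<tau> C" and C': "is_component B x E \<tau> C'"
  have "preserves_sites E \<tau> (C \<inter> C')" using C C' by (simp add: is_component_def preserves_sites_def)
  then have "C \<inter> C' = C" "C \<inter> C' = C'"
    using C C' unfolding is_component_def by (metis Int_iff Int_lower1, metis Int_iff Int_lower2)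
  then show "C = C'" by simp
qed

definition perm_weight :: "(dedge \<Rightarrow> dedge \<Rightarrow> real) \<Rightarrow> dedge set \<Rightarrow> (dedge \<Rightarrow> dedge) \<Rightarrow> real" where
  "perm_weight M E \<tau> = of_int (sign \<tau>) * (\<Prod>f\<in>E. M f (\<tau> f))"

definition site_weight :: "(dedge set \<Rightarrow> real) \<Rightarrow> point set \<Rightarrow> dedge set \<Rightarrow> real" where
  "site_weight a B E = (\<Prod>v\<in>B. a (edges_at E v))"

definition det_moment :: "(dedge set \<Rightarrow> real) \<Rightarrow> (dedge \<Rightarrow> dedge \<Rightarrow> real) \<Rightarrow> point set \<Rightarrow> real" where
  "det_moment a M B = (\<Sum>E\<in>Pow (edges_from B). site_weight a B E * det_on E M)"

definition det_cumulant :: "(dedge set \<Rightarrow> real) \<Rightarrow> (dedge \<Rightarrow> dedge \<Rightarrow> real) \<Rightarrow> point set \<Rightarrow> real" where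
  "det_cumulant a M B = (\<Sum>E\<in>Pow (edges_from B). site_weight a B E * (\<Sum>\<tau>\<in>connected_perms B E. perm_weight M E \<tau>))"

lemma edges_from_eq: "edges_from V = (\<Union>v\<in>V. (\<lambda>e. (v, v + e)) ` unit_dirs)"
  unfolding edges_from_def by blast

lemma finite_edges_from: "finite V \<Longrightarrow> finite (edges_from V)"
  by (simp add: edges_from_eq unit_dirs_def)

lemma edges_from_subset_iff: "f \<in> edges_from B \<Longrightarrow> C \<subseteq> B \<Longrightarrow> f \<in> edges_from C \<longleftrightarrow> fst f \<in> C"
  by (auto simp: edges_from_def)

lemma perm_split:
  assumes "\<tau> permutes E" "E1 \<subseteq> E" "\<And>f. f \<in> E1 \<Longrightarrow> \<tau> f \<in> E1" "finite E"
  shows "perm_restrict \<tau> E1 permutes E1"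
proof (rule bij_imp_permutes)
  have "inj_on \<tau> E1" using permutes_inj[OF assms(1)] by (rule inj_on_subset) simp
  moreover have "finite E1" using assms(2,4) finite_subset by blast
  moreover have "\<tau> ` E1 \<subseteq> E1" using assms(3) by blast
  ultimately have "bij_betw \<tau> E1 E1"
    using endo_inj_surj unfolding bij_betw_def by blast
  then show "bij_betw (perm_restrict \<tau> E1) E1 E1"
    by (rule bij_betw_cong[THEN iffD1, rotated]) (simp add: perm_restrict_def)
qed (simp add: perm_restrict_def)

text \<open>A permutation respecting \<open>C\<close> is the product of a permutation of the edges over \<open>C\<close> and
  one of the edges over \<open>B - C\<close>. That \<open>C\<close> is the component of \<open>x\<close> is a
  condition on the first factor only.\<close>

lemma component_decomposition:
  assumes finB: "finite B" and x: "x \<in> C" and CB: "C \<subseteq> B"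
  shows "bij_betw (\<lambda>((E1, \<tau>1), (E2, \<tau>2)). (E1 \<union> E2, \<tau>1 \<circ> \<tau>2))
    ((SIGMA E1:Pow (edges_from C). connected_perms C E1) \<times>
     (SIGMA E2:Pow (edges_from (B - C)). {\<tau>. \<tau> permutes E2}))
    {(E, \<tau>). E \<subseteq> edges_from B \<and> \<tau> permutes E \<and> is_component B x E \<tau> C}"
    (is "bij_betw ?j ?S ?T")
proof -
  have comp_app: "(\<tau>1 \<circ> \<tau>2) f = (if f \<in> E1 then \<tau>1 f else \<tau>2 f)"
    if "\<tau>1 permutes E1" "\<tau>2 permutes E2" "E1 \<inter> E2 = {}" for \<tau>1 \<tau>2 :: "dedge \<Rightarrow> dedge" and E1 E2 f
  proof (cases "f \<in> E2")
    case True
    then have "\<tau>2 f \<in> E2" "f \<notin> E1" using permutes_in_image[OF that(2)] that(3) by auto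
    moreover have "\<tau>2 f \<notin> E1" using \<open>\<tau>2 f \<in> E2\<close> that(3) by blast
    ultimately show ?thesis using permutes_not_in[OF that(1)] by simp
  next
    case False
    then show ?thesis using permutes_not_in[OF that(2)] permutes_not_in[OF that(1)] by simp
  qed
  let ?i = "\<lambda>(E, \<tau>). ((E \<inter> edges_from C, perm_restrict \<tau> (E \<inter> edges_from C)),
      (E - edges_from C, perm_restrict \<tau> (E - edges_from C)))"
  show ?thesis
  proof (rule bij_betwI[of _ _ _ ?i])
    show "?j \<in> ?S \<rightarrow> ?T"
    proof
      fix p assume "p \<in> ?S"
      then obtain E1 \<tau>1 E2 \<tau>2 where p: "p = ((E1, \<tau>1), (E2, \<tau>2))" "E1 \<subseteq> edges_from C" "\<tau>1 \<in> connected_perms C E1"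
        "E2 \<subseteq> edges_from (B - C)" "\<tau>2 permutes E2" by auto
      have \<tau>1: "\<tau>1 permutes E1" using p(3) by (simp add: connected_perms_def)
      have disj: "E1 \<inter> E2 = {}" using fst_in_sites(1)[OF p(2)] fst_in_sites(1)[OF p(4)] by blast
      note app = comp_app[OF \<tau>1 p(5) disj]
      have perm: "\<tau>1 \<circ> \<tau>2 permutes E1 \<union> E2"
        using \<tau>1 p(5) by (intro permutes_compose) (auto intro: permutes_subset)
      have in1: "fst f \<in> C" "fst (\<tau>1 f) \<in> C" if "f \<in> E1" for f
        using fst_in_sites[OF p(2) that] \<tau>1 by auto
      have in2: "fst f \<notin> C" "fst (\<tau>2 f) \<notin> C" if "f \<in> E2" for f
        using fst_in_sites[OF p(4) that] p(5) by auto
      have resp: "preserves_sites (E1 \<union> E2) (\<tau>1 \<circ> \<tau>2) X \<longleftrightarrow> preserves_sites E1 \<tau>1 X" if "X \<subseteq> C" for X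
        using that in2 disj unfolding preserves_sites_def app by auto
      have "is_component C x E1 \<tau>1 C"
        using p(3) multi_connected_iff_component[OF \<tau>1 p(2) x] by (simp add: connected_perms_def)
      then have "is_component B x (E1 \<union> E2) (\<tau>1 \<circ> \<tau>2) C"
        using CB resp unfolding is_component_def by auto
      moreover have "edges_from C \<subseteq> edges_from B" "edges_from (B - C) \<subseteq> edges_from B"
        using CB by (auto simp: edges_from_def)
      then have "E1 \<union> E2 \<subseteq> edges_from B" using p(2,4) by blast
      ultimately show "?j p \<in> ?T" using perm p(1) by simp
    qed
    show "?i \<in> ?T \<rightarrow> ?S"
    proof
      fix q assume "q \<in> ?T"
      then obtain E \<tau> where q: "q = (E, \<tau>)" "E \<subseteq> edges_from B" "\<tau> permutes E" "is_component B x E \<tau> C" by auto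
      let ?E1 = "E \<inter> edges_from C" and ?E2 = "E - edges_from C"
      have finE: "finite E" using q(2) finite_edges_from[OF finB] finite_subset by blast
      have mem: "f \<in> edges_from C \<longleftrightarrow> fst f \<in> C" if "f \<in> E" for f
        using edges_from_subset_iff[OF _ CB] q(2) that by blast
      have \<tau>E: "\<tau> f \<in> E \<longleftrightarrow> f \<in> E" for f by (rule permutes_in_image[OF q(3)])
      have resp: "fst f \<in> C \<longleftrightarrow> fst (\<tau> f) \<in> C" if "f \<in> E" for f
        using q(4) that by (auto simp: is_component_def preserves_sites_def)
      have E1: "\<tau> f \<in> ?E1" if "f \<in> ?E1" for f
        using that mem[of f] mem[of "\<tau> f"] resp[of f] \<tau>E[of f] by blast
      have E2: "\<tau> f \<in> ?E2" if "f \<in> ?E2" for f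
        using that mem[of f] mem[of "\<tau> f"] resp[of f] \<tau>E[of f] by blast
      have p1: "perm_restrict \<tau> ?E1 permutes ?E1" by (rule perm_split[OF q(3) _ E1 finE]) auto
      have p2: "perm_restrict \<tau> ?E2 permutes ?E2" by (rule perm_split[OF q(3) _ E2 finE]) auto
      have "is_component C x ?E1 (perm_restrict \<tau> ?E1) C"
        unfolding is_component_def
      proof (intro conjI allI impI)
        show "preserves_sites ?E1 (perm_restrict \<tau> ?E1) C"
          unfolding preserves_sites_def
        proof
          fix f assume "f \<in> ?E1"
          then show "fst f \<in> C \<longleftrightarrow> fst (perm_restrict \<tau> ?E1 f) \<in> C"
            using resp[of f] by (simp add: perm_restrict_def)
        qed
        fix X assume X: "X \<subseteq> C" "x \<in> X \<and> preserves_sites ?E1 (perm_restrict \<tau> ?E1) X"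
        have "preserves_sites E \<tau> X"
          unfolding preserves_sites_def
        proof
          fix f assume f: "f \<in> E"
          show "fst f \<in> X \<longleftrightarrow> fst (\<tau> f) \<in> X"
          proof (cases "f \<in> ?E1")
            case True
            then have "fst f \<in> X \<longleftrightarrow> fst (perm_restrict \<tau> ?E1 f) \<in> X"
              using X(2) unfolding preserves_sites_def by blast
            then show ?thesis using True by (simp add: perm_restrict_def)
          next
            case False
            then have "fst f \<notin> C" "fst (\<tau> f) \<notin> C" using f mem[OF f] resp[OF f] by blast+
            then show ?thesis using X(1) by blast
          qed
        qed
        then show "X = C" using q(4) X unfolding is_component_def by blast
      qed (use x in auto)
      then have "perm_restrict \<tau> ?E1 \<in> connected_perms C ?E1"
        using p1 multi_connected_iff_component[OF p1 _ x] by (simp add: connected_perms_def)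
      moreover have "?E2 \<subseteq> edges_from (B - C)"
      proof
        fix f assume f: "f \<in> ?E2"
        then have "fst f \<in> B - C" using mem fst_in_sites(1)[OF q(2), of f] by blast
        then show "f \<in> edges_from (B - C)" using f q(2) edges_from_subset_iff[of f B "B - C"] by blast
      qed
      ultimately show "?i q \<in> ?S" using p2 q(1) by auto
    qed
    show "?i (?j p) = p" if "p \<in> ?S" for p
    proof -
      obtain E1 \<tau>1 E2 \<tau>2 where p: "p = ((E1, \<tau>1), (E2, \<tau>2))" "E1 \<subseteq> edges_from C" "\<tau>1 permutes E1"
        "E2 \<subseteq> edges_from (B - C)" "\<tau>2 permutes E2" using \<open>p \<in> ?S\<close> by (auto simp: connected_perms_def)
      have n: "E2 \<inter> edges_from C = {}" using p(4) by (auto simp: edges_from_def)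
      have e: "(E1 \<union> E2) \<inter> edges_from C = E1" "(E1 \<union> E2) - edges_from C = E2" using n p(2) by blast+
      have disj: "E1 \<inter> E2 = {}" using n p(2) by blast
      note app = comp_app[OF p(3,5) disj]
      have "perm_restrict (\<tau>1 \<circ> \<tau>2) E1 = \<tau>1" "perm_restrict (\<tau>1 \<circ> \<tau>2) E2 = \<tau>2"
        using app disj permutes_not_in[OF p(3)] permutes_not_in[OF p(5)]
        by (auto simp: perm_restrict_def fun_eq_iff)
      then show ?thesis using p(1) e by simp
    qed
    show "?j (?i q) = q" if "q \<in> ?T" for q
    proof -
      obtain E \<tau> where q: "q = (E, \<tau>)" "E \<subseteq> edges_from B" "\<tau> permutes E" "is_component B x E \<tau> C"
        using \<open>q \<in> ?T\<close> by auto
      have mem: "f \<in> edges_from C \<longleftrightarrow> fst f \<in> C" if "f \<in> E" for f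
        using edges_from_subset_iff[OF _ CB] q(2) that by blast
      have resp: "fst f \<in> C \<longleftrightarrow> fst (\<tau> f) \<in> C" if "f \<in> E" for f
        using q(4) that by (auto simp: is_component_def preserves_sites_def)
      have \<tau>E: "\<tau> f \<in> E \<longleftrightarrow> f \<in> E" for f by (rule permutes_in_image[OF q(3)])
      have "(perm_restrict \<tau> (E \<inter> edges_from C) \<circ> perm_restrict \<tau> (E - edges_from C)) f = \<tau> f" for f
        using permutes_not_in[OF q(3), of f] mem[of f] mem[of "\<tau> f"] resp[of f] \<tau>E[of f]
        by (auto simp: perm_restrict_def)
      moreover have "(E \<inter> edges_from C) \<union> (E - edges_from C) = E" by blast
      ultimately show ?thesis using q(1) by (simp add: fun_eq_iff)
    qed
  qed
qed

lemma det_moment_eq_sum: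
  assumes "finite B"
  shows "det_moment a M B = (\<Sum>(E, \<tau>)\<in>(SIGMA E:Pow (edges_from B). {\<tau>. \<tau> permutes E}). site_weight a B E * perm_weight M E \<tau>)"
proof -
  have "finite E" if "E \<in> Pow (edges_from B)" for E
    using that finite_edges_from[OF assms] finite_subset by blast
  then have "(\<Sum>E\<in>Pow (edges_from B). \<Sum>\<tau> | \<tau> permutes E. site_weight a B E * perm_weight M E \<tau>) =
      (\<Sum>(E, \<tau>)\<in>(SIGMA E:Pow (edges_from B). {\<tau>. \<tau> permutes E}). site_weight a B E * perm_weight M E \<tau>)"
    using finite_edges_from[OF assms] by (intro sum.Sigma) (auto intro: finite_permutations)
  then show ?thesis
    by (simp add: det_moment_def det_on_def perm_weight_def sum_distrib_left)
qed

lemma finite_connected_perms: "finite E \<Longrightarrow> finite (connected_perms B E)"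
  by (rule finite_subset[OF _ finite_permutations[of E]]) (auto simp: connected_perms_def)

lemma det_cumulant_eq_sum:
  assumes "finite B"
  shows "det_cumulant a M B = (\<Sum>(E, \<tau>)\<in>(SIGMA E:Pow (edges_from B). connected_perms B E). site_weight a B E * perm_weight M E \<tau>)"
proof -
  have "finite E" if "E \<in> Pow (edges_from B)" for E
    using that finite_edges_from[OF assms] finite_subset by blast
  then have "(\<Sum>E\<in>Pow (edges_from B). \<Sum>\<tau>\<in>connected_perms B E. site_weight a B E * perm_weight M E \<tau>) =
      (\<Sum>(E, \<tau>)\<in>(SIGMA E:Pow (edges_from B). connected_perms B E). site_weight a B E * perm_weight M E \<tau>)"
    using finite_edges_from[OF assms] by (intro sum.Sigma) (auto intro: finite_connected_perms)
  then show ?thesis by (simp add: det_cumulant_def sum_distrib_left)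
qed

lemma weight_split:
  assumes "finite B" "C \<subseteq> B" "E1 \<subseteq> edges_from C" "E2 \<subseteq> edges_from (B - C)" "\<tau>1 permutes E1" "\<tau>2 permutes E2"
  shows "site_weight a B (E1 \<union> E2) * perm_weight M (E1 \<union> E2) (\<tau>1 \<circ> \<tau>2) =
    (site_weight a C E1 * perm_weight M E1 \<tau>1) * (site_weight a (B - C) E2 * perm_weight M E2 \<tau>2)"
proof -
  have "finite C" by (rule finite_subset[OF assms(2,1)])
  then have fin: "finite E1" "finite E2"
    using finite_subset[OF assms(3) finite_edges_from] finite_subset[OF assms(4) finite_edges_from] assms(1) by simp_all
  have disj: "E1 \<inter> E2 = {}" using fst_in_sites(1)[OF assms(3)] fst_in_sites(1)[OF assms(4)] by blast
  have "site_weight a B (E1 \<union> E2) = (\<Prod>v\<in>C. a (edges_at (E1 \<union> E2) v)) * (\<Prod>v\<in>B - C. a (edges_at (E1 \<union> E2) v))"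
    unfolding site_weight_def using prod.subset_diff[OF assms(2,1)] by (simp add: mult.commute)
  also have "(\<Prod>v\<in>C. a (edges_at (E1 \<union> E2) v)) = site_weight a C E1"
    unfolding site_weight_def
  proof (intro prod.cong refl arg_cong[where f=a])
    fix v assume "v \<in> C"
    then show "edges_at (E1 \<union> E2) v = edges_at E1 v"
      using assms(4) by (auto simp: edges_at_def edges_from_def)
  qed
  also have "(\<Prod>v\<in>B - C. a (edges_at (E1 \<union> E2) v)) = site_weight a (B - C) E2"
    unfolding site_weight_def
  proof (intro prod.cong refl arg_cong[where f=a])
    fix v assume "v \<in> B - C"
    then show "edges_at (E1 \<union> E2) v = edges_at E2 v"
      using assms(3) by (auto simp: edges_at_def edges_from_def)
  qed
  finally have site: "site_weight a B (E1 \<union> E2) = site_weight a C E1 * site_weight a (B - C) E2" .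
  have "(\<Prod>f\<in>E1 \<union> E2. M f ((\<tau>1 \<circ> \<tau>2) f)) = (\<Prod>f\<in>E1. M f ((\<tau>1 \<circ> \<tau>2) f)) * (\<Prod>f\<in>E2. M f ((\<tau>1 \<circ> \<tau>2) f))"
    using fin disj by (intro prod.union_disjoint) auto
  also have "(\<Prod>f\<in>E1. M f ((\<tau>1 \<circ> \<tau>2) f)) = (\<Prod>f\<in>E1. M f (\<tau>1 f))"
  proof (rule prod.cong[OF refl])
    fix f assume "f \<in> E1"
    then have "\<tau>2 f = f" using disj permutes_not_in[OF assms(6)] by blast
    then show "M f ((\<tau>1 \<circ> \<tau>2) f) = M f (\<tau>1 f)" by simp
  qed
  also have "(\<Prod>f\<in>E2. M f ((\<tau>1 \<circ> \<tau>2) f)) = (\<Prod>f\<in>E2. M f (\<tau>2 f))"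
  proof (rule prod.cong[OF refl])
    fix f assume "f \<in> E2"
    then have "\<tau>2 f \<notin> E1" using disj permutes_in_image[OF assms(6)] by blast
    then have "\<tau>1 (\<tau>2 f) = \<tau>2 f" by (rule permutes_not_in[OF assms(5)])
    then show "M f ((\<tau>1 \<circ> \<tau>2) f) = M f (\<tau>2 f)" by simp
  qed
  finally have "(\<Prod>f\<in>E1 \<union> E2. M f ((\<tau>1 \<circ> \<tau>2) f)) = (\<Prod>f\<in>E1. M f (\<tau>1 f)) * (\<Prod>f\<in>E2. M f (\<tau>2 f))" .
  moreover have "permutation \<tau>1" "permutation \<tau>2" using assms(5,6) fin by (auto simp: permutation_permutes)
  then have "sign (\<tau>1 \<circ> \<tau>2) = sign \<tau>1 * sign \<tau>2" by (rule sign_compose)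
  ultimately show ?thesis by (simp add: site perm_weight_def)
qed

text \<open>Group the edge sets and permutations by the component of \<open>x\<close>; the weights are multiplicative.\<close>

lemma det_moment_recursion:
  assumes finB: "finite B" and x: "x \<in> B"
  shows "(\<Sum>C | x \<in> C \<and> C \<subseteq> B. det_cumulant a M C * det_moment a M (B - C)) = det_moment a M B"
proof -
  let ?w = "\<lambda>B (E, \<tau>). site_weight a B E * perm_weight M E \<tau>"
  let ?all = "SIGMA E:Pow (edges_from B). {\<tau>. \<tau> permutes E}"
  define comp where "comp = (\<lambda>(E, \<tau>). THE C. is_component B x E \<tau> C)"
  have comp: "comp (E, \<tau>) = C \<longleftrightarrow> is_component B x E \<tau> C" if "(E, \<tau>) \<in> ?all" for E \<tau> C
  proof -
    have ex1: "\<exists>!C. is_component B x E \<tau> C" using that x by (intro ex1_component) auto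
    show ?thesis using theI'[OF ex1] ex1 by (auto simp: comp_def)
  qed
  have finE: "finite E" if "E \<subseteq> edges_from B" for E
    using that finite_edges_from[OF finB] finite_subset by blast
  have fin: "finite ?all"
    using finite_edges_from[OF finB] finE by (intro finite_SigmaI) (auto intro: finite_permutations)
  have "det_moment a M B = sum (?w B) ?all" using det_moment_eq_sum[OF finB] by simp
  also have "\<dots> = (\<Sum>C | x \<in> C \<and> C \<subseteq> B. sum (?w B) {p \<in> ?all. comp p = C})"
  proof (rule sum.group[symmetric, OF fin])
    show "finite {C. x \<in> C \<and> C \<subseteq> B}" using finB by (auto intro: finite_subset[of _ "Pow B"])
    show "comp ` ?all \<subseteq> {C. x \<in> C \<and> C \<subseteq> B}"
    proof
      fix C assume "C \<in> comp ` ?all"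
      then obtain E \<tau> where "(E, \<tau>) \<in> ?all" "comp (E, \<tau>) = C" by auto
      then show "C \<in> {C. x \<in> C \<and> C \<subseteq> B}" using comp by (auto simp: is_component_def)
    qed
  qed
  also have "\<dots> = (\<Sum>C | x \<in> C \<and> C \<subseteq> B. det_cumulant a M C * det_moment a M (B - C))"
  proof (rule sum.cong[OF refl])
    fix C assume "C \<in> {C. x \<in> C \<and> C \<subseteq> B}"
    then have C: "x \<in> C" "C \<subseteq> B" by auto
    let ?S1 = "SIGMA E1:Pow (edges_from C). connected_perms C E1"
    let ?S2 = "SIGMA E2:Pow (edges_from (B - C)). {\<tau>. \<tau> permutes E2}"
    have "{p \<in> ?all. comp p = C} = {(E, \<tau>). E \<subseteq> edges_from B \<and> \<tau> permutes E \<and> is_component B x E \<tau> C}"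
      using comp by auto
    then have "sum (?w B) {p \<in> ?all. comp p = C} =
        sum (?w B) {(E, \<tau>). E \<subseteq> edges_from B \<and> \<tau> permutes E \<and> is_component B x E \<tau> C}" by (rule arg_cong)
    also have "\<dots> =
        (\<Sum>p\<in>?S1 \<times> ?S2. ?w B ((\<lambda>((E1, \<tau>1), (E2, \<tau>2)). (E1 \<union> E2, \<tau>1 \<circ> \<tau>2)) p))"
      using sum.reindex_bij_betw[OF component_decomposition[OF finB C], of "?w B"] by (rule sym)
    also have "\<dots> = (\<Sum>(p, q)\<in>?S1 \<times> ?S2. ?w C p * ?w (B - C) q)"
    proof (rule sum.cong[OF refl])
      fix r assume "r \<in> ?S1 \<times> ?S2"
      then obtain E1 \<tau>1 E2 \<tau>2 where r: "r = ((E1, \<tau>1), (E2, \<tau>2))" "E1 \<subseteq> edges_from C" "\<tau>1 permutes E1"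
        "E2 \<subseteq> edges_from (B - C)" "\<tau>2 permutes E2" by (auto simp: connected_perms_def)
      show "?w B ((\<lambda>((E1, \<tau>1), (E2, \<tau>2)). (E1 \<union> E2, \<tau>1 \<circ> \<tau>2)) r) = (case r of (p, q) \<Rightarrow> ?w C p * ?w (B - C) q)"
        unfolding r(1) prod.case by (rule weight_split[OF finB C(2) r(2,4,3,5)])
    qed
    also have "\<dots> = sum (?w C) ?S1 * sum (?w (B - C)) ?S2"
      by (simp only: sum_product sum.cartesian_product)
    also have "\<dots> = det_cumulant a M C * det_moment a M (B - C)"
      using det_cumulant_eq_sum[OF finite_subset[OF C(2) finB], of a M]
        det_moment_eq_sum[OF finite_Diff[OF finB], of a M C] by simp
    finally show "sum (?w B) {p \<in> ?all. comp p = C} = det_cumulant a M C * det_moment a M (B - C)" .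
  qed
  finally show ?thesis by simp
qed

text \<open>Connected sums satisfy the recursion that characterises cumulants.\<close>

theorem cumulant_det_moment:
  assumes "finite V" "V \<noteq> {}"
  shows "cumulant_of_moments (det_moment a M) V = det_cumulant a M V"
proof (rule cumulant_of_moments_eqI[OF assms])
  have "edges_from {} = {}" by (simp add: edges_from_def)
  then show "det_moment a M {} = 1" by (simp add: det_moment_def site_weight_def)
  fix B x assume "B \<subseteq> V" "x \<in> B"
  then show "(\<Sum>C | x \<in> C \<and> C \<subseteq> B. det_cumulant a M C * det_moment a M (B - C)) = det_moment a M B"
    using assms(1) finite_subset by (intro det_moment_recursion) auto
qed

section \<open>Cyclic permutations\<close>

text \<open>The orbit of \<open>x\<close> is the smallest invariant set containing \<open>x\<close>.\<close>

lemma cyclic_on_iff_invariant: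
  assumes \<sigma>: "\<sigma> permutes V" and V: "finite V" and x: "x \<in> V"
  shows "cyclic_on \<sigma> V \<longleftrightarrow> (\<forall>X\<subseteq>V. x \<in> X \<and> (\<forall>v\<in>V. v \<in> X \<longleftrightarrow> \<sigma> v \<in> X) \<longrightarrow> X = V)"
proof
  assume c: "cyclic_on \<sigma> V"
  show "\<forall>X\<subseteq>V. x \<in> X \<and> (\<forall>v\<in>V. v \<in> X \<longleftrightarrow> \<sigma> v \<in> X) \<longrightarrow> X = V"
  proof (intro allI impI)
    fix X assume X: "X \<subseteq> V" "x \<in> X \<and> (\<forall>v\<in>V. v \<in> X \<longleftrightarrow> \<sigma> v \<in> X)"
    have "y \<in> X" if "y \<in> orbit \<sigma> x" for y
      using that by (induction rule: orbit.induct) (use X x in blast)+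
    moreover have "V = orbit \<sigma> x" using c x by (auto simp: cyclic_on_alldef)
    ultimately show "X = V" using X(1) by blast
  qed
next
  assume *: "\<forall>X\<subseteq>V. x \<in> X \<and> (\<forall>v\<in>V. v \<in> X \<longleftrightarrow> \<sigma> v \<in> X) \<longrightarrow> X = V"
  have perm: "permutation \<sigma>" using \<sigma> V by (auto simp: permutation_permutes)
  have "x \<in> orbit \<sigma> x" by (rule permutation_self_in_orbit[OF perm])
  moreover have "orbit \<sigma> x \<subseteq> V" by (rule permutes_orbit_subset[OF \<sigma> x])
  moreover have "v \<in> orbit \<sigma> x \<longleftrightarrow> \<sigma> v \<in> orbit \<sigma> x" for v
    using cyclic_on_f_in[OF \<sigma> cyclic_on_orbit[OF \<sigma> V]] by (auto intro: orbit.step)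
  ultimately have "orbit \<sigma> x = V" using * by blast
  then show "cyclic_on \<sigma> V" unfolding cyclic_on_def using x by blast
qed

text \<open>Composing with the transposition of \<open>x\<close> and \<open>\<sigma> x\<close> takes \<open>x\<close> out of
  the cycle.\<close>

lemma sign_cyclic_perm:
  assumes "\<sigma> permutes V" "finite V" "cyclic_on \<sigma> V"
  shows "sign \<sigma> = (-1) ^ (card V - 1)"
  using assms
proof (induction "card V" arbitrary: \<sigma> V)
  case 0
  then show ?case by (auto simp: cyclic_on_def)
next
  case (Suc n)
  obtain x where x: "x \<in> V" using Suc.prems(3) by (auto simp: cyclic_on_def)
  have inj: "\<sigma> v = \<sigma> x \<longleftrightarrow> v = x" for v using inj_eq[OF permutes_inj[OF Suc.prems(1)]] .
  show ?case
  proof (cases "\<sigma> x = x")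
    case True
    have "{x} \<subseteq> V \<and> x \<in> {x} \<and> (\<forall>v\<in>V. v \<in> {x} \<longleftrightarrow> \<sigma> v \<in> {x})"
      using True x inj by simp
    then have "{x} = V" using cyclic_on_iff_invariant[OF Suc.prems(1,2) x] Suc.prems(3) by blast
    then have "\<sigma> = id" "card V = 1" using Suc.prems(1) by (auto simp: permutes_sing)
    then show ?thesis by simp
  next
    case False
    let ?y = "\<sigma> x" and ?\<tau> = "Transposition.transpose x (\<sigma> x) \<circ> \<sigma>"
    have yV: "?y \<in> V - {x}" using False x permutes_in_image[OF Suc.prems(1)] by auto
    have \<tau>V: "?\<tau> permutes V"
      using Suc.prems(1) x yV by (intro permutes_compose permutes_swap_id) auto
    have "?\<tau> x = x" by simp
    then have \<tau>: "?\<tau> permutes V - {x}"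
      using permutes_superset[OF \<tau>V, of "V - {x}"] x by auto
    have "cyclic_on ?\<tau> (V - {x})"
    proof (subst cyclic_on_iff_invariant[OF \<tau> _ yV])
      show "finite (V - {x})" using Suc.prems(2) by simp
      show "\<forall>X\<subseteq>V - {x}. ?y \<in> X \<and> (\<forall>v\<in>V - {x}. v \<in> X \<longleftrightarrow> ?\<tau> v \<in> X) \<longrightarrow> X = V - {x}"
      proof (intro allI impI)
        fix X assume X: "X \<subseteq> V - {x}" "?y \<in> X \<and> (\<forall>v\<in>V - {x}. v \<in> X \<longleftrightarrow> ?\<tau> v \<in> X)"
        have "v \<in> insert x X \<longleftrightarrow> \<sigma> v \<in> insert x X" if v: "v \<in> V" for v
        proof (cases "v = x")
          case False
          then have ne: "\<sigma> v \<noteq> ?y" using inj by simp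
          have vX: "v \<in> X \<longleftrightarrow> ?\<tau> v \<in> X" using X(2) v False by blast
          show ?thesis
          proof (cases "\<sigma> v = x")
            case True
            then have "?\<tau> v = ?y" by simp
            then show ?thesis using vX X(2) True by simp
          next
            case False
            then have "?\<tau> v = \<sigma> v" using ne by (simp add: transpose_apply_other)
            then show ?thesis using vX \<open>v \<noteq> x\<close> False by simp
          qed
        qed (use X(2) in simp)
        moreover have "insert x X \<subseteq> V" using X(1) x by blast
        ultimately have "insert x X = V"
          using cyclic_on_iff_invariant[OF Suc.prems(1,2) x] Suc.prems(3) by blast
        then show "X = V - {x}" using X(1) by blast
      qed
    qed
    moreover have "n = card (V - {x})" using Suc.hyps(2) x by simp
    ultimately have IH: "sign ?\<tau> = (-1) ^ (card (V - {x}) - 1)"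
      using Suc.hyps(1)[of "V - {x}" ?\<tau>] \<tau> Suc.prems(2) by simp
    have perm: "permutation \<sigma>" using Suc.prems by (auto simp: permutation_permutes)
    have "sign ?\<tau> = - sign \<sigma>"
      using False perm by (simp add: sign_compose permutation_swap_id sign_swap_id)
    moreover have "card (V - {x}) > 0" using yV Suc.prems(2) by (auto simp: card_gt_0_iff)
    then obtain k where "card (V - {x}) = Suc k" by (metis Suc_pred)
    moreover have "card V = Suc (card (V - {x}))" using Suc.prems(2) x by (rule card.remove)
    ultimately show ?thesis using IH by simp
  qed
qed

section \<open>Fields as polynomials in the edge variables\<close>

lemma sum_Pow_singletons:
  fixes x :: "'a \<Rightarrow> 'b::comm_ring_1"
  assumes "finite U"
  shows "(\<Sum>S\<in>Pow U. of_bool (card S = 1) * (\<Prod>f\<in>S. x f)) = (\<Sum>f\<in>U. x f)"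
proof -
  have "(\<Sum>f\<in>U. x f) = (\<Sum>S\<in>(\<lambda>f. {f}) ` U. of_bool (card S = 1) * (\<Prod>f\<in>S. x f))"
    by (simp add: sum.reindex)
  also have "\<dots> = (\<Sum>S\<in>Pow U. of_bool (card S = 1) * (\<Prod>f\<in>S. x f))"
    using assms by (intro sum.mono_neutral_left) (auto simp: card_1_singleton_iff)
  finally show ?thesis ..
qed

text \<open>If the variables are idempotent, the right-hand side is the indicator of exactly one of them being
  \<open>1\<close>; if they have square zero, it is \<open>(\<Sum>f\<in>U. x f) * (\<Prod>f\<in>U. 1 - x
  f)\<close>. So one polynomial serves for leaves of a tree and for \<open>X\<^sub>v Y\<^sub>v\<close>.\<close>

lemma sum_Pow_exactly_one:
  fixes x :: "'a \<Rightarrow> 'b::comm_ring_1"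
  assumes U: "finite U"
  shows "(\<Sum>S\<in>Pow U. - ((-1) ^ card S * of_nat (card S)) * (\<Prod>f\<in>S. x f)) =
    (\<Sum>f\<in>U. x f * (\<Prod>g\<in>U - {f}. 1 - x g))"
proof -
  have "(\<Sum>f\<in>U. x f * (\<Prod>g\<in>U - {f}. 1 - x g)) =
      (\<Sum>f\<in>U. \<Sum>S\<in>Pow (U - {f}). x f * ((-1) ^ card S * (\<Prod>g\<in>S. x g)))"
    using U by (simp add: prod_one_minus sum_distrib_left)
  also have "\<dots> = (\<Sum>f\<in>U. \<Sum>S | S \<in> Pow U \<and> f \<in> S. - ((-1) ^ card S) * (\<Prod>g\<in>S. x g))"
  proof (rule sum.cong[OF refl])
    fix f assume f: "f \<in> U"
    show "(\<Sum>S\<in>Pow (U - {f}). x f * ((-1) ^ card S * (\<Prod>g\<in>S. x g))) =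
        (\<Sum>S | S \<in> Pow U \<and> f \<in> S. - ((-1) ^ card S) * (\<Prod>g\<in>S. x g))"
    proof (rule sum.reindex_bij_witness[of _ "\<lambda>S. S - {f}" "insert f"])
      fix S assume S: "S \<in> Pow (U - {f})"
      then have "f \<notin> S" "finite S" using U finite_subset by auto
      then show "- ((-1) ^ card (insert f S)) * (\<Prod>g\<in>insert f S. x g) = x f * ((-1) ^ card S * (\<Prod>g\<in>S. x g))"
        by (simp add: mult_ac)
    qed (use f in auto)
  qed
  also have "\<dots> = (\<Sum>S\<in>Pow U. \<Sum>f | f \<in> U \<and> f \<in> S. - ((-1) ^ card S) * (\<Prod>g\<in>S. x g))"
    using U by (intro sum.swap_restrict) auto
  also have "\<dots> = (\<Sum>S\<in>Pow U. - ((-1) ^ card S * of_nat (card S)) * (\<Prod>f\<in>S. x f))"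
  proof (rule sum.cong[OF refl])
    fix S assume "S \<in> Pow U"
    then have "{f. f \<in> U \<and> f \<in> S} = S" by blast
    then show "(\<Sum>f | f \<in> U \<and> f \<in> S. - ((-1) ^ card S) * (\<Prod>g\<in>S. x g)) =
        - ((-1) ^ card S * of_nat (card S)) * (\<Prod>f\<in>S. x f)" by (simp add: mult_ac)
  qed
  finally show ?thesis ..
qed

lemma sum_exactly_one_of_bool:
  assumes U: "finite U"
  shows "(\<Sum>f\<in>U. of_bool (P f) * (\<Prod>g\<in>U - {f}. 1 - of_bool (P g))) = (of_bool (card {f \<in> U. P f} = 1) :: real)"
proof -
  have "of_bool (P f) * (\<Prod>g\<in>U - {f}. 1 - of_bool (P g)) = (of_bool ({g \<in> U. P g} = {f}) :: real)" if "f \<in> U" for f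
  proof -
    have "(1::real) - of_bool b = of_bool (\<not> b)" for b by simp
    then have "(\<Prod>g\<in>U - {f}. (1::real) - of_bool (P g)) = of_bool (\<forall>g\<in>U - {f}. \<not> P g)"
      using U by simp
    then show ?thesis using that by auto
  qed
  then have *: "(\<Sum>f\<in>U. of_bool (P f) * (\<Prod>g\<in>U - {f}. 1 - of_bool (P g))) =
      (\<Sum>f\<in>U. of_bool ({g \<in> U. P g} = {f}) :: real)" by (intro sum.cong) auto
  show ?thesis
  proof (cases "card {f \<in> U. P f} = 1")
    case True
    then obtain h where h: "{f \<in> U. P f} = {h}" by (auto simp: card_1_singleton_iff)
    then have "h \<in> U" by blast
    have "(\<Sum>f\<in>U. of_bool ({g \<in> U. P g} = {f}) :: real) = (\<Sum>f\<in>U. if f = h then 1 else 0)"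
      unfolding h by (intro sum.cong) auto
    then show ?thesis unfolding * using True U \<open>h \<in> U\<close> by simp
  next
    case False
    then have "{g \<in> U. P g} \<noteq> {f}" for f by auto
    then show ?thesis unfolding * using False by simp
  qed
qed

lemma edges_fromE:
  assumes "f \<in> edges_from B"
  obtains v e where "f = (v, v + e)" "v \<in> B" "e \<in> unit_dirs"
  using assms unfolding edges_from_def by blast

lemma edges_fromI: "v \<in> B \<Longrightarrow> e \<in> unit_dirs \<Longrightarrow> (v, v + e) \<in> edges_from B"
  unfolding edges_from_def by blast

lemma finite_edges_from_single [simp]: "finite (edges_from {v})"
  by (rule finite_edges_from) simp

lemma edges_from_single_disjoint: "u \<noteq> v \<Longrightarrow> edges_from {u} \<inter> edges_from {v} = {}"
  unfolding edges_from_def by blast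

lemma edges_at_edges_from: "E \<subseteq> edges_from B \<Longrightarrow> edges_at E v \<subseteq> edges_from {v}"
proof
  fix f assume E: "E \<subseteq> edges_from B" and "f \<in> edges_at E v"
  then have f: "f \<in> edges_from B" "fst f = v" unfolding edges_at_def by blast+
  from f(1) obtain u e where "f = (u, u + e)" "e \<in> unit_dirs" by (rule edges_fromE)
  then show "f \<in> edges_from {v}" using f(2) edges_fromI[of v "{v}" e] by simp
qed

text \<open>Choosing an edge set at each site is the same as choosing an edge set over \<open>B\<close>.\<close>

lemma prod_sites_expand:
  fixes x :: "dedge \<Rightarrow> 'b::comm_ring_1" and c :: "dedge set \<Rightarrow> 'b"
  assumes "finite B"
  shows "(\<Prod>v\<in>B. \<Sum>S\<in>Pow (edges_from {v}). c S * (\<Prod>f\<in>S. x f)) =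
    (\<Sum>E\<in>Pow (edges_from B). (\<Prod>v\<in>B. c (edges_at E v)) * (\<Prod>f\<in>E. x f))"
proof -
  let ?U = "\<lambda>v. Pow (edges_from {v})"
  have "(\<Prod>v\<in>B. \<Sum>S\<in>?U v. c S * (\<Prod>f\<in>S. x f)) =
      (\<Sum>p\<in>PiE B ?U. \<Prod>v\<in>B. c (p v) * (\<Prod>f\<in>p v. x f))"
    using assms finite_edges_from by (intro prod_sum_PiE) auto
  also have "\<dots> = (\<Sum>E\<in>Pow (edges_from B). (\<Prod>v\<in>B. c (edges_at E v)) * (\<Prod>f\<in>E. x f))"
  proof (rule sum.reindex_bij_witness[of _ "\<lambda>E. \<lambda>v\<in>B. edges_at E v" "\<lambda>p. \<Union>v\<in>B. p v"])
    fix p assume p: "p \<in> PiE B ?U"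
    have pv: "p v \<subseteq> edges_from {v}" if "v \<in> B" for v using p that by auto
    have at: "edges_at (\<Union>v\<in>B. p v) v = p v" if "v \<in> B" for v
    proof (intro equalityI subsetI)
      fix f assume "f \<in> edges_at (\<Union>v\<in>B. p v) v"
      then obtain u where u: "u \<in> B" "f \<in> p u" "fst f = v" unfolding edges_at_def by blast
      have "fst f = u" using fst_edges_from[OF subsetD[OF pv[OF u(1)] u(2)]] by simp
      then show "f \<in> p v" using u by simp
    next
      fix f assume f: "f \<in> p v"
      have "fst f = v" using fst_edges_from[OF subsetD[OF pv[OF that] f]] by simp
      then show "f \<in> edges_at (\<Union>v\<in>B. p v) v" using f that unfolding edges_at_def by blast
    qed
    then show "(\<lambda>v\<in>B. edges_at (\<Union>v\<in>B. p v) v) = p"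
      using p by (intro ext) (auto simp: PiE_def extensional_def)
    show "(\<Union>v\<in>B. p v) \<in> Pow (edges_from B)" 
    proof
      show "(\<Union>v\<in>B. p v) \<subseteq> edges_from B"
      proof (rule UN_least)
        fix v assume "v \<in> B"
        then have "edges_from {v} \<subseteq> edges_from B" unfolding edges_from_def by blast
        then show "p v \<subseteq> edges_from B" using pv[OF \<open>v \<in> B\<close>] by simp
      qed
    qed
    have "(\<Prod>f\<in>(\<Union>v\<in>B. p v). x f) = (\<Prod>v\<in>B. \<Prod>f\<in>p v. x f)"
    proof (rule prod.UNION_disjoint[OF assms])
      show "\<forall>v\<in>B. finite (p v)" using finite_subset[OF pv finite_edges_from_single] by simp
      show "\<forall>u\<in>B. \<forall>v\<in>B. u \<noteq> v \<longrightarrow> p u \<inter> p v = {}"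
      proof (intro ballI impI)
        fix u v assume "u \<in> B" "v \<in> B" "u \<noteq> v"
        then show "p u \<inter> p v = {}"
          using Int_mono[OF pv[of u] pv[of v]] edges_from_single_disjoint[of u v] by simp
      qed
    qed
    then show "(\<Prod>v\<in>B. c (edges_at (\<Union>v\<in>B. p v) v)) * (\<Prod>f\<in>(\<Union>v\<in>B. p v). x f) =
        (\<Prod>v\<in>B. c (p v) * (\<Prod>f\<in>p v. x f))"
      by (simp add: at prod.distrib)
  next
    fix E assume E: "E \<in> Pow (edges_from B)"
    show "(\<lambda>v\<in>B. edges_at E v) \<in> PiE B ?U"
    proof (rule restrict_PiE[THEN iffD2], rule Pi_I)
      show "edges_at E v \<in> ?U v" for v using edges_at_edges_from[of E B v] E by simp
    qed
    have "f \<in> (\<Union>v\<in>B. (\<lambda>v\<in>B. edges_at E v) v)" if "f \<in> E" for f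
      using that E fst_edges_from[of f B] by (intro UN_I[of "fst f"]) (auto simp: edges_at_def)
    moreover have "(\<Union>v\<in>B. (\<lambda>v\<in>B. edges_at E v) v) \<subseteq> E" by (auto simp: edges_at_def)
    ultimately show "(\<Union>v\<in>B. (\<lambda>v\<in>B. edges_at E v) v) = E" by blast
  qed
  finally show ?thesis .
qed

text \<open>Coefficients of \<open>deg T / 6\<close> and of the leaf indicator divided by \<open>6\<close>, as polynomials in the edge
  variables at a site.\<close>

definition degree_coeff :: "dedge set \<Rightarrow> real" where
  "degree_coeff S = of_bool (card S = 1) / 6"

definition leaf_coeff :: "dedge set \<Rightarrow> real" where
  "leaf_coeff S = 1 / 6 * - ((-1) ^ card S * real (card S))"

definition site_poly :: "(dedge set \<Rightarrow> real) \<Rightarrow> point \<Rightarrow> gen even_grassmann" where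
  "site_poly a v = (\<Sum>S\<in>Pow (edges_from {v}). of_real (a S) * (\<Prod>f\<in>S. zeta f))"

lemma sum_edges_from_single:
  "(\<Sum>f\<in>edges_from {v}. g f) = (\<Sum>e\<in>unit_dirs. g (v, v + e))"
proof -
  have "edges_from {v} = (\<lambda>e. (v, v + e)) ` unit_dirs" by (auto simp: edges_from_eq)
  then show ?thesis by (simp add: sum.reindex inj_on_def)
qed

lemma prod_edges_from_single:
  "(\<Prod>f\<in>edges_from {v}. g f) = (\<Prod>e\<in>unit_dirs. g (v, v + e))"
proof -
  have "edges_from {v} = (\<lambda>e. (v, v + e)) ` unit_dirs" by (auto simp: edges_from_eq)
  then show ?thesis by (simp add: prod.reindex inj_on_def)
qed

lemma site_poly_degree: "site_poly degree_coeff v = (1/6) *\<^sub>R (\<Sum>f\<in>edges_from {v}. zeta f)"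
proof -
  have "site_poly degree_coeff v = (1/6) *\<^sub>R (\<Sum>S\<in>Pow (edges_from {v}). of_bool (card S = 1) * (\<Prod>f\<in>S. zeta f))"
    unfolding site_poly_def degree_coeff_def scaleR_sum_right
    by (intro sum.cong refl) (auto simp: scaleR_conv_of_real)
  then show ?thesis by (simp only: sum_Pow_singletons[OF finite_edges_from_single])
qed

lemma X_field_eq: "X_field v = of_even (site_poly degree_coeff v)"
  by (simp add: X_field_def site_poly_degree sum_edges_from_single of_even_sum of_even_zeta)

lemma Y_field_eq: "Y_field v = of_even (\<Prod>f\<in>edges_from {v}. 1 - zeta f)"
proof -
  have "1 - grad psi e v * grad psibar e v = of_even (1 - zeta (v, v + e))" for e
    by (simp add: of_even_zeta)
  then show ?thesis
    unfolding Y_field_def prod_edges_from_single by (simp only: comm_prod_of_even)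
qed

text \<open>Since \<open>zeta f\<close> has square zero, the factor for \<open>f\<close> in the product over all edges may
  be inserted or dropped.\<close>

lemma site_poly_leaf:
  "site_poly leaf_coeff v = site_poly degree_coeff v * (\<Prod>f\<in>edges_from {v}. 1 - zeta f)"
proof -
  let ?U = "edges_from {v}"
  have "site_poly leaf_coeff v = (1/6) *\<^sub>R (\<Sum>S\<in>Pow ?U. - ((-1) ^ card S * of_nat (card S)) * (\<Prod>f\<in>S. zeta f))"
    unfolding site_poly_def leaf_coeff_def scaleR_sum_right
    by (simp only: scaleR_conv_of_real of_real_mult of_real_minus of_real_power of_real_1 of_real_of_nat_eq mult.assoc)
  also have "\<dots> = (1/6) *\<^sub>R (\<Sum>f\<in>?U. zeta f * (\<Prod>g\<in>?U - {f}. 1 - zeta g))"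
    by (simp only: sum_Pow_exactly_one[OF finite_edges_from_single])
  also have "(\<Sum>f\<in>?U. zeta f * (\<Prod>g\<in>?U - {f}. 1 - zeta g)) = (\<Sum>f\<in>?U. zeta f * (\<Prod>g\<in>?U. 1 - zeta g))"
  proof (rule sum.cong[OF refl])
    fix f assume f: "f \<in> ?U"
    have "zeta f * (\<Prod>g\<in>?U. 1 - zeta g) = zeta f * (1 - zeta f) * (\<Prod>g\<in>?U - {f}. 1 - zeta g)"
      using prod.remove[OF finite_edges_from_single f, of "\<lambda>g. 1 - zeta g"] by (simp add: mult.assoc)
    also have "zeta f * (1 - zeta f) = zeta f" by (simp add: right_diff_distrib zeta_square)
    finally show "zeta f * (\<Prod>g\<in>?U - {f}. 1 - zeta g) = zeta f * (\<Prod>g\<in>?U. 1 - zeta g)" by simp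
  qed
  finally show ?thesis by (simp add: site_poly_degree sum_distrib_right)
qed

lemma XY_field_eq: "X_field v * Y_field v = of_even (site_poly leaf_coeff v)"
  by (simp add: X_field_eq Y_field_eq site_poly_leaf)

context finite_domain
begin

lemma edges_from_within:
  assumes "B \<subseteq> lattice_interior L"
  shows "edges_from B \<subseteq> edges_within L"
proof
  fix f assume "f \<in> edges_from B"
  then obtain v e where "f = (v, v + e)" "v \<in> B" "e \<in> unit_dirs" by (rule edges_fromE)
  moreover have "v \<in> L" "v + e \<in> L" using assms calculation unfolding lattice_interior_def by blast+
  ultimately show "f \<in> edges_within L" by (simp add: edges_within_def)
qed

lemma fgff_prod_site_poly:
  assumes B: "B \<subseteq> lattice_interior L"
  shows "fgff L (of_even (\<Prod>v\<in>B. site_poly a v)) = det_moment a (transfer_current L) B"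
proof -
  have finB: "finite B" using B fin by (auto simp: lattice_interior_def intro: finite_subset)
  have "(\<Prod>v\<in>B. site_poly a v) = (\<Sum>E\<in>Pow (edges_from B). site_weight a B E *\<^sub>R (\<Prod>f\<in>E. zeta f))"
    unfolding site_poly_def prod_sites_expand[OF finB]
    by (simp add: site_weight_def scaleR_conv_of_real)
  then have "fgff L (of_even (\<Prod>v\<in>B. site_poly a v)) =
      (\<Sum>E\<in>Pow (edges_from B). site_weight a B E * fgff L (of_even (\<Prod>f\<in>E. zeta f)))"
    by (simp only: fgff_sum[OF fin] fgff_linear(2)[OF fin])
  also have "\<dots> = det_moment a (transfer_current L) B"
    unfolding det_moment_def
  proof (intro sum.cong refl arg_cong2[where f="(*)"])
    fix E assume E: "E \<in> Pow (edges_from B)"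
    show "fgff L (of_even (\<Prod>f\<in>E. zeta f)) = det_on E (transfer_current L)"
    proof (rule fgff_prod_zeta)
      show "finite E" using E finite_edges_from[OF finB] finite_subset by auto
      show "E \<subseteq> edges_within L" using E edges_from_within[OF B] by blast
    qed
  qed
  finally show ?thesis .
qed

definition tree_poly :: "(dedge set \<Rightarrow> real) \<Rightarrow> point \<Rightarrow> point set set \<Rightarrow> real" where
  "tree_poly a v T = (\<Sum>S\<in>Pow (edges_from {v}). a S * (\<Prod>f\<in>S. of_bool (wired_pair f \<in> T)))"

lemma wired_pair_edges_from:
  assumes "B \<subseteq> L" "f \<in> edges_from B"
  shows "wired_pair f \<in> wired"
proof -
  obtain v e where f: "f = (v, v + e)" "v \<in> B" "e \<in> unit_dirs" using assms(2) by (auto simp: edges_from_def)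
  then show ?thesis
    using pair_in_wired_edges[OF lattice, of v "v + e"] assms(1) by (auto simp: wired_pair_def)
qed

text \<open>An edge has at most one end point in a set without neighbouring sites, so it can be directed in only one way.\<close>

lemma inj_wired_pair:
  assumes "\<And>u v. u \<in> B \<Longrightarrow> v \<in> B \<Longrightarrow> \<not> nn u v"
  shows "inj_on wired_pair (edges_from B)"
proof (rule inj_onI)
  fix f g assume f: "f \<in> edges_from B" and g: "g \<in> edges_from B" and eq: "wired_pair f = wired_pair g"
  obtain v e where v: "f = (v, v + e)" "v \<in> B" "e \<in> unit_dirs" using f by (auto simp: edges_from_def)
  obtain w e' where w: "g = (w, w + e')" "w \<in> B" "e' \<in> unit_dirs" using g by (auto simp: edges_from_def)
  have "v + e \<noteq> w" using assms[OF v(2) w(2)] v(3) nn_add_dir[of v e] by metis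
  then show "f = g" using eq v(1) w(1) by (auto simp: wired_pair_def doubleton_eq_iff)
qed

lemma tree_mean_prod_tree_poly:
  assumes B: "B \<subseteq> lattice_interior L" and indep: "\<And>u v. u \<in> B \<Longrightarrow> v \<in> B \<Longrightarrow> \<not> nn u v"
  shows "(\<Sum>T\<in>spanning_trees. \<Prod>v\<in>B. tree_poly a v T) / real (card spanning_trees) = det_moment a (transfer_current L) B"
proof -
  have BL: "B \<subseteq> L" using B by (auto simp: lattice_interior_def)
  have finB: "finite B" using BL fin finite_subset by blast
  have finE: "finite E" if "E \<in> Pow (edges_from B)" for E
    using that finite_edges_from[OF finB] finite_subset by auto
  have "(\<Sum>T\<in>spanning_trees. \<Prod>v\<in>B. tree_poly a v T) =
      (\<Sum>T\<in>spanning_trees. \<Sum>E\<in>Pow (edges_from B). site_weight a B E * of_bool (wired_pair ` E \<subseteq> T))"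
  proof (rule sum.cong[OF refl])
    fix T
    have "(\<Prod>f\<in>E. of_bool (wired_pair f \<in> T)) = (of_bool (wired_pair ` E \<subseteq> T) :: real)" if "E \<in> Pow (edges_from B)" for E
      using finE[OF that] by (auto simp: image_subset_iff)
    then show "(\<Prod>v\<in>B. tree_poly a v T) = (\<Sum>E\<in>Pow (edges_from B). site_weight a B E * of_bool (wired_pair ` E \<subseteq> T))"
      unfolding tree_poly_def prod_sites_expand[OF finB] site_weight_def by (intro sum.cong) auto
  qed
  also have "\<dots> = (\<Sum>E\<in>Pow (edges_from B). site_weight a B E * (\<Sum>T\<in>spanning_trees. of_bool (wired_pair ` E \<subseteq> T)))"
    unfolding sum_distrib_left by (rule sum.swap)
  also have "\<dots> = (\<Sum>E\<in>Pow (edges_from B). site_weight a B E * real (card {T \<in> spanning_trees. wired_pair ` E \<subseteq> T}))"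
    using finite_trees by (simp add: sum_of_bool_eq Int_def)
  finally have "(\<Sum>T\<in>spanning_trees. \<Prod>v\<in>B. tree_poly a v T) / real (card spanning_trees) =
      (\<Sum>E\<in>Pow (edges_from B). site_weight a B E * (real (card {T \<in> spanning_trees. wired_pair ` E \<subseteq> T}) / real (card spanning_trees)))"
    by (simp add: sum_divide_distrib)
  also have "\<dots> = det_moment a (transfer_current L) B"
    unfolding det_moment_def
  proof (intro sum.cong refl arg_cong2[where f="(*)"] card_trees_containing)
    fix E assume E: "E \<in> Pow (edges_from B)"
    show "finite E" by (rule finE[OF E])
    show "E \<subseteq> edges_within L" using E edges_from_within[OF B] by blast
    show "inj_on wired_pair E" using inj_on_subset[OF inj_wired_pair[OF indep]] E by blast
    show "wired_pair ` E \<subseteq> wired" using E wired_pair_edges_from[OF BL] by blast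
  qed
  finally show ?thesis .
qed

lemma edge_degree_tree:
  assumes "T \<subseteq> wired" "v \<in> L"
  shows "edge_degree T v = card {f \<in> edges_from {v}. wired_pair f \<in> T}"
proof -
  have "{d \<in> T. v \<in> d} = wired_pair ` {f \<in> edges_from {v}. wired_pair f \<in> T}"
  proof (intro equalityI subsetI)
    fix d assume d: "d \<in> {d \<in> T. v \<in> d}"
    then have "d \<in> (\<lambda>w. {v, w}) ` {w. nn v w}"
      using edges_at_vertex[OF lattice assms(2)] assms(1) by blast
    then obtain w where w: "d = {v, w}" "nn v w" by blast
    then have "(v, v + (w - v)) \<in> edges_from {v}" unfolding edges_from_def nn_def by blast
    then have "(v, w) \<in> edges_from {v}" by simp
    then show "d \<in> wired_pair ` {f \<in> edges_from {v}. wired_pair f \<in> T}"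
      using d w by (intro image_eqI[of _ _ "(v, w)"]) (auto simp: wired_pair_def)
  next
    fix d assume "d \<in> wired_pair ` {f \<in> edges_from {v}. wired_pair f \<in> T}"
    then show "d \<in> {d \<in> T. v \<in> d}" by (auto simp: wired_pair_def dest: fst_edges_from)
  qed
  moreover have "inj_on wired_pair {f \<in> edges_from {v}. wired_pair f \<in> T}"
    by (rule inj_on_subset[OF inj_wired_pair[of "{v}"]]) auto
  ultimately show ?thesis by (simp add: edge_degree_def card_image)
qed

lemma tree_poly_degree:
  assumes "T \<in> spanning_trees" "v \<in> L"
  shows "tree_poly degree_coeff v T = avg_degree v T"
proof -
  have "tree_poly degree_coeff v T =
      (1/6) * (\<Sum>S\<in>Pow (edges_from {v}). of_bool (card S = 1) * (\<Prod>f\<in>S. of_bool (wired_pair f \<in> T)))"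
    unfolding tree_poly_def degree_coeff_def sum_distrib_left by (intro sum.cong refl) simp
  also have "\<dots> = (1/6) * (\<Sum>f\<in>edges_from {v}. of_bool (wired_pair f \<in> T))"
    by (simp only: sum_Pow_singletons[OF finite_edges_from_single])
  also have "\<dots> = real (edge_degree T v) / 6"
    using assms by (subst edge_degree_tree) (auto simp: rooted_trees_def sum_of_bool_eq Int_def)
  finally show ?thesis by (simp add: avg_degree_def tree_degree_def edge_degree_def)
qed

lemma tree_poly_leaf:
  assumes "T \<in> spanning_trees" "v \<in> L"
  shows "tree_poly leaf_coeff v T = of_bool (edge_degree T v = 1) / 6"
proof -
  have "tree_poly leaf_coeff v T = (1/6) * (\<Sum>S\<in>Pow (edges_from {v}).
      - ((-1) ^ card S * of_nat (card S)) * (\<Prod>f\<in>S. of_bool (wired_pair f \<in> T)))"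
    unfolding tree_poly_def leaf_coeff_def sum_distrib_left by (intro sum.cong refl) simp
  also have "\<dots> = (1/6) * of_bool (card {f \<in> edges_from {v}. wired_pair f \<in> T} = 1)"
    by (simp only: sum_Pow_exactly_one[OF finite_edges_from_single] sum_exactly_one_of_bool[OF finite_edges_from_single])
  finally show ?thesis
    using assms by (subst edge_degree_tree) (auto simp: rooted_trees_def)
qed

lemma ust_moment:
  assumes B: "B \<subseteq> lattice_interior L" and indep: "\<And>u v. u \<in> B \<Longrightarrow> v \<in> B \<Longrightarrow> \<not> nn u v"
  shows "measure_pmf.expectation (ust L) (\<lambda>T. \<Prod>v\<in>B. avg_degree v T) = det_moment degree_coeff (transfer_current L) B"
proof -
  have BL: "B \<subseteq> L" using B by (auto simp: lattice_interior_def)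
  have "measure_pmf.expectation (ust L) (\<lambda>T. \<Prod>v\<in>B. avg_degree v T) =
      (\<Sum>T\<in>spanning_trees. \<Prod>v\<in>B. avg_degree v T) / real (card spanning_trees)"
    unfolding ust_def wired_trees using finite_trees card_trees_pos
    by (intro integral_pmf_of_set) (auto simp: card_gt_0_iff)
  also have "(\<Sum>T\<in>spanning_trees. \<Prod>v\<in>B. avg_degree v T) = (\<Sum>T\<in>spanning_trees. \<Prod>v\<in>B. tree_poly degree_coeff v T)"
    using BL by (intro sum.cong prod.cong refl) (auto simp: tree_poly_degree)
  finally show ?thesis using tree_mean_prod_tree_poly[OF B indep] by simp
qed

lemma pendant_set_interior:
  assumes B: "B \<subseteq> lattice_interior L" and indep: "\<And>u v. u \<in> B \<Longrightarrow> v \<in> B \<Longrightarrow> \<not> nn u v"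
  shows "pendant_set L wired B"
proof
  show "B \<subseteq> L" using B by (auto simp: lattice_interior_def)
  then show "1 \<le> edge_degree wired v" if "v \<in> B" for v
    using edge_degree_wired[OF lattice, of v] that by auto
  fix d assume "d \<in> wired"
  then obtain u w where "d = {u, w}" "nn u w" unfolding wired_edges_eq[OF lattice] by blast
  then show "\<not> d \<subseteq> B" using indep by blast
qed (use fin simple_wired in auto)

lemma sandpile_moment:
  assumes B: "B \<subseteq> lattice_interior L" and indep: "\<And>u v. u \<in> B \<Longrightarrow> v \<in> B \<Longrightarrow> \<not> nn u v" and ne: "L \<noteq> {}"
  shows "measure_pmf.expectation (sandpile_stationary L) (\<lambda>\<rho>. \<Prod>v\<in>B. height_one v \<rho>) =
    det_moment leaf_coeff (transfer_current L) B"
proof -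
  let ?R = "recurrent_sandpiles L"
  have BL: "B \<subseteq> L" using B by (auto simp: lattice_interior_def)
  have finB: "finite B" using BL fin finite_subset by blast
  have finR: "finite ?R" by (rule finite_recurrent_sandpiles[OF fin])
  have "measure_pmf.expectation (sandpile_stationary L) (\<lambda>\<rho>. \<Prod>v\<in>B. height_one v \<rho>) =
      (\<Sum>\<rho>\<in>?R. \<Prod>v\<in>B. height_one v \<rho>) / real (card ?R)"
    unfolding sandpile_stationary_uniform[OF fin ne] using finR max_config_recurrent[OF fin]
    by (intro integral_pmf_of_set) auto
  also have "(\<Sum>\<rho>\<in>?R. \<Prod>v\<in>B. height_one v \<rho>) = (\<Sum>\<rho>\<in>?R. of_bool (\<forall>v\<in>B. \<rho> v = 1))"
    using finB by (intro sum.cong) (auto simp: height_one_def)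
  also have "\<dots> = real (card {\<rho> \<in> ?R. \<forall>v\<in>B. \<rho> v = 1})"
    using finR by (simp add: sum_of_bool_eq Int_def)
  also have "\<dots> = real (card {T \<in> spanning_trees. \<forall>v\<in>B. edge_degree T v = 1}) / 6 ^ card B"
  proof -
    have "(\<Prod>v\<in>B. edge_degree wired v) = (\<Prod>v\<in>B. 6)"
      by (intro prod.cong refl edge_degree_wired[OF lattice] subsetD[OF BL])
    then have "6 ^ card B * card {\<rho> \<in> ?R. \<forall>v\<in>B. \<rho> v = 1} = card {T \<in> spanning_trees. \<forall>v\<in>B. edge_degree T v = 1}"
      using card_recurrent_all_one_eq_leaves[OF pendant_set_interior[OF B indep]]
      unfolding recurrent_sandpiles_eq[OF lattice] by simp
    from arg_cong[OF this, of real] show ?thesis by (simp add: field_simps)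
  qed
  also have "\<dots> = (\<Sum>T\<in>spanning_trees. \<Prod>v\<in>B. tree_poly leaf_coeff v T)"
  proof -
    have "(\<Prod>v\<in>B. tree_poly leaf_coeff v T) = of_bool (\<forall>v\<in>B. edge_degree T v = 1) / 6 ^ card B" if "T \<in> spanning_trees" for T
    proof -
      have "(\<Prod>v\<in>B. tree_poly leaf_coeff v T) = (\<Prod>v\<in>B. of_bool (edge_degree T v = 1) / 6)"
        using BL that by (intro prod.cong refl tree_poly_leaf) auto
      then show ?thesis using finB by (simp add: prod_dividef)
    qed
    then have "(\<Sum>T\<in>spanning_trees. \<Prod>v\<in>B. tree_poly leaf_coeff v T) =
        (\<Sum>T\<in>spanning_trees. of_bool (\<forall>v\<in>B. edge_degree T v = 1)) / 6 ^ card B"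
      by (simp add: sum_divide_distrib)
    then show ?thesis using finite_trees by (simp add: sum_of_bool_eq Int_def)
  qed
  finally show ?thesis using tree_mean_prod_tree_poly[OF B indep, of leaf_coeff] by (simp add: card_recurrent)
qed

lemma fgff_moment_X:
  "B \<subseteq> lattice_interior L \<Longrightarrow> fgff L (comm_prod X_field B) = det_moment degree_coeff (transfer_current L) B"
  using fgff_prod_site_poly[of B degree_coeff] by (simp add: X_field_eq[abs_def] comm_prod_of_even)

lemma fgff_moment_XY:
  "B \<subseteq> lattice_interior L \<Longrightarrow>
    fgff L (comm_prod (\<lambda>v. X_field v * Y_field v) B) = det_moment leaf_coeff (transfer_current L) B"
  using fgff_prod_site_poly[of B leaf_coeff] by (simp add: XY_field_eq comm_prod_of_even)

end

section \<open>The two cumulant formulas\<close>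

lemma det_cumulant_leaf:
  assumes "finite V"
  shows "det_cumulant leaf_coeff M V = (-1 / 6) ^ card V *
    (\<Sum>E | E \<subseteq> edges_from V \<and> (\<forall>v\<in>V. card (edges_at E v) \<ge> 1).
      edge_weight V E * (\<Sum>\<tau>\<in>connected_perms V E. of_int (sign \<tau>) * (\<Prod>f\<in>E. M f (\<tau> f))))"
proof -
  have w: "site_weight leaf_coeff V E = (-1 / 6) ^ card V * edge_weight V E" for E
  proof -
    have "leaf_coeff S = (-1 / 6) * ((-1) ^ card S * real (card S))" for S by (simp add: leaf_coeff_def)
    then show ?thesis
      unfolding site_weight_def edge_weight_def by (simp only: prod.distrib prod_constant)
  qed
  have "det_cumulant leaf_coeff M V =
      (\<Sum>E\<in>Pow (edges_from V). (-1 / 6) ^ card V * (edge_weight V E * (\<Sum>\<tau>\<in>connected_perms V E. perm_weight M E \<tau>)))"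
    unfolding det_cumulant_def w by (simp only: mult.assoc)
  also have "\<dots> = (\<Sum>E | E \<subseteq> edges_from V \<and> (\<forall>v\<in>V. card (edges_at E v) \<ge> 1).
      (-1 / 6) ^ card V * (edge_weight V E * (\<Sum>\<tau>\<in>connected_perms V E. perm_weight M E \<tau>)))"
  proof (rule sum.mono_neutral_right)
    show "finite (Pow (edges_from V))" using finite_edges_from[OF assms] by simp
    show "\<forall>E\<in>Pow (edges_from V) - {E. E \<subseteq> edges_from V \<and> (\<forall>v\<in>V. card (edges_at E v) \<ge> 1)}.
      (-1 / 6) ^ card V * (edge_weight V E * (\<Sum>\<tau>\<in>connected_perms V E. perm_weight M E \<tau>)) = 0"
    proof
      fix E assume "E \<in> Pow (edges_from V) - {E. E \<subseteq> edges_from V \<and> (\<forall>v\<in>V. card (edges_at E v) \<ge> 1)}"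
      then obtain v where "v \<in> V" "card (edges_at E v) = 0" by (auto simp: not_le)
      then have "edge_weight V E = 0" unfolding edge_weight_def using assms by (intro prod_zero) auto
      then show "(-1 / 6) ^ card V * (edge_weight V E * (\<Sum>\<tau>\<in>connected_perms V E. perm_weight M E \<tau>)) = 0" by simp
    qed
  qed auto
  finally show ?thesis by (simp add: perm_weight_def sum_distrib_left)
qed

definition section_edges :: "point set \<Rightarrow> (point \<Rightarrow> point) \<Rightarrow> dedge set" where
  "section_edges V \<eta> = (\<lambda>v. (v, v + \<eta> v)) ` V"

lemma edges_at_section:
  "v \<in> V \<Longrightarrow> edges_at (section_edges V \<eta>) v = {(v, v + \<eta> v)}"
  unfolding edges_at_def section_edges_def by auto

text \<open>With one edge at each site, permutations of the edges are permutations of the sites, and the invariance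
  conditions agree.\<close>

lemma sum_connected_section:
  assumes V: "finite V" "V \<noteq> {}" and \<eta>: "\<eta> \<in> V \<rightarrow>\<^sub>E unit_dirs"
  shows "(\<Sum>\<tau>\<in>connected_perms V (section_edges V \<eta>). perm_weight M (section_edges V \<eta>) \<tau>) =
    (\<Sum>\<sigma>\<in>cyclic_perms V. (-1) ^ (card V - 1) * (\<Prod>v\<in>V. M (v, v + \<eta> v) (\<sigma> v, \<sigma> v + \<eta> (\<sigma> v))))"
proof -
  let ?h = "\<lambda>v. (v, v + \<eta> v)" and ?E = "section_edges V \<eta>"
  obtain x where x: "x \<in> V" using V(2) by blast
  have inj: "inj_on ?h V" by (simp add: inj_on_def)
  have bij: "bij_betw ?h V ?E" using inj by (simp add: bij_betw_def section_edges_def)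
  have E: "?E \<subseteq> edges_from V"
    unfolding section_edges_def using \<eta> by (intro image_subsetI edges_fromI) auto
  have conn: "map_permutation V ?h \<sigma> \<in> connected_perms V ?E \<longleftrightarrow> \<sigma> \<in> cyclic_perms V" if \<sigma>: "\<sigma> permutes V" for \<sigma>
  proof -
    have p: "map_permutation V ?h \<sigma> permutes ?E" by (rule map_permutation_permutes[OF bij \<sigma>])
    have app: "map_permutation V ?h \<sigma> (v, v + \<eta> v) = (\<sigma> v, \<sigma> v + \<eta> (\<sigma> v))" if "v \<in> V" for v
      using map_permutation_apply[OF inj that, of \<sigma>] by simp
    have pres: "preserves_sites ?E (map_permutation V ?h \<sigma>) X \<longleftrightarrow> (\<forall>v\<in>V. v \<in> X \<longleftrightarrow> \<sigma> v \<in> X)" for X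
      unfolding preserves_sites_def section_edges_def by (simp add: app)
    have "map_permutation V ?h \<sigma> \<in> connected_perms V ?E \<longleftrightarrow> is_component V x ?E (map_permutation V ?h \<sigma>) V"
      using p multi_connected_iff_component[OF p E x] by (simp add: connected_perms_def)
    also have "\<dots> \<longleftrightarrow> (\<forall>X\<subseteq>V. x \<in> X \<and> (\<forall>v\<in>V. v \<in> X \<longleftrightarrow> \<sigma> v \<in> X) \<longrightarrow> X = V)"
      unfolding is_component_def pres using x permutes_in_image[OF \<sigma>] by auto
    also have "\<dots> \<longleftrightarrow> \<sigma> \<in> cyclic_perms V"
      using cyclic_on_iff_invariant[OF \<sigma> V(1) x] \<sigma> by (simp add: cyclic_perms_def)
    finally show ?thesis .
  qed
  have "bij_betw (map_permutation V ?h) (cyclic_perms V) (connected_perms V ?E)"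
  proof (rule bij_betw_subset[OF bij_betw_map_permutation[OF bij]])
    show "cyclic_perms V \<subseteq> {\<sigma>. \<sigma> permutes V}" by (auto simp: cyclic_perms_def)
    show "map_permutation V ?h ` cyclic_perms V = connected_perms V ?E"
    proof (intro equalityI subsetI)
      fix \<tau> assume "\<tau> \<in> map_permutation V ?h ` cyclic_perms V"
      then obtain \<sigma> where "\<sigma> \<in> cyclic_perms V" "\<tau> = map_permutation V ?h \<sigma>" by blast
      then show "\<tau> \<in> connected_perms V ?E" using conn[of \<sigma>] by (simp add: cyclic_perms_def)
    next
      fix \<tau> assume \<tau>: "\<tau> \<in> connected_perms V ?E"
      then have "\<tau> \<in> map_permutation V ?h ` {\<sigma>. \<sigma> permutes V}"
        using bij_betw_map_permutation[OF bij] by (simp add: bij_betw_def connected_perms_def)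
      then obtain \<sigma> where "\<sigma> permutes V" "\<tau> = map_permutation V ?h \<sigma>" by blast
      then show "\<tau> \<in> map_permutation V ?h ` cyclic_perms V" using conn \<tau> by blast
    qed
  qed
  then have "(\<Sum>\<tau>\<in>connected_perms V ?E. perm_weight M ?E \<tau>) =
      (\<Sum>\<sigma>\<in>cyclic_perms V. perm_weight M ?E (map_permutation V ?h \<sigma>))"
    by (rule sum.reindex_bij_betw[symmetric])
  also have "\<dots> = (\<Sum>\<sigma>\<in>cyclic_perms V. (-1) ^ (card V - 1) * (\<Prod>v\<in>V. M (v, v + \<eta> v) (\<sigma> v, \<sigma> v + \<eta> (\<sigma> v))))"
  proof (rule sum.cong[OF refl])
    fix \<sigma> assume "\<sigma> \<in> cyclic_perms V"
    then have \<sigma>: "\<sigma> permutes V" "cyclic_on \<sigma> V" by (auto simp: cyclic_perms_def)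
    have "sign (map_permutation V ?h \<sigma>) = (-1) ^ (card V - 1)"
      using sign_map_permutation[OF inj \<sigma>(1) V(1)] sign_cyclic_perm[OF \<sigma>(1) V(1) \<sigma>(2)] by simp
    moreover have "(\<Prod>f\<in>?E. M f (map_permutation V ?h \<sigma> f)) = (\<Prod>v\<in>V. M (?h v) (map_permutation V ?h \<sigma> (?h v)))"
      by (rule prod.reindex_bij_betw[OF bij, symmetric])
    moreover have "\<dots> = (\<Prod>v\<in>V. M (v, v + \<eta> v) (\<sigma> v, \<sigma> v + \<eta> (\<sigma> v)))"
      using map_permutation_apply[OF inj, of _ \<sigma>] by (intro prod.cong) auto
    ultimately show "perm_weight M ?E (map_permutation V ?h \<sigma>) =
        (-1) ^ (card V - 1) * (\<Prod>v\<in>V. M (v, v + \<eta> v) (\<sigma> v, \<sigma> v + \<eta> (\<sigma> v)))"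
      by (simp add: perm_weight_def)
  qed
  finally show ?thesis .
qed

text \<open>The coefficients vanish unless there is exactly one edge at every site; such edge sets are choices
  \<open>\<eta>\<close> of a direction at every site.\<close>

lemma det_cumulant_degree:
  assumes V: "finite V" "V \<noteq> {}"
  shows "det_cumulant degree_coeff M V = - ((-1 / 6) ^ card V) *
    (\<Sum>\<sigma>\<in>cyclic_perms V. \<Sum>\<eta>\<in>V \<rightarrow>\<^sub>E unit_dirs. \<Prod>v\<in>V. M (v, v + \<eta> v) (\<sigma> v, \<sigma> v + \<eta> (\<sigma> v)))"
proof -
  let ?k = "\<lambda>E. \<Sum>\<tau>\<in>connected_perms V E. perm_weight M E \<tau>"
  let ?P = "\<lambda>\<sigma> \<eta>. \<Prod>v\<in>V. M (v, v + \<eta> v) (\<sigma> v, \<sigma> v + \<eta> (\<sigma> v))"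
  have inj: "inj_on (section_edges V) (V \<rightarrow>\<^sub>E unit_dirs)"
  proof (rule inj_onI)
    fix \<eta> \<theta> assume e: "\<eta> \<in> V \<rightarrow>\<^sub>E unit_dirs" "\<theta> \<in> V \<rightarrow>\<^sub>E unit_dirs" "section_edges V \<eta> = section_edges V \<theta>"
    show "\<eta> = \<theta>"
    proof (rule PiE_ext[OF e(1,2)])
      fix v assume v: "v \<in> V"
      show "\<eta> v = \<theta> v" using edges_at_section[OF v, of \<eta>] edges_at_section[OF v, of \<theta>] e(3) by simp
    qed
  qed
  have one: "E \<in> section_edges V ` (V \<rightarrow>\<^sub>E unit_dirs)"
    if E: "E \<subseteq> edges_from V" and c: "\<And>v. v \<in> V \<Longrightarrow> card (edges_at E v) = 1" for E
  proof -
    have "\<exists>f. edges_at E v = {f}" if "v \<in> V" for v using c[OF that] by (simp add: card_1_singleton_iff)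
    then obtain g where g: "\<And>v. v \<in> V \<Longrightarrow> edges_at E v = {g v}" by metis
    define \<eta> where "\<eta> = (\<lambda>v\<in>V. snd (g v) - v)"
    have gv: "g v = (v, v + \<eta> v)" "\<eta> v \<in> unit_dirs" "g v \<in> E" if "v \<in> V" for v
    proof -
      have "g v \<in> edges_at E v" using g[OF that] by simp
      then have *: "g v \<in> E" "fst (g v) = v" by (auto simp: edges_at_def)
      then have "g v \<in> edges_from V" using E by blast
      then obtain u e where "g v = (u, u + e)" "e \<in> unit_dirs" by (auto simp: edges_from_def)
      then show "g v = (v, v + \<eta> v)" "\<eta> v \<in> unit_dirs" "g v \<in> E" using * that by (auto simp: \<eta>_def)
    qed
    have "E = section_edges V \<eta>"
    proof (intro equalityI subsetI)
      fix f assume f: "f \<in> E"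
      then have v: "fst f \<in> V" using E fst_edges_from by blast
      have "f \<in> edges_at E (fst f)" using f by (simp add: edges_at_def)
      then have "f = (fst f, fst f + \<eta> (fst f))" using g[OF v] gv(1)[OF v] by simp
      then show "f \<in> section_edges V \<eta>" unfolding section_edges_def using v by (rule image_eqI)
    next
      fix f assume "f \<in> section_edges V \<eta>"
      then obtain v where "v \<in> V" "f = (v, v + \<eta> v)" by (auto simp: section_edges_def)
      then show "f \<in> E" using gv[of v] by simp
    qed
    moreover have "\<eta> \<in> V \<rightarrow>\<^sub>E unit_dirs" using gv(2) by (auto simp: \<eta>_def)
    ultimately show ?thesis by blast
  qed
  have "det_cumulant degree_coeff M V = (\<Sum>E\<in>section_edges V ` (V \<rightarrow>\<^sub>E unit_dirs). site_weight degree_coeff V E * ?k E)"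
    unfolding det_cumulant_def
  proof (rule sum.mono_neutral_right)
    show "finite (Pow (edges_from V))" using finite_edges_from[OF V(1)] by simp
    show "section_edges V ` (V \<rightarrow>\<^sub>E unit_dirs) \<subseteq> Pow (edges_from V)"
    proof (intro image_subsetI PowI)
      fix \<eta> assume "\<eta> \<in> V \<rightarrow>\<^sub>E unit_dirs"
      then show "section_edges V \<eta> \<subseteq> edges_from V"
        unfolding section_edges_def by (intro image_subsetI edges_fromI) auto
    qed
    show "\<forall>E\<in>Pow (edges_from V) - section_edges V ` (V \<rightarrow>\<^sub>E unit_dirs). site_weight degree_coeff V E * ?k E = 0"
    proof
      fix E assume E: "E \<in> Pow (edges_from V) - section_edges V ` (V \<rightarrow>\<^sub>E unit_dirs)"
      then obtain v where "v \<in> V" "card (edges_at E v) \<noteq> 1" using one[of E] by blast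
      then have "site_weight degree_coeff V E = 0"
        unfolding site_weight_def using V(1) by (intro prod_zero bexI[of _ v]) (auto simp: degree_coeff_def)
      then show "site_weight degree_coeff V E * ?k E = 0" by simp
    qed
  qed
  also have "\<dots> = (\<Sum>\<eta>\<in>V \<rightarrow>\<^sub>E unit_dirs. site_weight degree_coeff V (section_edges V \<eta>) * ?k (section_edges V \<eta>))"
    by (simp add: sum.reindex[OF inj])
  also have "\<dots> = (\<Sum>\<eta>\<in>V \<rightarrow>\<^sub>E unit_dirs. \<Sum>\<sigma>\<in>cyclic_perms V. - ((-1 / 6) ^ card V) * ?P \<sigma> \<eta>)"
  proof (rule sum.cong[OF refl])
    fix \<eta> assume \<eta>: "\<eta> \<in> V \<rightarrow>\<^sub>E unit_dirs"
    have "site_weight degree_coeff V (section_edges V \<eta>) = (\<Prod>v\<in>V. 1 / 6)"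
      unfolding site_weight_def by (intro prod.cong refl) (simp add: edges_at_section degree_coeff_def)
    then have "site_weight degree_coeff V (section_edges V \<eta>) = (1 / 6) ^ card V" by simp
    moreover have "(1 / 6) ^ card V * (-1) ^ (card V - 1) = - ((-1 / 6 :: real) ^ card V)"
    proof -
      obtain n where n: "card V = Suc n" using V by (metis card_0_eq not0_implies_Suc)
      have "(-1 / 6 :: real) ^ Suc n = (-1) ^ Suc n * (1 / 6) ^ Suc n"
        by (simp only: power_mult_distrib[symmetric]) simp
      then show ?thesis unfolding n by simp
    qed
    ultimately show "site_weight degree_coeff V (section_edges V \<eta>) * ?k (section_edges V \<eta>) =
        (\<Sum>\<sigma>\<in>cyclic_perms V. - ((-1 / 6) ^ card V) * ?P \<sigma> \<eta>)"
      unfolding sum_connected_section[OF V \<eta>] sum_distrib_left by (simp only: mult.assoc[symmetric])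
  qed
  also have "\<dots> = (\<Sum>\<sigma>\<in>cyclic_perms V. \<Sum>\<eta>\<in>V \<rightarrow>\<^sub>E unit_dirs. - ((-1 / 6) ^ card V) * ?P \<sigma> \<eta>)"
    by (rule sum.swap)
  finally show ?thesis by (simp only: sum_distrib_left)
qed

theorem theorem5p1:
  fixes \<Lambda> V :: "point set" and n :: nat
  assumes "\<Lambda> \<subseteq> tri_lattice" and "finite \<Lambda>" and "lattice_connected \<Lambda>"
    and "n \<ge> 1" and "V \<subseteq> lattice_interior \<Lambda>" and "card V = n" and "good \<Lambda> V"
  shows
    "(joint_cumulant (ust \<Lambda>) avg_degree V = fgff_cumulant \<Lambda> X_field V \<and>
      fgff_cumulant \<Lambda> X_field V =
        - ((-1 / 6) ^ n) * (\<Sum>\<sigma>\<in>cyclic_perms V. \<Sum>\<eta>\<in>V \<rightarrow>\<^sub>E unit_dirs.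
            \<Prod>v\<in>V. mixed_diff (\<eta> v) (\<eta> (\<sigma> v)) (green \<Lambda>) v (\<sigma> v))) \<and>
     (joint_cumulant (sandpile_stationary \<Lambda>) height_one V =
        fgff_cumulant \<Lambda> (\<lambda>v. X_field v * Y_field v) V \<and>
      fgff_cumulant \<Lambda> (\<lambda>v. X_field v * Y_field v) V =
        (-1 / 6) ^ n * (\<Sum>E | E \<subseteq> edges_from V \<and> (\<forall>v\<in>V. card (edges_at E v) \<ge> 1).
          edge_weight V E * (\<Sum>\<tau>\<in>connected_perms V E.
            of_int (sign \<tau>) * (\<Prod>f\<in>E. transfer_current \<Lambda> f (\<tau> f)))))"
proof -
  interpret finite_domain \<Lambda> by (rule finite_domain.intro[OF assms(2,1)])
  let ?M = "transfer_current \<Lambda>"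
  have V: "finite V" "V \<noteq> {}" using assms(4,6) card.infinite by (fastforce, auto)
  have indep_sub: "\<not> nn u v" if "B \<subseteq> V" "u \<in> B" "v \<in> B" for B u v
    using assms(7) that unfolding good_def by blast
  have ne: "\<Lambda> \<noteq> {}" using V(2) assms(5) by (auto simp: lattice_interior_def)
  have sub: "B \<subseteq> lattice_interior \<Lambda>" if "B \<subseteq> V" for B using that assms(5) by blast
  have X: "fgff_cumulant \<Lambda> X_field V = det_cumulant degree_coeff ?M V"
    unfolding fgff_cumulant_def cumulant_det_moment[OF V, symmetric]
    by (rule cumulant_of_moments_cong) (rule fgff_moment_X[OF sub])
  have T: "joint_cumulant (ust \<Lambda>) avg_degree V = det_cumulant degree_coeff ?M V"
    unfolding joint_cumulant_def cumulant_det_moment[OF V, symmetric]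
    by (rule cumulant_of_moments_cong) (rule ust_moment[OF sub indep_sub])
  have XY: "fgff_cumulant \<Lambda> (\<lambda>v. X_field v * Y_field v) V = det_cumulant leaf_coeff ?M V"
    unfolding fgff_cumulant_def cumulant_det_moment[OF V, symmetric]
    by (rule cumulant_of_moments_cong) (rule fgff_moment_XY[OF sub])
  have H: "joint_cumulant (sandpile_stationary \<Lambda>) height_one V = det_cumulant leaf_coeff ?M V"
    unfolding joint_cumulant_def cumulant_det_moment[OF V, symmetric]
    by (rule cumulant_of_moments_cong) (rule sandpile_moment[OF sub indep_sub ne])
  have M: "?M (v, v + \<eta> v) (\<sigma> v, \<sigma> v + \<eta> (\<sigma> v)) = mixed_diff (\<eta> v) (\<eta> (\<sigma> v)) (green \<Lambda>) v (\<sigma> v)" for v \<eta> \<sigma>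
    by (simp add: transfer_current_def edge_dir_def)
  show ?thesis
    using X T XY H det_cumulant_degree[OF V, of ?M] det_cumulant_leaf[OF V(1), of ?M]
    by (simp only: M assms(6))
qed

end
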